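(* As $p\to\infty$ through the primes, the minimizing index of the doubled regular $p$-gon tends to infinity: $minind(X_p)\to\infty$.
   Context: $X_n$ ($n\ge 3$) is the metric space obtained by gluing two copies (front and back) of a regular Euclidean $n$-gon along their common boundary, with the induced length metric. A closed geodesic is a nonconstant, constant speed, locally length-minimizing closed curve $\gamma\colon S^1=[0,2\pi]/(0\sim 2\pi)\to \mathcal{M}$ in a metric space $(\mathcal{M},d_{\mathcal M})$; let $L$ be its length. For an integer $k\ge 2$, $\gamma$ is a $1/k$ geodesic if $d_{\mathcal M}(\gamma(t),\gamma(t+2\pi/k))=L/k$ for every $t\in S^1$. The minimizing index $minind(\mathcal{M})$ is the smallest integer $k\ge 2$ such that $\mathcal{M}$ admits a $1/k$ geodesic. *)

theory Defs
  imports "HOL-Analysis.Analysis" "HOL-Computational_Algebra.Primes"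
begin

section \<open>Curves, closed geodesics and the minimizing index\<close>

text \<open>The length of the restriction of a curve to \<open>[a, b]\<close>: the supremum over all partitions
  \<open>a = t 0 \<le> \<dots> \<le> t n = b\<close>.\<close>

definition curve_length :: "'a metric \<Rightarrow> (real \<Rightarrow> 'a) \<Rightarrow> real \<Rightarrow> real \<Rightarrow> ennreal" where
  "curve_length X \<gamma> a b =
     Sup {(\<Sum>i<n. ennreal (mdist X (\<gamma> (t i)) (\<gamma> (t (Suc i))))) |n t.
            t 0 = a \<and> t n = b \<and> (\<forall>i<n. t i \<le> t (Suc i))}"

text \<open>Competing curves may be taken to have the same parameter interval, since length is invariant
  under affine reparametrization.\<close>

definition length_minimizing_on :: "'a metric \<Rightarrow> (real \<Rightarrow> 'a) \<Rightarrow> real \<Rightarrow> real \<Rightarrow> bool" where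
  "length_minimizing_on X \<gamma> a b \<longleftrightarrow>
     (\<forall>\<sigma>. continuous_map (top_of_set {a..b}) (mtopology_of X) \<sigma> \<and> \<sigma> a = \<gamma> a \<and> \<sigma> b = \<gamma> b
        \<longrightarrow> curve_length X \<gamma> a b \<le> curve_length X \<sigma> a b)"

definition locally_length_minimizing :: "'a metric \<Rightarrow> (real \<Rightarrow> 'a) \<Rightarrow> bool" where
  "locally_length_minimizing X \<gamma> \<longleftrightarrow>
     (\<forall>t. \<exists>e>0. \<forall>a b. t - e \<le> a \<and> a \<le> b \<and> b \<le> t + e \<longrightarrow> length_minimizing_on X \<gamma> a b)"

definition constant_speed :: "'a metric \<Rightarrow> (real \<Rightarrow> 'a) \<Rightarrow> bool" where
  "constant_speed X \<gamma> \<longleftrightarrow>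
     (\<exists>c\<ge>0. \<forall>a b. a \<le> b \<longrightarrow> curve_length X \<gamma> a b = ennreal (c * (b - a)))"

text \<open>A closed curve on the circle \<open>[0, 2\<pi>]/(0 \<sim> 2\<pi>)\<close> is represented by its \<open>2\<pi>\<close>-periodic lift
  to the real line.\<close>

definition closed_curve :: "'a metric \<Rightarrow> (real \<Rightarrow> 'a) \<Rightarrow> bool" where
  "closed_curve X \<gamma> \<longleftrightarrow>
     continuous_map euclidean (mtopology_of X) \<gamma> \<and> (\<forall>t. \<gamma> (t + 2 * pi) = \<gamma> t)"

definition closed_geodesic :: "'a metric \<Rightarrow> (real \<Rightarrow> 'a) \<Rightarrow> bool" where
  "closed_geodesic X \<gamma> \<longleftrightarrow>
     closed_curve X \<gamma> \<and> (\<exists>s t. \<gamma> s \<noteq> \<gamma> t) \<and> constant_speed X \<gamma> \<and> locally_length_minimizing X \<gamma>"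

definition one_over_geodesic :: "'a metric \<Rightarrow> nat \<Rightarrow> (real \<Rightarrow> 'a) \<Rightarrow> bool" where
  "one_over_geodesic X k \<gamma> \<longleftrightarrow>
     closed_geodesic X \<gamma> \<and>
     (\<forall>t. ennreal (mdist X (\<gamma> t) (\<gamma> (t + 2 * pi / real k)))
            = curve_length X \<gamma> 0 (2 * pi) / of_nat k)"

definition minind :: "'a metric \<Rightarrow> nat" where
  "minind X = (LEAST k. 2 \<le> k \<and> (\<exists>\<gamma>. one_over_geodesic X k \<gamma>))"

section \<open>Doubled regular polygons\<close>

text \<open>The circumradius is normalized to 1.\<close>

definition regular_polygon :: "nat \<Rightarrow> complex set" where
  "regular_polygon n = convex hull ((\<lambda>j. cis (2 * pi * real j / real n)) ` {..<n})"

definition sheets :: "nat \<Rightarrow> (bool \<times> complex) set" where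
  "sheets n = UNIV \<times> regular_polygon n"

definition glue :: "nat \<Rightarrow> (bool \<times> complex) rel" where
  "glue n = {(x, y). x \<in> sheets n \<and> y \<in> sheets n \<and>
               (x = y \<or> snd x = snd y \<and> snd x \<in> frontier (regular_polygon n))}"

definition doubled_points :: "nat \<Rightarrow> (bool \<times> complex) set set" where
  "doubled_points n = sheets n // glue n"

text \<open>The length metric induced on the gluing is the quotient metric: the infimum of the lengths of
  all broken paths from \<open>X\<close> to \<open>Y\<close>, i.e. of finite sequences of jumps \<open>p i \<leadsto> q i\<close>, each inside
  a single sheet, where \<open>q i\<close> is glued to \<open>p (i + 1)\<close>.  Within one sheet, which is convex, the
  length metric is the Euclidean distance.\<close>

definition broken_path ::
  "nat \<Rightarrow> (bool \<times> complex) set \<Rightarrow> (bool \<times> complex) set \<Rightarrow>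
     nat \<Rightarrow> (nat \<Rightarrow> bool \<times> complex) \<Rightarrow> (nat \<Rightarrow> bool \<times> complex) \<Rightarrow> bool" where
  "broken_path n X Y m p q \<longleftrightarrow>
     p 0 \<in> X \<and> q m \<in> Y \<and>
     (\<forall>i\<le>m. p i \<in> sheets n \<and> q i \<in> sheets n \<and> fst (p i) = fst (q i)) \<and>
     (\<forall>i<m. (q i, p (Suc i)) \<in> glue n)"

definition broken_path_lengths ::
  "nat \<Rightarrow> (bool \<times> complex) set \<Rightarrow> (bool \<times> complex) set \<Rightarrow> real set" where
  "broken_path_lengths n X Y =
     {(\<Sum>i\<le>m. dist (snd (p i)) (snd (q i))) |m p q. broken_path n X Y m p q}"

definition doubled_dist :: "nat \<Rightarrow> (bool \<times> complex) set \<Rightarrow> (bool \<times> complex) set \<Rightarrow> real" where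
  "doubled_dist n X Y =
     (if X \<in> doubled_points n \<and> Y \<in> doubled_points n then Inf (broken_path_lengths n X Y) else 0)"

definition doubled_polygon :: "nat \<Rightarrow> (bool \<times> complex) set metric" where
  "doubled_polygon n = metric (doubled_points n, doubled_dist n)"

subsection \<open>The quotient distance is a metric\<close>

lemma equiv_glue: "equiv (sheets n) (glue n)"
  by (rule equivI) (auto simp: glue_def refl_on_def sym_def trans_def)

lemma glue_snd: "(x, y) \<in> glue n \<Longrightarrow> snd x = snd y"
  by (auto simp: glue_def)

lemma doubled_pointsE:
  assumes "X \<in> doubled_points n"
  obtains x where "x \<in> sheets n" "X = glue n `` {x}" "x \<in> X"
  using assms equiv_class_self[OF equiv_glue] unfolding doubled_points_def
  by (auto elim!: quotientE)

lemma doubled_points_glue: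
  assumes "X \<in> doubled_points n" "x \<in> X" "y \<in> X"
  shows "(x, y) \<in> glue n"
  using assms equiv_glue quotient_eq_iff unfolding doubled_points_def by fastforce

lemma broken_path_lengths_nonneg: "l \<in> broken_path_lengths n X Y \<Longrightarrow> 0 \<le> l"
  by (auto simp: broken_path_lengths_def intro: sum_nonneg)

lemma bdd_below_broken_path_lengths: "bdd_below (broken_path_lengths n X Y)"
  using broken_path_lengths_nonneg by (meson bdd_belowI)

lemma compact_regular_polygon: "compact (regular_polygon n)"
  unfolding regular_polygon_def by (intro finite_imp_compact_convex_hull) auto

lemma broken_path_lengths_nonempty:
  assumes "X \<in> doubled_points n" "Y \<in> doubled_points n"
  shows "broken_path_lengths n X Y \<noteq> {}"
proof -
  obtain x where x: "x \<in> sheets n" "x \<in> X" using assms(1) by (rule doubled_pointsE)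
  obtain y where y: "y \<in> sheets n" "y \<in> Y" using assms(2) by (rule doubled_pointsE)
  have "regular_polygon n \<noteq> {}" using x by (auto simp: sheets_def)
  moreover have "regular_polygon n \<noteq> UNIV"
    using compact_regular_polygon[of n] not_compact_UNIV by metis
  ultimately have "frontier (regular_polygon n) \<noteq> {}"
    using frontier_not_empty by blast
  then obtain b where b: "b \<in> frontier (regular_polygon n)" by blast
  have bP: "b \<in> regular_polygon n"
    using b compact_regular_polygon[of n] by (meson compact_imp_closed frontier_subset_closed subsetD)
  define p where "p i = (if i = 0 then x else (fst y, b))" for i :: nat
  define q where "q i = (if i = 0 then (fst x, b) else y)" for i :: nat
  have "broken_path n X Y 1 p q"
    using x y b bP unfolding broken_path_def p_def q_def
    by (auto simp: sheets_def glue_def)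
  then show ?thesis unfolding broken_path_lengths_def by blast
qed

lemma broken_path_dist_le:
  assumes "broken_path n X Y m p q" "i \<le> m"
  shows "dist (snd (p 0)) (snd (q i)) \<le> (\<Sum>j\<le>i. dist (snd (p j)) (snd (q j)))"
  using assms(2)
proof (induction i)
  case (Suc i)
  have "snd (q i) = snd (p (Suc i))"
    using assms(1) Suc.prems by (intro glue_snd[of _ _ n]) (auto simp: broken_path_def)
  with Suc dist_triangle[of "snd (p 0)" "snd (q (Suc i))" "snd (p (Suc i))"]
  show ?case by simp
qed simp

lemma broken_path_lengths_commute: "broken_path_lengths n X Y \<subseteq> broken_path_lengths n Y X"
proof
  fix l assume "l \<in> broken_path_lengths n X Y"
  then obtain m p q where l: "l = (\<Sum>i\<le>m. dist (snd (p i)) (snd (q i)))"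
    and bp: "broken_path n X Y m p q"
    unfolding broken_path_lengths_def by blast
  define p' where "p' i = q (m - i)" for i
  define q' where "q' i = p (m - i)" for i
  have "(q' i, p' (Suc i)) \<in> glue n" if "i < m" for i
  proof -
    have "(q (m - Suc i), p (Suc (m - Suc i))) \<in> glue n"
      using bp that by (auto simp: broken_path_def)
    then have "(p (m - i), q (m - Suc i)) \<in> glue n"
      using that by (auto simp: Suc_diff_Suc glue_def)
    then show ?thesis by (simp add: p'_def q'_def)
  qed
  then have "broken_path n Y X m p' q'"
    using bp unfolding broken_path_def by (auto simp: p'_def q'_def)
  moreover have "l = (\<Sum>i\<le>m. dist (snd (p' i)) (snd (q' i)))"
    unfolding l p'_def q'_def
    by (rule sum.reindex_bij_witness[of _ "\<lambda>i. m - i" "\<lambda>i. m - i"]) (auto simp: dist_commute)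
  ultimately show "l \<in> broken_path_lengths n Y X" unfolding broken_path_lengths_def by blast
qed

lemma broken_path_lengths_add:
  assumes Y: "Y \<in> doubled_points n"
    and l: "l \<in> broken_path_lengths n X Y" and l': "l' \<in> broken_path_lengths n Y Z"
  shows "l + l' \<in> broken_path_lengths n X Z"
proof -
  obtain m p q where l: "l = (\<Sum>i\<le>m. dist (snd (p i)) (snd (q i)))"
    and bp: "broken_path n X Y m p q"
    using l unfolding broken_path_lengths_def by blast
  obtain m' p' q' where l': "l' = (\<Sum>i\<le>m'. dist (snd (p' i)) (snd (q' i)))"
    and bp': "broken_path n Y Z m' p' q'"
    using l' unfolding broken_path_lengths_def by blast
  define P where "P i = (if i \<le> m then p i else p' (i - Suc m))" for i
  define Q where "Q i = (if i \<le> m then q i else q' (i - Suc m))" for i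
  have join: "(q m, p' 0) \<in> glue n"
    using bp bp' doubled_points_glue[OF Y] by (auto simp: broken_path_def)
  have "(Q i, P (Suc i)) \<in> glue n" if i: "i < Suc m + m'" for i
  proof -
    consider "i < m" | "i = m" | "m < i" by linarith
    then show ?thesis
    proof cases
      case 3
      then have "(q' (i - Suc m), p' (Suc (i - Suc m))) \<in> glue n"
        using bp' i by (auto simp: broken_path_def)
      with 3 show ?thesis by (simp add: P_def Q_def Suc_diff_Suc)
    qed (use bp join in \<open>auto simp: P_def Q_def broken_path_def\<close>)
  qed
  moreover have "P i \<in> sheets n \<and> Q i \<in> sheets n \<and> fst (P i) = fst (Q i)"
    if "i \<le> Suc m + m'" for i
    using bp bp' that by (auto simp: P_def Q_def broken_path_def)
  ultimately have "broken_path n X Z (Suc m + m') P Q"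
    using bp bp' unfolding broken_path_def by (auto simp: P_def Q_def)
  moreover have "(\<Sum>i\<le>Suc m + m'. dist (snd (P i)) (snd (Q i))) = l + l'"
  proof -
    have "(\<Sum>i\<le>Suc m + m'. dist (snd (P i)) (snd (Q i)))
      = (\<Sum>i<Suc m + Suc m'. dist (snd (P i)) (snd (Q i)))"
      by (simp add: lessThan_Suc_atMost)
    also have "\<dots> = (\<Sum>i<Suc m. dist (snd (P i)) (snd (Q i)))
      + (\<Sum>i<Suc m'. dist (snd (P (Suc m + i))) (snd (Q (Suc m + i))))"
      by (induction m') (auto simp: add.assoc)
    also have "\<dots> = l + l'"
      unfolding l l' lessThan_Suc_atMost by (intro arg_cong2[of _ _ _ _ "(+)"] sum.cong) (auto simp: P_def Q_def)
    finally show ?thesis .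
  qed
  ultimately show ?thesis
    unfolding broken_path_lengths_def mem_Collect_eq
    by (intro exI[of _ "Suc m + m'"] exI[of _ P] exI[of _ Q]) simp
qed

lemma doubled_dist_eq_0:
  assumes X: "X \<in> doubled_points n" and Y: "Y \<in> doubled_points n" and 0: "doubled_dist n X Y = 0"
  shows "X = Y"
proof -
  obtain x where x: "x \<in> sheets n" "X = glue n `` {x}" "x \<in> X" using X by (rule doubled_pointsE)
  obtain y where y: "y \<in> sheets n" "Y = glue n `` {y}" "y \<in> Y" using Y by (rule doubled_pointsE)
  have small: "c \<le> 0" if "\<And>l. l \<in> broken_path_lengths n X Y \<Longrightarrow> c \<le> l" for c
    using cInf_greatest[OF broken_path_lengths_nonempty[OF X Y], of c] that 0 X Y
    by (simp add: doubled_dist_def)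
  have start: "snd (p 0) = snd x" and stop: "snd (q m) = snd y"
    if "broken_path n X Y m p q" for m p q
    using that X Y x y by (auto simp: broken_path_def dest: glue_snd)
  have "dist (snd x) (snd y) \<le> 0"
  proof (rule small)
    fix l assume "l \<in> broken_path_lengths n X Y"
    then obtain m p q where "l = (\<Sum>i\<le>m. dist (snd (p i)) (snd (q i)))"
      "broken_path n X Y m p q"
      unfolding broken_path_lengths_def by blast
    then show "dist (snd x) (snd y) \<le> l"
      using broken_path_dist_le[of n X Y m p q m] start stop by fastforce
  qed
  then have eq: "snd x = snd y" by simp
  have "(x, y) \<in> glue n"
  proof (rule ccontr)
    assume not: "(x, y) \<notin> glue n"
    let ?F = "frontier (regular_polygon n)"
    have notF: "snd x \<notin> ?F" and fst: "fst x \<noteq> fst y"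
      using not x y eq by (auto simp: glue_def prod_eq_iff)
    have ends: "p 0 = x" "q m = y" if "broken_path n X Y m p q" for m p q
      using that x y notF eq by (auto simp: broken_path_def glue_def)
    have cross: "\<exists>i\<le>m. snd (q i) \<in> ?F" if bp: "broken_path n X Y m p q" for m p q
    proof (rule ccontr)
      assume no: "\<not> (\<exists>i\<le>m. snd (q i) \<in> ?F)"
      have "fst (q i) = fst x" if "i \<le> m" for i
        using that
      proof (induction i)
        case 0
        then show ?case using bp ends[OF bp] by (metis broken_path_def)
      next
        case (Suc i)
        then have "(q i, p (Suc i)) \<in> glue n" "snd (q i) \<notin> ?F"
          using bp no by (auto simp: broken_path_def)
        then have "q i = p (Suc i)" by (auto simp: glue_def)
        then show ?case using Suc bp by (auto simp: broken_path_def)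
      qed
      then show False using ends[OF bp] fst by auto
    qed
    have "infdist (snd x) ?F \<le> 0"
    proof (rule small)
      fix l assume "l \<in> broken_path_lengths n X Y"
      then obtain m p q where l: "l = (\<Sum>i\<le>m. dist (snd (p i)) (snd (q i)))"
        and bp: "broken_path n X Y m p q"
        unfolding broken_path_lengths_def by blast
      obtain i where i: "i \<le> m" "snd (q i) \<in> ?F" using cross[OF bp] by blast
      have "infdist (snd x) ?F \<le> dist (snd (p 0)) (snd (q i))"
        using infdist_le[OF i(2)] start[OF bp] by simp
      also have "\<dots> \<le> (\<Sum>j\<le>i. dist (snd (p j)) (snd (q j)))"
        by (rule broken_path_dist_le[OF bp i(1)])
      also have "\<dots> \<le> l"
        unfolding l using i(1) by (intro sum_mono2) auto
      finally show "infdist (snd x) ?F \<le> l" .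
    qed
    moreover obtain m p q where "broken_path n X Y m p q"
      using broken_path_lengths_nonempty[OF X Y] unfolding broken_path_lengths_def by blast
    then have "?F \<noteq> {}" using cross by blast
    ultimately have "snd x \<in> ?F"
      using in_closed_iff_infdist_zero[OF frontier_closed] infdist_nonneg
      by (metis order_antisym)
    then show False using notF by simp
  qed
  then show ?thesis using x y equiv_class_eq[OF equiv_glue] by metis
qed

lemma Metric_space_doubled: "Metric_space (doubled_points n) (doubled_dist n)"
proof
  show "0 \<le> doubled_dist n X Y" for X Y
    using broken_path_lengths_nonempty broken_path_lengths_nonneg
    by (auto simp: doubled_dist_def intro: cInf_greatest)
  show "doubled_dist n X Y = doubled_dist n Y X" for X Y
    using broken_path_lengths_commute[of n X Y] broken_path_lengths_commute[of n Y X]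
    by (simp add: doubled_dist_def)
next
  fix X Y assume X: "X \<in> doubled_points n" and Y: "Y \<in> doubled_points n"
  have "doubled_dist n X X \<le> 0"
  proof -
    obtain x where x: "x \<in> sheets n" "x \<in> X" using X by (rule doubled_pointsE)
    then have "broken_path n X X 0 (\<lambda>_. x) (\<lambda>_. x)" by (simp add: broken_path_def)
    then have "0 \<in> broken_path_lengths n X X"
      unfolding broken_path_lengths_def mem_Collect_eq
      by (intro exI[of _ 0] exI[of _ "\<lambda>_. x"]) simp
    then show ?thesis
      using X cInf_lower[OF _ bdd_below_broken_path_lengths] by (simp add: doubled_dist_def)
  qed
  moreover have "0 \<le> doubled_dist n X X"
    using broken_path_lengths_nonempty broken_path_lengths_nonneg
    by (auto simp: doubled_dist_def intro: cInf_greatest)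
  ultimately show "doubled_dist n X Y = 0 \<longleftrightarrow> X = Y"
    using doubled_dist_eq_0[OF X Y] by auto
next
  fix X Y Z
  assume X: "X \<in> doubled_points n" and Y: "Y \<in> doubled_points n" and Z: "Z \<in> doubled_points n"
  let ?L = "broken_path_lengths n"
  have *: "Inf (?L X Z) \<le> l + l'" if "l \<in> ?L X Y" "l' \<in> ?L Y Z" for l l'
    using cInf_lower[OF broken_path_lengths_add[OF Y that] bdd_below_broken_path_lengths] .
  have "Inf (?L X Z) - l' \<le> Inf (?L X Y)" if "l' \<in> ?L Y Z" for l'
    using *[OF _ that] by (intro cInf_greatest broken_path_lengths_nonempty X Y) (simp add: diff_le_eq)
  then have "Inf (?L X Z) - Inf (?L X Y) \<le> Inf (?L Y Z)"
    by (intro cInf_greatest broken_path_lengths_nonempty Y Z) (simp add: algebra_simps)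
  then show "doubled_dist n X Z \<le> doubled_dist n X Y + doubled_dist n Y Z"
    using X Y Z by (simp add: doubled_dist_def)
qed

lemma mspace_doubled_polygon [simp]: "mspace (doubled_polygon n) = doubled_points n"
  unfolding doubled_polygon_def by (rule Metric_space.mspace_metric[OF Metric_space_doubled])

lemma mdist_doubled_polygon [simp]: "mdist (doubled_polygon n) = doubled_dist n"
  unfolding doubled_polygon_def by (rule Metric_space.mdist_metric[OF Metric_space_doubled])

end

theory Submission
  imports Defs "HOL-Real_Asymp.Real_Asymp"
begin

text \<open>Let \<open>\<gamma>\<close> be a \<open>1/k\<close> geodesic on the doubled regular \<open>p\<close>-gon, of length \<open>k l\<close>.  Points of the same sheet
  are joined by Euclidean segments, so a minimizing piece of length \<open>l\<close> crosses the boundary at most once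
  in its interior; hence \<open>\<gamma>\<close> is a billiard trajectory with \<open>N \<le> k\<close> bounces, and \<open>N\<close> is even because sheets alternate.
  The squared distance between opposite sheets is at most \<open>|x - y|\<^sup>2 + 4 h x * h y\<close> for the heights
  \<open>h\<close> over any edge.  The edge that is crossed gives the law of reflection; its two neighbours show that,
  in units of half an edge, the bounce is at distance \<open>|v| \<le> 1 - \<eta>\<close> from the midpoint of the edge, where
  \<open>\<eta>\<close> depends only on \<open>k\<close>.
  If \<open>d i\<close> is the number of edges between consecutive bounces, then up to \<open>O(1/p)\<close> the law of reflection
  reads \<open>v (i + 1) + 2 v i + v (i - 1) = 2 (d (i - 1) - d i)\<close>.  Modulo 2 the solutions are
  \<open>(-1)^i (\<alpha> + \<beta> i)\<close>, and as \<open>v\<close> avoids a neighbourhood of \<open>1\<close>, the integers \<open>d i\<close> are given by rounding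
  and are insensitive to the error.  A parity argument then makes \<open>\<Sum>d\<close> over a period equal to \<open>N h\<close> with
  an integer \<open>0 < h < p\<close>; but the trajectory closes up, so \<open>p\<close> divides this sum, which is impossible
  for a prime \<open>p > k\<close>.
  Finally every doubled odd polygon carries some \<open>1/k\<close> geodesic, namely a trajectory with four bounces.\<close>

section \<open>Rounding and parity\<close>

text \<open>The bound on \<open>v\<close> pins an integer sequence to the rounding of an arithmetic
  progression, whose symmetry under the shift by its period \<open>q\<close> survives rounding. A
  parity argument makes \<open>q\<close> odd, and pairing the indices \<open>i\<close> and
  \<open>i + q\<close> gives the constant \<open>h\<close>. Writing \<open>h\<close> through two
  values of \<open>\<psi>\<close> lets it be bounded later.\<close>

lemma rounding_rigidity:
  fixes \<psi> v :: "nat \<Rightarrow> real" and d :: "nat \<Rightarrow> int"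
  assumes N: "even N" "0 < N"
    and per: "\<And>i. \<psi> (i + N) = \<psi> i" "\<And>i. v (i + N) = v i"
    and add: "\<And>i. \<psi> i + \<psi> (Suc i) = 4 * of_int (d i)"
    and diff: "\<And>i. \<bar>(\<psi> i - \<psi> (Suc i)) / 2 - (v i + v (Suc i))\<bar> \<le> \<epsilon>"
    and bound: "\<And>i. \<bar>v i\<bar> \<le> 1 - \<eta>" "6 * real N * \<epsilon> < \<eta>"
  shows "\<exists>i j h. 4 * real_of_int h = \<psi> i + \<psi> j \<and> int N * h = (\<Sum>i<N. d i)"
proof -
  \<comment> \<open>\<open>\<psi> i = (-1)^i f + 4 l i\<close> exactly; the integers \<open>Q i\<close> stay within less than \<open>1/2\<close> of an
    arithmetic progression with rational step \<open>\<beta> / n\<close>, so they are its roundings.\<close>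
  define l :: "nat \<Rightarrow> int" where "l = rec_nat 0 (\<lambda>i x. d i - x)"
  have l0: "l 0 = 0" and lS: "l (Suc i) = d i - l i" for i by (simp_all add: l_def)
  define f where "f = \<psi> 0"
  have psi: "\<psi> i = (-1) ^ i * f + 4 * of_int (l i)" for i
  proof (induction i)
    case (Suc i) then show ?case using add[of i] by (simp add: lS)
  qed (simp add: f_def l0)
  have lper: "l (i + N) = l i" for i
    using psi[of i] psi[of "i + N"] per(1)[of i] N(1) by (simp add: power_add)
  \<comment> \<open>The signs \<open>(-1) ^ i\<close> turn the alternating relations into first
    differences: up to \<open>\<epsilon>\<close>, \<open>A i - A (Suc i)\<close> equals
    \<open>f\<close> plus twice an increment of the integers \<open>Q\<close>.\<close>
  define B where "B i = (-1) ^ i * l i" for i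
  define Q where "Q i = (\<Sum>j<i. B j + B (Suc j))" for i
  define A where "A i = (-1) ^ i * v i" for i
  have Q0: "Q 0 = 0" and QS: "Q (Suc i) = Q i + B i + B (Suc i)" for i
    by (simp_all add: Q_def)
  have Qsum: "Q i = 2 * sum B {..<i} + B i - B 0" for i
    by (induction i) (simp_all add: Q0 QS)
  have Bper: "B (i + N) = B i" for i using lper[of i] N(1) by (simp add: B_def power_add)
  have Aper: "A (i + N) = A i" for i using per(2)[of i] N(1) by (simp add: A_def power_add)
  have eps: "0 \<le> \<epsilon>" using diff[of 0] by linarith
  have step: "\<bar>A i - A (Suc i) - f - 2 * of_int (Q (Suc i) - Q i)\<bar> \<le> \<epsilon>" for i
  proof -
    have "(\<psi> i - \<psi> (Suc i)) / 2 = (-1) ^ i * (f + 2 * of_int (Q (Suc i) - Q i))"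
      by (simp add: psi QS B_def field_simps)
    moreover have "v i + v (Suc i) = (-1) ^ i * (A i - A (Suc i))"
      by (simp add: A_def algebra_simps flip: power_add)
    ultimately have "(\<psi> i - \<psi> (Suc i)) / 2 - (v i + v (Suc i))
        = - ((-1) ^ i * (A i - A (Suc i) - f - 2 * of_int (Q (Suc i) - Q i)))"
      by (simp add: algebra_simps)
    then show ?thesis using diff[of i] by (simp add: abs_mult power_abs)
  qed
  have tele: "\<bar>A 0 - A i - real i * f - 2 * of_int (Q i)\<bar> \<le> real i * \<epsilon>" for i
  proof (induction i)
    case (Suc i) then show ?case using step[of i] by (simp add: algebra_simps)
  qed (simp add: Q0)
  define n where "n = N div 2"
  have n: "N = 2 * n" "0 < n" using N by (auto simp: n_def)
  define \<beta> where "\<beta> = sum B {..<N}"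
  have QN: "Q N = 2 * \<beta>" using Qsum[of N] Bper[of 0] by (simp add: \<beta>_def)
  \<comment> \<open>The step \<open>\<beta> / n\<close> in lowest terms \<open>b / m\<close>:
    \<open>m\<close>, renamed \<open>q\<close> below, is the smallest positive shift that moves the
    progression by an integer.\<close>
  obtain g b m :: int where g: "\<beta> = b * g" "int n = m * g" "coprime b m" "g = gcd \<beta> (int n)"
    using gcd_coprime_exists[of \<beta> "int n"] n by (metis gcd_eq_0_iff less_irrefl of_nat_0_less_iff)
  have gpos: "0 < g" using g(4) n by simp
  then have mpos: "0 < m" using g(2) n by (metis of_nat_0_less_iff zero_less_mult_pos2)
  define q where "q = nat m"
  define G where "G = nat g"
  have q: "m = int q" "g = int G" "0 < q" "0 < G" "n = q * G"
    using mpos gpos g(2) by (auto simp: q_def G_def nat_mult_distrib) (metis nat_int nat_mult_distrib less_imp_le)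
  \<comment> \<open>Closing up over a full period, \<open>A N = A 0\<close>, determines
    \<open>f\<close> up to \<open>\<epsilon>\<close>.\<close>
  have f: "\<bar>f + 2 * of_int \<beta> / real n\<bar> \<le> \<epsilon>"
  proof -
    have "\<bar>real N * f + 4 * of_int \<beta>\<bar> \<le> real N * \<epsilon>"
      using tele[of N] Aper[of 0] by (simp add: QN)
    moreover have "real N * f + 4 * of_int \<beta> = real N * (f + 2 * of_int \<beta> / real n)"
      using n by (simp add: field_simps)
    ultimately have "real N * \<bar>f + 2 * of_int \<beta> / real n\<bar> \<le> real N * \<epsilon>"
      by (simp add: abs_mult)
    then show ?thesis using N(2) by simp
  qed
  define x where "x i = A 0 / 2 + real i * of_int \<beta> / real n" for i
  \<comment> \<open>Twice the deviation is \<open>A i\<close> plus two errors of at most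
    \<open>i * \<epsilon>\<close>. The range \<open>3 * N\<close> has room for the index
    \<open>Suc i + q\<close> with \<open>i\<close> and \<open>q\<close> at most \<open>N\<close>,
    and it accounts for the factor 6 in \<open>bound\<close>.\<close>
  have close: "\<bar>x i - of_int (Q i)\<bar> < 1 / 2" if "i \<le> 3 * N" for i
  proof -
    have "\<bar>real i * (f + 2 * of_int \<beta> / real n)\<bar> \<le> real i * \<epsilon>"
      using f by (simp add: abs_mult mult_left_mono)
    moreover have "2 * (x i - of_int (Q i)) = A i + (A 0 - A i - real i * f - 2 * of_int (Q i))
        + real i * (f + 2 * of_int \<beta> / real n)"
      by (simp add: x_def algebra_simps)
    moreover have "\<bar>A i\<bar> \<le> 1 - \<eta>" using bound(1) by (simp add: A_def abs_mult power_abs)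
    moreover have "2 * (real i * \<epsilon>) \<le> 6 * real N * \<epsilon>"
      using that eps mult_right_mono[of "2 * real i" "6 * real N" \<epsilon>] by simp
    moreover have "\<bar>X\<bar> < 1 / 2" if "\<bar>z\<bar> \<le> e" "2 * X = a + y + z" "\<bar>a\<bar> \<le> 1 - \<eta>" "2 * e < \<eta>" "\<bar>y\<bar> \<le> e"
      for X a y z e :: real
      using that by linarith
    ultimately show ?thesis using tele[of i] bound(2) by (meson le_less_trans)
  qed
  \<comment> \<open>The shift by \<open>q\<close> moves \<open>x\<close> by exactly
    \<open>b\<close>, so two integers within less than \<open>1 / 2\<close> of it move by
    \<open>b\<close> as well.\<close>
  have Qshift: "Q (i + q) = Q i + b" if "i + q \<le> 3 * N" for i
  proof -
    have "of_int \<beta> / real n * real q = of_int b"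
      using q g(1) n by (simp add: field_simps)
    then have "x (i + q) = x i + of_int b"
      by (simp add: x_def algebra_simps add_divide_distrib)
    then have "\<bar>of_int (Q i + b - Q (i + q)) :: real\<bar> < 1"
      using close[of i] close[of "i + q"] that by (auto simp: abs_if split: if_splits)
    then show ?thesis by linarith
  qed
  define C where "C i = B (i + q) - B i" for i
  have qN: "q \<le> N" using n q by simp
  \<comment> \<open>Comparing \<open>Qshift\<close> at \<open>i\<close> and \<open>Suc i\<close>
    shows that \<open>B i + B (Suc i)\<close> is invariant under the shift by
    \<open>q\<close>.\<close>
  have CS: "C (Suc i) = - C i" if "i \<le> N" for i
    using Qshift[of i] Qshift[of "Suc i"] QS[of i] QS[of "i + q"] that qN N(2) by (simp add: C_def)
  have Calt: "C i = (-1) ^ i * C 0" if "i \<le> Suc N" for i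
    using that by (induction i) (simp_all add: CS)
  \<comment> \<open>For even \<open>q\<close>, the sequence \<open>B\<close> would drift by
    \<open>C 0\<close> at each multiple of \<open>q\<close>, so periodicity forces
    \<open>C 0 = 0\<close>; then \<open>b = Q q\<close> is even, against the coprimality of
    \<open>b\<close> and \<open>q\<close>.\<close>
  have odd: "odd q"
  proof
    assume ev: "even q"
    have tot: "B (j * q) - B 0 = int j * C 0" if "j * q \<le> N" for j
      using that
    proof (induction j)
      case (Suc j)
      then have "C (j * q) = C 0" using Calt[of "j * q"] ev by simp
      moreover have "B (Suc j * q) = B (j * q) + C (j * q)" by (simp add: C_def add.commute)
      ultimately show ?case using Suc by (simp add: algebra_simps)
    qed simp
    have "N = (2 * G) * q" using n q by simp
    then have "C 0 = 0" using tot[of "2 * G"] Bper[of 0] q by simp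
    then have "b = 2 * sum B {..<q}" using Qshift[of 0] Qsum[of q] qN by (simp add: Q0 C_def)
    then have "even b" by simp
    then show False using g(3) ev q(1) by (meson coprime_common_divisor even_of_nat odd_one)
  qed
  define h where "h = - C 0"
  \<comment> \<open>Since \<open>q\<close> is odd, the signs in \<open>B\<close> turn the
    alternating difference \<open>C\<close> into a constant sum of values of
    \<open>l\<close>.\<close>
  have lsum: "l i + l (i + q) = h" if "i \<le> N" for i
  proof -
    have "(-1) ^ i * (l i + l (i + q)) = (-1) ^ i * h"
      using Calt[of i] odd that by (simp add: C_def B_def h_def power_add algebra_simps)
    then show ?thesis by simp
  qed
  have shift: "(\<Sum>i<N. l (i + j)) = sum l {..<N}" for j
  proof (induction j)
    case (Suc j)
    have "(\<Sum>i<N. l (i + Suc j)) = (\<Sum>i<N. l (Suc i + j))" by simp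
    also have "\<dots> = (\<Sum>i<N. l (i + j)) + l (N + j) - l j"
      using sum.lessThan_Suc_shift[of "\<lambda>i. l (i + j)" N] by simp
    finally show ?case using Suc lper[of j] by (simp add: add.commute)
  qed simp
  have "int N * h = (\<Sum>i<N. l i + l (i + q))" using lsum by simp
  also have "\<dots> = 2 * sum l {..<N}" by (simp add: sum.distrib shift)
  also have "\<dots> = (\<Sum>i<N. l i + l (i + 1))" by (simp add: sum.distrib shift del: One_nat_def)
  also have "\<dots> = (\<Sum>i<N. d i)" by (simp add: lS)
  finally have "int N * h = (\<Sum>i<N. d i)" .
  moreover have "4 * real_of_int h = \<psi> 0 + \<psi> q"
    using lsum[of 0] odd by (simp add: psi l0 flip: of_int_add)
  ultimately show ?thesis by blast
qed

section \<open>Closed sequences of chords\<close>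

lemma abs_cos_diff_le: "\<bar>cos x - cos y\<bar> \<le> \<bar>x - y\<bar>" for x y :: real
proof -
  have "\<bar>cos x - cos y\<bar> = 2 * \<bar>sin ((x + y) / 2)\<bar> * \<bar>sin ((y - x) / 2)\<bar>"
    by (simp add: cos_diff_cos abs_mult)
  also have "\<dots> \<le> 2 * 1 * \<bar>(y - x) / 2\<bar>"
    by (intro mult_mono abs_sin_x_le_abs_x) auto
  finally show ?thesis by simp
qed

text \<open>The mean value point lies between \<open>a\<close> and \<open>b\<close>, so its absolute
  value is at most one of theirs; cosine decreases in the absolute value, hence the lower bound
  \<open>c\<close> passes to it.\<close>

lemma sin_diff_mvt:
  fixes a b c :: real
  assumes "\<bar>a\<bar> < pi / 2" "\<bar>b\<bar> < pi / 2" "c \<le> cos a" "c \<le> cos b"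
  obtains x where "sin b - sin a = (b - a) * cos x" "c \<le> cos x" "\<bar>a - x\<bar> \<le> \<bar>a - b\<bar>" "\<bar>b - x\<bar> \<le> \<bar>a - b\<bar>"
proof -
  have "\<exists>x. min a b \<le> x \<and> x \<le> max a b \<and> sin b - sin a = (b - a) * cos x"
  proof (cases a b rule: linorder_cases)
    case less
    then show ?thesis using MVT2[of a b sin cos] by (auto intro: less_imp_le)
  next
    case greater
    then obtain x where "b < x" "x < a" "sin a - sin b = (a - b) * cos x"
      using MVT2[of b a sin cos] by auto
    then show ?thesis by (intro exI[of _ x]) (auto simp: algebra_simps)
  qed auto
  then obtain x where x: "min a b \<le> x" "x \<le> max a b" "sin b - sin a = (b - a) * cos x" by blast
  have "\<bar>x\<bar> \<le> \<bar>a\<bar> \<or> \<bar>x\<bar> \<le> \<bar>b\<bar>" using x(1,2) by linarith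
  then have "cos \<bar>a\<bar> \<le> cos \<bar>x\<bar> \<or> cos \<bar>b\<bar> \<le> cos \<bar>x\<bar>"
    using assms(1,2) cos_monotone_0_pi_le[of "\<bar>x\<bar>"] pi_half_gt_zero by (smt (verit) abs_ge_zero field_sum_of_halves) 
  then have "c \<le> cos x" using assms by auto
  with x show ?thesis by (intro that[of x]) auto
qed

text \<open>The billiard problem stripped of its geometry: \<open>\<phi> i\<close> is the angle
  between a chord and the inward normal, \<open>T i\<close> the offset of the bounce from the
  midpoint of its edge and \<open>\<delta>\<close> half an edge, both in units of the apothem
  \<open>r\<close>, and \<open>d i\<close> counts the edges from one bounce to the next. Closing up
  keeps the angles away from \<open>pi / 2\<close>; linearizing then gives the hypotheses of
  \<open>rounding_rigidity\<close>.\<close>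

lemma no_closed_chord_sequence:
  fixes k p N :: nat and \<phi> T :: "nat \<Rightarrow> real" and d :: "nat \<Rightarrow> int" and l \<delta> r q \<eta> :: real
  assumes \<delta>_def: "\<delta> = tan (pi / p)" and r_def: "r = cos (pi / p)"
    and k: "2 \<le> k" and p: "prime p" "k < p"
    and q: "q = (1 + cos (pi / k)) / 2" and \<eta>: "\<eta> = (1 - q\<^sup>2) / (2 * k)"
    and small: "4 * k * \<delta> \<le> 1 - cos (pi / k)" "2 * \<delta> \<le> sqrt (1 - q\<^sup>2)"
      "(1 - \<eta>) * (p / pi * \<delta>) \<le> 1 - \<eta> / 2" "48 * k * (p / pi * \<delta>\<^sup>2) < \<eta> * (1 - q\<^sup>2)"
    and N: "even N" "0 < N" "N \<le> k"
    and per: "\<And>i. \<phi> (i + N) = \<phi> i" "\<And>i. T (i + N) = T i"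
    and \<phi>: "\<And>i. \<bar>\<phi> i\<bar> < pi / 2"
    and turn: "\<And>i. \<phi> i + \<phi> (Suc i) = pi - 2 * pi * d i / p"
    and momentum: "\<And>i. sin (\<phi> i) + T i * cos (\<phi> i) = sin (\<phi> (Suc i)) - T (Suc i) * cos (\<phi> (Suc i))"
    and T: "\<And>i. \<bar>T i\<bar> \<le> (1 - l / 2 * cos (\<phi> i) / r) * \<delta>" and l: "0 < l"
    and chord: "r * (cos (\<phi> 0) + cos (\<phi> 1) + T 1 * sin (\<phi> 1) - T 0 * sin (\<phi> 0)) \<le> k * l"
    and closing: "int p dvd (\<Sum>i<N. d i)"
  shows False
proof -
  have p2: "2 < p" using k p by simp
  have pp2: "0 < pi / p" "pi / p < pi / 2" using p2 divide_strict_left_mono[of 2 "real p" pi] by auto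
  have r: "0 < r" unfolding r_def using pp2 by (intro cos_gt_zero_pi) auto
  have \<delta>: "0 < \<delta>" using tan_gt_zero[OF pp2] by (simp only: \<delta>_def)
  have cosk: "0 \<le> cos (pi / k)" using k divide_left_mono[of 2 "real k" pi] by (intro cos_ge_zero order_trans[of "- (pi / 2)" 0 "pi / k"]) auto
  have cospos: "0 < cos (\<phi> i)" for i using \<phi>[of i] by (intro cos_gt_zero_pi) auto
  have Td: "\<bar>T i\<bar> \<le> \<delta>" for i
  proof -
    have "(1 - l / 2 * cos (\<phi> i) / r) * \<delta> \<le> 1 * \<delta>"
      using \<delta> l r cospos[of i] by (intro mult_right_mono) auto
    then show ?thesis using T[of i] by linarith
  qed
  have d: "0 < d i" "d i < int p" for i
  proof -
    have "- pi < pi - 2 * pi * d i / p" "pi - 2 * pi * d i / p < pi"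
      using \<phi>[of i] \<phi>[of "Suc i"] turn[of i] by linarith+
    then show "0 < d i" "d i < int p" using p2 by (auto simp: field_simps zero_less_mult_iff)
  qed
  \<comment> \<open>Only the offsets change the sine of the angle along a chord, and these are at
    most \<open>\<delta>\<close>.\<close>
  have step: "\<bar>sin (\<phi> (Suc i)) - sin (\<phi> i)\<bar> \<le> 2 * \<delta>" for i
  proof -
    have "\<bar>T i * cos (\<phi> i)\<bar> \<le> \<delta> * 1" "\<bar>T (Suc i) * cos (\<phi> (Suc i))\<bar> \<le> \<delta> * 1"
      unfolding abs_mult using Td \<delta> by (intro mult_mono; auto)+
    moreover have "sin (\<phi> (Suc i)) - sin (\<phi> i) = T i * cos (\<phi> i) + T (Suc i) * cos (\<phi> (Suc i))"
      using momentum[of i] by linarith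
    ultimately show ?thesis by linarith
  qed
  have steps: "\<bar>sin (\<phi> (i + j)) - sin (\<phi> i)\<bar> \<le> 2 * \<delta> * real j" for i j
  proof (induction j)
    case (Suc j)
    then show ?case using step[of "i + j"] by (simp add: algebra_simps)
  qed simp
  have phi_mod: "\<phi> i = \<phi> (i mod N)" for i
  proof (induction i rule: less_induct)
    case (less i)
    show ?case
    proof (cases "i < N")
      case False
      then show ?thesis using less[of "i - N"] per(1)[of "i - N"] N(2) by (simp add: le_mod_geq)
    qed simp
  qed
  have near: "\<bar>sin (\<phi> i) - sin (\<phi> j)\<bar> \<le> 2 * \<delta> * k" if "j \<le> N" for i j
  proof -
    have i: "i mod N \<le> N" using N(2) by (simp add: less_imp_le)
    have "\<bar>sin (\<phi> (i mod N)) - sin (\<phi> j)\<bar> \<le> 2 * \<delta> * N"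
    proof (cases "i mod N \<le> j")
      case True
      have "2 * \<delta> * (j - i mod N) \<le> 2 * \<delta> * N" using that \<delta> by (intro mult_left_mono) auto
      then show ?thesis using steps[of "i mod N" "j - i mod N"] True by (simp add: abs_minus_commute)
    next
      case False
      have "2 * \<delta> * (i mod N - j) \<le> 2 * \<delta> * N" using i \<delta> by (intro mult_left_mono) auto
      then show ?thesis using steps[of "j" "i mod N - j"] False by simp
    qed
    also have "\<dots> \<le> 2 * \<delta> * k" using N \<delta> by simp
    finally show ?thesis using phi_mod[of i] by simp
  qed
  \<comment> \<open>\<open>W\<close> is the winding number. As \<open>1 \<le> W < N\<close>, the
    average of \<open>d\<close> lies between \<open>p / N\<close> and
    \<open>p * (N - 1) / N\<close>, so some term reaches the lower value and some term does not
    exceed the upper one.\<close>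
  obtain W where W: "(\<Sum>i<N. d i) = int p * W" using closing by (auto elim: dvdE)
  have "0 < (\<Sum>i<N. d i)" using d N by (intro sum_pos) auto
  then have W1: "1 \<le> W" using W p2 by (simp add: zero_less_mult_iff)
  have "(\<Sum>i<N. d i) < (\<Sum>i<N. int p)" using d N by (intro sum_strict_mono) auto
  then have WN: "W < int N" using W p2 by (simp add: mult.commute)
  have "\<exists>i<N. int p \<le> int N * d i"
  proof (rule ccontr)
    assume "\<not> ?thesis"
    then have "(\<Sum>i<N. int N * d i) < (\<Sum>i<N. int p)" using N by (intro sum_strict_mono) (auto simp: not_le)
    then have "int N * (\<Sum>i<N. d i) < int N * int p" by (simp add: sum_distrib_left)
    then have "int p * W < int p * 1" using W N by simp
    then show False using W1 p2 by simp
  qed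
  then obtain a where a: "a < N" "int p \<le> int N * d a" by blast
  have "\<exists>i<N. int N * d i \<le> int p * (int N - 1)"
  proof (rule ccontr)
    assume "\<not> ?thesis"
    then have "(\<Sum>i<N. int p * (int N - 1)) < (\<Sum>i<N. int N * d i)" using N by (intro sum_strict_mono) (auto simp: not_le)
    then have "int N * (int p * (int N - 1)) < int N * (\<Sum>i<N. d i)" by (simp add: sum_distrib_left)
    then have "int p * (int N - 1) < int p * W" using W N by simp
    then show False using WN p2 by simp
  qed
  then obtain b where b: "b < N" "int N * d b \<le> int p * (int N - 1)" by blast
  have kN: "pi / k \<le> pi / N" using N by (intro divide_left_mono) auto
  have k2: "pi / k \<le> pi / 2" using k divide_left_mono[of 2 "real k" pi] by simp
  have "1 / N \<le> d a / p"
  proof -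
    have "real_of_int (int p) \<le> real_of_int (int N * d a)" using a(2) of_int_le_iff by blast
    then show ?thesis using N p2 by (simp add: field_simps)
  qed
  then have "2 * pi * (1 / N) \<le> 2 * pi * (d a / p)" by (intro mult_left_mono) auto
  then have "\<phi> a + \<phi> (Suc a) \<le> pi - 2 * (pi / k)" using turn[of a] kN by simp
  then have "\<phi> a \<le> pi / 2 - pi / k \<or> \<phi> (Suc a) \<le> pi / 2 - pi / k" by linarith
  then obtain a' where a': "a' \<le> N" "\<phi> a' \<le> pi / 2 - pi / k"
    using a(1) by (metis less_eq_Suc_le less_imp_le)
  have "d b / p \<le> (real N - 1) / N"
  proof -
    have "real_of_int (int N * d b) \<le> real_of_int (int p * (int N - 1))" using b(2) of_int_le_iff by blast
    then show ?thesis using N p2 by (simp add: field_simps)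
  qed
  then have "2 * pi * (d b / p) \<le> 2 * pi * ((real N - 1) / N)" by (intro mult_left_mono) auto
  also have "\<dots> = 2 * pi - 2 * (pi / N)" using N by (simp add: field_simps)
  finally have "- pi + 2 * (pi / k) \<le> \<phi> b + \<phi> (Suc b)" using turn[of b] kN by simp
  then have "- (pi / 2 - pi / k) \<le> \<phi> b \<or> - (pi / 2 - pi / k) \<le> \<phi> (Suc b)" by linarith
  then obtain b' where b': "b' \<le> N" "- (pi / 2 - pi / k) \<le> \<phi> b'"
    using b(1) by (metis less_eq_Suc_le less_imp_le)
  have sin_a: "sin (\<phi> a') \<le> sin (pi / 2 - pi / k)"
    using a' \<phi>[of a'] k2 by (intro sin_monotone_2pi_le) auto
  have sin_b: "sin (- (pi / 2 - pi / k)) \<le> sin (\<phi> b')"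
    using b' \<phi>[of b'] k2 by (intro sin_monotone_2pi_le) auto
  have ck: "sin (pi / 2 - pi / k) = cos (pi / k)" by (simp add: sin_diff)
  \<comment> \<open>\<open>near\<close> spreads the two one-sided bounds at \<open>a'\<close> and
    \<open>b'\<close> to every index. The loss \<open>2 * \<delta> * k\<close> is at most half of
    \<open>1 - cos (pi / k)\<close>, which is why \<open>q\<close> is the midpoint of
    \<open>cos (pi / k)\<close> and 1.\<close>
  have sinq: "\<bar>sin (\<phi> i)\<bar> \<le> q" for i
    using near[OF a'(1), of i] near[OF b'(1), of i] sin_a sin_b small(1) unfolding ck sin_minus q
    by (simp add: abs_le_iff mult_ac; linarith)
  have "cos (pi / k) < 1"
    using cos_monotone_0_pi[of 0 "pi / k"] k k2 by (simp add: field_simps)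
  then have q1: "0 < q" "q < 1" using cosk q by auto
  define c where "c = sqrt (1 - q\<^sup>2)"
  have c2: "c\<^sup>2 = 1 - q\<^sup>2" and c: "0 < c"
    using q1 by (auto simp: c_def abs_square_less_1 abs_square_le_1)
  have cosc: "c \<le> cos (\<phi> i)" for i
  proof -
    have "(sin (\<phi> i))\<^sup>2 \<le> q\<^sup>2" using sinq[of i] by (simp add: abs_le_square_iff[symmetric] q1)
    then show ?thesis unfolding c_def using cospos[of i]
      by (intro real_le_lsqrt) (auto simp: cos_squared_eq)
  qed
  have Tsin: "\<bar>T i * sin (\<phi> i)\<bar> \<le> c / 2" for i
  proof -
    have "\<bar>T i * sin (\<phi> i)\<bar> \<le> \<delta> * 1"
      unfolding abs_mult using Td \<delta> by (intro mult_mono) auto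
    then show ?thesis using small(2) by (simp add: c_def)
  qed
  \<comment> \<open>Two cosines of at least \<open>c\<close>, less two offset terms of at most
    \<open>c / 2\<close>, leave a chord of length at least \<open>r * c\<close>. As a chord is no
    longer than \<open>k * l\<close>, this bounds \<open>l / r\<close> below in terms of
    \<open>k\<close> alone.\<close>
  have "r * c \<le> r * (cos (\<phi> 0) + cos (\<phi> 1) + T 1 * sin (\<phi> 1) - T 0 * sin (\<phi> 0))"
    using Tsin[of 0] Tsin[of 1] cosc[of 0] cosc[of 1] r by (intro mult_left_mono) linarith+
  then have rl: "c / k \<le> l / r" using chord k r by (simp add: field_simps)
  have etaT: "\<eta> \<le> l / 2 * cos (\<phi> i) / r" for i
  proof -
    have "\<eta> = c / k * c / 2" using c2 by (simp add: \<eta> power2_eq_square)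
    also have "\<dots> \<le> l / r * cos (\<phi> i) / 2"
      using rl cosc[of i] c k l r by (intro divide_right_mono mult_mono) auto
    finally show ?thesis by (simp add: field_simps)
  qed
  have Teta: "\<bar>T i\<bar> \<le> (1 - \<eta>) * \<delta>" for i
  proof -
    have "(1 - l / 2 * cos (\<phi> i) / r) * \<delta> \<le> (1 - \<eta>) * \<delta>"
      using etaT[of i] \<delta> by (intro mult_right_mono) auto
    then show ?thesis using T[of i] by linarith
  qed
  \<comment> \<open>\<open>momentum\<close> linearized: replacing both cosines by the one at the
    mean value point costs at most the gap \<open>2 * \<delta> / c\<close> each, times an offset of
    at most \<open>\<delta>\<close>.\<close>
  have diff: "\<bar>(\<phi> (Suc i) - \<phi> i) - (T i + T (Suc i))\<bar> \<le> 4 * \<delta>\<^sup>2 / c\<^sup>2" for i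
  proof -
    obtain x where x: "sin (\<phi> (Suc i)) - sin (\<phi> i) = (\<phi> (Suc i) - \<phi> i) * cos x" "c \<le> cos x"
      "\<bar>\<phi> i - x\<bar> \<le> \<bar>\<phi> i - \<phi> (Suc i)\<bar>" "\<bar>\<phi> (Suc i) - x\<bar> \<le> \<bar>\<phi> i - \<phi> (Suc i)\<bar>"
      using sin_diff_mvt[of "\<phi> i" "\<phi> (Suc i)" c] \<phi> cosc by blast
    have "\<bar>\<phi> i - \<phi> (Suc i)\<bar> * c \<le> \<bar>\<phi> i - \<phi> (Suc i)\<bar> * \<bar>cos x\<bar>"
      using x(2) by (intro mult_left_mono) auto
    also have "\<dots> \<le> 2 * \<delta>" using step[of i] x(1) by (simp add: abs_mult abs_minus_commute)
    finally have gap: "\<bar>\<phi> i - \<phi> (Suc i)\<bar> \<le> 2 * \<delta> / c" using c by (simp add: field_simps)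
    have "\<bar>(\<phi> (Suc i) - \<phi> i) - (T i + T (Suc i))\<bar> * c
        \<le> \<bar>(\<phi> (Suc i) - \<phi> i) - (T i + T (Suc i))\<bar> * \<bar>cos x\<bar>"
      using x(2) by (intro mult_left_mono) auto
    also have "\<dots> = \<bar>T i * (cos (\<phi> i) - cos x) + T (Suc i) * (cos (\<phi> (Suc i)) - cos x)\<bar>"
      unfolding abs_mult[symmetric] using x(1) momentum[of i] by (simp add: algebra_simps)
    also have "\<dots> \<le> \<bar>T i * (cos (\<phi> i) - cos x)\<bar> + \<bar>T (Suc i) * (cos (\<phi> (Suc i)) - cos x)\<bar>"
      by (rule abs_triangle_ineq)
    also have "\<dots> \<le> \<delta> * (2 * \<delta> / c) + \<delta> * (2 * \<delta> / c)"
      unfolding abs_mult using Td \<delta> gap x(3,4) abs_cos_diff_le[of "\<phi> i" x] abs_cos_diff_le[of "\<phi> (Suc i)" x]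
      by (intro add_mono mult_mono) (auto intro: order_trans)
    finally show ?thesis using c by (simp add: field_simps power2_eq_square)
  qed
  \<comment> \<open>This scale makes \<open>turn\<close> an exact relation between integers
    multiplied by 4, and makes an offset of half an edge approach 1 as \<open>p\<close>
    grows.\<close>
  define \<kappa> where "\<kappa> = p / pi"
  define \<psi> where "\<psi> i = p - 2 * \<kappa> * \<phi> i" for i
  define v where "v i = \<kappa> * T i" for i
  define \<epsilon> where "\<epsilon> = \<kappa> * (4 * \<delta>\<^sup>2 / c\<^sup>2)"
  have pp: "0 < \<kappa>" using p2 by (simp add: \<kappa>_def)
  have "\<exists>i j h. 4 * real_of_int h = \<psi> i + \<psi> j \<and> int N * h = (\<Sum>i<N. d i)"
  proof (rule rounding_rigidity[OF N(1,2), of \<psi> v d \<epsilon> "\<eta> / 2"])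
    show "\<psi> (i + N) = \<psi> i" "v (i + N) = v i" for i using per by (simp_all add: \<psi>_def v_def)
    show "\<psi> i + \<psi> (Suc i) = 4 * of_int (d i)" for i
    proof -
      have "\<psi> i + \<psi> (Suc i) = 2 * p - 2 * (\<kappa>) * (\<phi> i + \<phi> (Suc i))" by (simp add: \<psi>_def algebra_simps)
      also have "\<dots> = 4 * of_int (d i)" unfolding turn using p2 by (simp add: \<kappa>_def field_simps)
      finally show ?thesis .
    qed
    show "\<bar>(\<psi> i - \<psi> (Suc i)) / 2 - (v i + v (Suc i))\<bar> \<le> \<epsilon>" for i
    proof -
      have "(\<psi> i - \<psi> (Suc i)) / 2 - (v i + v (Suc i)) = \<kappa> * ((\<phi> (Suc i) - \<phi> i) - (T i + T (Suc i)))"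
        by (simp add: \<psi>_def v_def field_simps)
      also have "\<bar>\<dots>\<bar> = \<kappa> * \<bar>(\<phi> (Suc i) - \<phi> i) - (T i + T (Suc i))\<bar>"
        using pp by (simp add: abs_mult)
      also have "\<dots> \<le> \<epsilon>" unfolding \<epsilon>_def using diff pp by (intro mult_left_mono) auto
      finally show ?thesis .
    qed
    show "\<bar>v i\<bar> \<le> 1 - \<eta> / 2" for i
    proof -
      have "\<bar>v i\<bar> = \<kappa> * \<bar>T i\<bar>" using pp by (simp add: v_def abs_mult)
      also have "\<dots> \<le> \<kappa> * ((1 - \<eta>) * \<delta>)" using Teta pp by (intro mult_left_mono) auto
      also have "\<dots> \<le> 1 - \<eta> / 2" using small(3) by (simp add: \<kappa>_def[symmetric] mult_ac)
      finally show ?thesis .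
    qed
    have "6 * real N * \<epsilon> \<le> 6 * real k * \<epsilon>"
      using N(3) pp by (intro mult_right_mono) (auto simp: \<epsilon>_def)
    also have "\<dots> < \<eta> / 2"
      using small(4) c unfolding c2[symmetric] \<epsilon>_def \<kappa>_def[symmetric] by (simp add: field_simps)
    finally show "6 * real N * \<epsilon> < \<eta> / 2" .
  qed
  then obtain i j h where h: "4 * real_of_int h = \<psi> i + \<psi> j" "int N * h = (\<Sum>i<N. d i)" by blast
  \<comment> \<open>Since \<open>4 * h\<close> is a sum of two values of \<open>\<psi>\<close>, this
    range gives \<open>0 < h < p\<close>, so the prime \<open>p\<close> divides neither
    \<open>h\<close> nor \<open>N\<close>.\<close>
  have psi: "0 < \<psi> i" "\<psi> i < 2 * p" for i
  proof -
    have "2 * (\<kappa>) * \<bar>\<phi> i\<bar> < 2 * (\<kappa>) * (pi / 2)" using \<phi> pp by (intro mult_strict_left_mono) auto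
    also have "\<dots> = p" by (simp add: \<kappa>_def)
    finally have "\<bar>2 * \<kappa> * \<phi> i\<bar> < p" using pp by (simp add: abs_mult)
    then show "0 < \<psi> i" "\<psi> i < 2 * p" unfolding \<psi>_def by linarith+
  qed
  have "0 < 4 * real_of_int h" "4 * real_of_int h < 4 * real_of_int (int p)"
    using psi[of i] psi[of j] unfolding h(1) by simp_all
  then have hp: "0 < h" "h < int p" by (simp_all only: mult_less_cancel_left_pos of_int_less_iff zero_less_mult_iff) auto
  have "int p dvd int N * h" using closing h(2) by simp
  moreover have "prime (int p)" using p by simp
  ultimately have "int p dvd int N \<or> int p dvd h" by (rule prime_dvd_multD[rotated])
  then show False
    using hp N p(2) by (auto dest!: zdvd_imp_le dvd_imp_le)
qed

text \<open>For fixed \<open>k\<close> the numbers \<open>1 - q\<close> and \<open>\<eta>\<close>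
  are fixed and positive, while the tangent expressions tend to 0, 1 and 0; all four inequalities
  hold strictly in the limit.\<close>

lemma eventually_small_angle:
  fixes k :: nat and q \<eta> :: real
  assumes "2 \<le> k" and q: "q = (1 + cos (pi / k)) / 2" and \<eta>: "\<eta> = (1 - q\<^sup>2) / (2 * k)"
  shows "\<forall>\<^sub>F p :: nat in at_top.
    4 * k * tan (pi / p) \<le> 1 - cos (pi / k) \<and> 2 * tan (pi / p) \<le> sqrt (1 - q\<^sup>2) \<and>
    (1 - \<eta>) * (p / pi * tan (pi / p)) \<le> 1 - \<eta> / 2 \<and>
    48 * k * (p / pi * (tan (pi / p))\<^sup>2) < \<eta> * (1 - q\<^sup>2)"
proof -
  have k2: "pi / k \<le> pi / 2" using assms(1) divide_left_mono[of 2 "real k" pi] by simp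
  have "0 \<le> cos (pi / k)"
    using assms(1) k2 by (intro cos_ge_zero order_trans[of "- (pi / 2)" 0 "pi / k"]) auto
  moreover have cos1: "cos (pi / k) < 1"
    using cos_monotone_0_pi[of 0 "pi / k"] assms(1) k2 by (simp add: field_simps)
  ultimately have q1: "0 < q" "q < 1" using q by auto
  then have q2: "0 < 1 - q\<^sup>2" by (simp add: abs_square_less_1)
  then have \<eta>0: "0 < \<eta>" using \<eta> assms(1) by simp
  have lim: "(\<lambda>p. tan (pi / real p)) \<longlonglongrightarrow> 0" "(\<lambda>p. real p / pi * tan (pi / real p)) \<longlonglongrightarrow> 1"
    "(\<lambda>p. real p / pi * (tan (pi / real p))\<^sup>2) \<longlonglongrightarrow> 0"
    by real_asymp+
  have "4 * real k * 0 < 1 - cos (pi / k)" "2 * 0 < sqrt (1 - q\<^sup>2)" "(1 - \<eta>) * 1 < 1 - \<eta> / 2"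
    "48 * real k * 0 < \<eta> * (1 - q\<^sup>2)"
    using q2 \<eta>0 cos1 by simp_all
  note small = this(1)[THEN order_tendstoD(2)[OF tendsto_mult_left[OF lim(1)]]]
      this(2)[THEN order_tendstoD(2)[OF tendsto_mult_left[OF lim(1)]]]
      this(3)[THEN order_tendstoD(2)[OF tendsto_mult_left[OF lim(2)]]]
      this(4)[THEN order_tendstoD(2)[OF tendsto_mult_left[OF lim(3)]]]
  from small show ?thesis by eventually_elim simp
qed

section \<open>Regular polygons and their doubles\<close>

definition apothem :: "nat \<Rightarrow> real" where
  "apothem n = cos (pi / n)"

text \<open>Edge \<open>e\<close> joins the vertices at angles \<open>2 * e * pi / n\<close> and
  \<open>2 * (e + 1) * pi / n\<close>. The index runs over all integers with period
  \<open>n\<close>, so that neighbours are \<open>e + 1\<close> and \<open>e - 1\<close> without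
  wrap-around.\<close>

definition edge_normal :: "nat \<Rightarrow> int \<Rightarrow> complex" where
  "edge_normal n e = cis ((2 * e + 1) * pi / n)"

definition edge_height :: "nat \<Rightarrow> int \<Rightarrow> complex \<Rightarrow> real" where
  "edge_height n e z = apothem n - inner (edge_normal n e) z"

lemma inner_cis_cis: "inner (cis a) (cis b) = cos (a - b)"
  by (simp add: inner_complex_def cos_diff)

lemma norm_edge_normal [simp]: "norm (edge_normal n e) = 1"
  by (simp add: edge_normal_def)

lemma edge_normal_neq_0 [simp]: "edge_normal n e \<noteq> 0"
  using norm_edge_normal[of n e] by (metis norm_zero zero_neq_one)

lemma inner_edge_normal_self [simp]: "inner (edge_normal n e) (edge_normal n e) = 1"
  by (simp add: dot_square_norm)

lemma edge_normal_mod: "0 < n \<Longrightarrow> edge_normal n (e mod int n) = edge_normal n e"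
proof -
  assume n: "0 < n"
  have "e = e mod int n + int n * (e div int n)" by simp
  then have "real_of_int e = of_int (e mod int n) + real n * of_int (e div int n)"
    by (metis of_int_add of_int_mult of_int_of_nat_eq)
  then have "(2 * e + 1) * pi / n = (2 * of_int (e mod int n) + 1) * pi / n + 2 * pi * of_int (e div int n)"
    using n by (simp add: field_simps)
  then show ?thesis by (simp add: edge_normal_def flip: cis_mult)
qed

lemma edge_height_mod: "0 < n \<Longrightarrow> edge_height n (e mod int n) z = edge_height n e z"
  by (simp add: edge_height_def edge_normal_mod)

lemma edge_height_add: "edge_height n e (z + w) = edge_height n e z - inner (edge_normal n e) w"
  by (simp add: edge_height_def inner_add_right)

lemma edge_height_convex:
  assumes "a + b = 1"
  shows "edge_height n e (a *\<^sub>R z + b *\<^sub>R w) = a * edge_height n e z + b * edge_height n e w"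
proof -
  have "apothem n = (a + b) * apothem n" using assms by simp
  then show ?thesis by (simp add: edge_height_def inner_add_right algebra_simps)
qed

lemma edge_height_lipschitz: "edge_height n e z - edge_height n e w \<le> dist z w"
proof -
  have "edge_height n e z - edge_height n e w = inner (edge_normal n e) (w - z)"
    by (simp add: edge_height_def inner_diff_right)
  also have "\<dots> \<le> norm (edge_normal n e) * norm (w - z)" by (rule norm_cauchy_schwarz)
  finally show ?thesis by (simp add: dist_norm norm_minus_commute)
qed

lemma apothem_pos: "3 \<le> n \<Longrightarrow> 0 < apothem n"
  unfolding apothem_def using divide_strict_left_mono[of 2 "real n" pi]
  by (intro cos_gt_zero_pi order.strict_trans[of "- (pi / 2)" 0 "pi / n"]) auto

text \<open>Modulo \<open>2 * pi\<close> and up to sign the angle is an odd multiple of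
  \<open>pi / n\<close> in \<open>[pi / n, pi]\<close>, where cosine decreases. This places every
  vertex on the inner side of every edge.\<close>

lemma cos_odd_multiple_le:
  fixes m :: int
  assumes n: "0 < n" and m: "odd m"
  shows "cos (m * pi / n) \<le> cos (pi / real n)"
proof -
  define j where "j = m mod (2 * int n)"
  have m_eq: "m = j + 2 * int n * (m div (2 * int n))" by (simp add: j_def)
  have j: "0 \<le> j" "j < 2 * int n" "odd j"
    using n m by (simp_all add: j_def dvd_mod_iff)
  have "real_of_int m = of_int j + 2 * real n * of_int (m div (2 * int n))"
    by (subst m_eq) simp
  then have "m * pi / n = of_int j * pi / n + 2 * pi * of_int (m div (2 * int n))"
    using n by (simp add: field_simps)
  then have eq: "cos (m * pi / n) = cos (of_int j * pi / n)" by (simp add: cos_add)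
  have *: "cos (of_int i * pi / n) \<le> cos (pi / real n)" if "1 \<le> i" "i \<le> int n" for i
  proof (rule cos_monotone_0_pi_le)
    have "real_of_int i \<le> real_of_int (int n)" using that of_int_le_iff by blast
    then show "of_int i * pi / n \<le> pi" using n by (simp add: field_simps)
    have "1 \<le> real_of_int i" using that by simp
    then have "1 * pi / n \<le> of_int i * pi / n" by (intro divide_right_mono mult_right_mono) auto
    then show "pi / n \<le> of_int i * pi / n" by simp
  qed simp
  have "1 \<le> j" using j by (cases "j = 0") auto
  show ?thesis
  proof (cases "j \<le> int n")
    case True
    then show ?thesis using * \<open>1 \<le> j\<close> eq by simp
  next
    case False
    have "of_int j * pi / n = 2 * pi - of_int (2 * int n - j) * pi / n"
      using n by (simp add: field_simps)
    then have "cos (of_int j * pi / n) = cos (of_int (2 * int n - j) * pi / n)"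
      by (simp add: cos_diff)
    then show ?thesis using *[of "2 * int n - j"] False j eq by simp
  qed
qed

lemma vertex_in_polygon:
  assumes "0 < n"
  shows "cis (2 * pi * of_int j / n) \<in> regular_polygon n"
proof -
  have "real_of_int j = real_of_int (j mod int n + int n * (j div int n))" by simp
  then have "2 * pi * of_int j / n = 2 * pi * of_int (j mod int n) / n + 2 * pi * of_int (j div int n)"
    unfolding of_int_add of_int_mult using assms by (simp add: field_simps)
  then have "cis (2 * pi * of_int j / n) = cis (2 * pi * of_int (j mod int n) / n)"
    by (simp flip: cis_mult)
  also have "\<dots> = cis (2 * pi * real (nat (j mod int n)) / real n)" using assms by simp
  also have "\<dots> \<in> regular_polygon n"
    unfolding regular_polygon_def using assms
    by (intro hull_inc imageI) (auto simp: nat_less_iff)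
  finally show ?thesis .
qed

lemma convex_regular_polygon: "convex (regular_polygon n)"
  by (simp add: regular_polygon_def)

text \<open>The centre is the average of the vertices, since the \<open>n\<close>-th roots of unity
  sum to 0.\<close>

lemma zero_in_polygon:
  assumes "2 \<le> n"
  shows "0 \<in> regular_polygon n"
proof -
  define w where "w = cis (2 * pi / n)"
  have wj: "w ^ j = cis (2 * pi * of_int (int j) / n)" for j
    by (simp add: w_def Complex.DeMoivre mult_ac)
  have "w \<noteq> 1"
  proof
    assume "w = 1"
    then have "cos (2 * pi / n) = 1" by (auto simp: w_def complex_eq_iff)
    moreover have "cos (2 * pi / n) < cos 0"
      using assms by (intro cos_monotone_0_pi) (auto simp: field_simps)
    ultimately show False by simp
  qed
  moreover have "w ^ n = 1" using assms by (simp add: wj)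
  ultimately have "(\<Sum>j<n. w ^ j) = 0" by (simp add: sum_gp_strict)
  then have "(\<Sum>j<n. (1 / real n) *\<^sub>R w ^ j) = 0" by (simp flip: scaleR_sum_right)
  moreover have "(\<Sum>j<n. (1 / real n) *\<^sub>R w ^ j) \<in> regular_polygon n"
    using assms unfolding wj by (intro convex_sum convex_regular_polygon vertex_in_polygon) auto
  ultimately show ?thesis by simp
qed

lemma edge_height_nonneg:
  assumes "0 < n" "z \<in> regular_polygon n"
  shows "0 \<le> edge_height n e z"
proof -
  have "regular_polygon n \<subseteq> {z. inner (edge_normal n e) z \<le> apothem n}"
    unfolding regular_polygon_def
  proof (intro hull_minimal convex_halfspace_le subsetI)
    fix v assume "v \<in> (\<lambda>j. cis (2 * pi * real j / real n)) ` {..<n}"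
    then obtain j where v: "v = cis (2 * pi * real j / real n)" by auto
    have "(2 * e + 1) * pi / n - 2 * pi * real j / real n = of_int (2 * (e - int j) + 1) * pi / n"
      using assms by (simp add: field_simps)
    then show "v \<in> {z. inner (edge_normal n e) z \<le> apothem n}"
      using cos_odd_multiple_le[OF assms(1), of "2 * (e - int j) + 1"]
      by (simp add: v edge_normal_def inner_cis_cis apothem_def)
  qed
  then show ?thesis using assms(2) by (auto simp: edge_height_def)
qed

text \<open>The sector of \<open>z\<close> between two consecutive vertex directions writes
  \<open>z\<close> as a nonnegative combination of these vertices; the height over the edge joining
  them bounds the coefficient sum by 1, and the centre takes up the remaining weight.\<close>

lemma in_regular_polygonI:
  assumes n: "3 \<le> n" and z: "\<And>e. 0 \<le> edge_height n e z"
  shows "z \<in> regular_polygon n"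
proof -
  define \<alpha> where "\<alpha> = 2 * pi / n"
  define j where "j = \<lfloor>Arg z / \<alpha>\<rfloor>"
  define \<tau> where "\<tau> = Arg z - of_int j * \<alpha>"
  have \<alpha>: "0 < \<alpha>" "\<alpha> < pi" using n by (auto simp: \<alpha>_def field_simps)
  have sin\<alpha>: "0 < sin \<alpha>" using \<alpha> by (rule sin_gt_zero)
  have "of_int j \<le> Arg z / \<alpha>" "Arg z / \<alpha> < of_int j + 1" unfolding j_def by linarith+
  then have \<tau>: "0 \<le> \<tau>" "\<tau> \<le> \<alpha>" using \<alpha> by (auto simp: \<tau>_def field_simps)
  define s where "s = norm z * (sin (\<alpha> - \<tau>) / sin \<alpha>)"
  define t where "t = norm z * (sin \<tau> / sin \<alpha>)"
  have st: "0 \<le> s" "0 \<le> t"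
    unfolding s_def t_def using \<tau> \<alpha> sin\<alpha> by (auto intro!: mult_nonneg_nonneg divide_nonneg_pos sin_ge_zero)
  have v: "cis (2 * pi * of_int i / n) = cis (of_int i * \<alpha>)" for i by (simp add: \<alpha>_def mult_ac)
  have split: "sin \<alpha> *\<^sub>R cis \<tau> = sin (\<alpha> - \<tau>) *\<^sub>R 1 + sin \<tau> *\<^sub>R cis \<alpha>"
    by (simp add: complex_eq_iff sin_diff algebra_simps)
  have "z = norm z *\<^sub>R cis (Arg z)" using rcis_cmod_Arg[of z] by (simp add: rcis_def scaleR_conv_of_real)
  also have "cis (Arg z) = cis (of_int j * \<alpha>) * cis \<tau>" by (simp add: cis_mult \<tau>_def)
  also have "cis \<tau> = (1 / sin \<alpha>) *\<^sub>R (sin \<alpha> *\<^sub>R cis \<tau>)" using sin\<alpha> by simp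
  also have "norm z *\<^sub>R (cis (of_int j * \<alpha>) * \<dots>) = s *\<^sub>R cis (of_int j * \<alpha>) + t *\<^sub>R cis (of_int (j + 1) * \<alpha>)"
    unfolding split by (simp add: s_def t_def algebra_simps flip: cis_mult)
  finally have zst: "z = s *\<^sub>R cis (of_int j * \<alpha>) + t *\<^sub>R cis (of_int (j + 1) * \<alpha>)" .
  have "inner (edge_normal n j) (cis (of_int j * \<alpha>)) = apothem n"
    "inner (edge_normal n j) (cis (of_int (j + 1) * \<alpha>)) = apothem n"
  proof -
    have "(2 * j + 1) * pi / n - of_int j * \<alpha> = pi / n" "(2 * j + 1) * pi / n - of_int (j + 1) * \<alpha> = - (pi / n)"
      using n by (simp_all add: \<alpha>_def field_simps)
    then show "inner (edge_normal n j) (cis (of_int j * \<alpha>)) = apothem n"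
      "inner (edge_normal n j) (cis (of_int (j + 1) * \<alpha>)) = apothem n"
      unfolding edge_normal_def inner_cis_cis apothem_def by simp_all
  qed
  then have "edge_height n j z = (1 - (s + t)) * apothem n"
    unfolding zst edge_height_def inner_add_right inner_scaleR_right by (simp add: algebra_simps)
  then have st1: "s + t \<le> 1"
    using z[of j] apothem_pos[OF n] by (simp add: zero_le_mult_iff)
  have "(\<Sum>i\<in>{0,1,2::nat}. (if i = 0 then s else if i = 1 then t else 1 - s - t) *\<^sub>R
      (if i = 0 then cis (of_int j * \<alpha>) else if i = 1 then cis (of_int (j + 1) * \<alpha>) else 0)) \<in> regular_polygon n"
    using n st st1 zero_in_polygon[of n] vertex_in_polygon[of n] unfolding v
    by (intro convex_sum convex_regular_polygon) (auto simp del: of_int_add)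
  then show ?thesis using zst by simp
qed

lemma edge_height_pos:
  assumes "0 < n" "z \<in> interior (regular_polygon n)"
  shows "0 < edge_height n e z"
proof -
  have "regular_polygon n \<subseteq> {z. inner (edge_normal n e) z \<le> apothem n}"
    using edge_height_nonneg[OF assms(1)] by (auto simp: edge_height_def)
  then have "interior (regular_polygon n) \<subseteq> {z. inner (edge_normal n e) z < apothem n}"
    using interior_mono interior_halfspace_le[of "edge_normal n e" "apothem n"] edge_normal_neq_0 by metis
  then show ?thesis using assms(2) by (auto simp: edge_height_def)
qed

lemma in_interior_polygonI:
  assumes n: "3 \<le> n" and z: "\<And>e. 0 < edge_height n e z"
  shows "z \<in> interior (regular_polygon n)"
proof (rule interiorI)
  let ?U = "\<Inter>e\<in>{0..<int n}. {z. inner (edge_normal n e) z < apothem n}"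
  show "open ?U" by (intro open_INT ballI open_halfspace_lt) auto
  show "z \<in> ?U" using z by (auto simp: edge_height_def)
  show "?U \<subseteq> regular_polygon n"
  proof
    fix w assume w: "w \<in> ?U"
    show "w \<in> regular_polygon n"
    proof (rule in_regular_polygonI[OF n])
      fix e
      have "e mod int n \<in> {0..<int n}" using n by simp
      then have "0 < edge_height n (e mod int n) w" using w by (auto simp: edge_height_def)
      then show "0 \<le> edge_height n e w" using n by (simp add: edge_height_mod)
    qed
  qed
qed

lemma frontier_regular_polygon:
  assumes n: "3 \<le> n" and z: "z \<in> regular_polygon n"
  shows "z \<in> frontier (regular_polygon n) \<longleftrightarrow> (\<exists>e. edge_height n e z = 0)"
proof -
  have "z \<in> frontier (regular_polygon n) \<longleftrightarrow> z \<notin> interior (regular_polygon n)"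
    using z closure_subset by (auto simp: frontier_def)
  moreover have "z \<in> interior (regular_polygon n) \<longleftrightarrow> (\<forall>e. 0 < edge_height n e z)"
    using edge_height_pos[of n z] in_interior_polygonI[OF n] n by auto
  ultimately show ?thesis using edge_height_nonneg[of n z] n z by (metis less_le less_irrefl not_numeral_le_zero gr0I)
qed

lemma frontier_polygon_subset: "z \<in> frontier (regular_polygon n) \<Longrightarrow> z \<in> regular_polygon n"
  using compact_regular_polygon[of n] by (meson compact_imp_closed frontier_subset_closed subsetD)

section \<open>Points of the double and estimates for its metric\<close>

definition doubled_point :: "nat \<Rightarrow> bool \<Rightarrow> complex \<Rightarrow> (bool \<times> complex) set" where
  "doubled_point n s z = glue n `` {(s, z)}"

lemma doubled_point_in: "z \<in> regular_polygon n \<Longrightarrow> doubled_point n s z \<in> doubled_points n"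
  by (auto simp: doubled_point_def doubled_points_def sheets_def intro: quotientI)

lemma doubled_points_cases:
  assumes "X \<in> doubled_points n"
  obtains s z where "z \<in> regular_polygon n" "X = doubled_point n s z"
  using assms by (rule doubled_pointsE) (auto simp: doubled_point_def sheets_def)

lemma mem_doubled_point:
  "z \<in> regular_polygon n \<Longrightarrow>
    (s', z') \<in> doubled_point n s z \<longleftrightarrow> z' = z \<and> (s' = s \<or> z \<in> frontier (regular_polygon n))"
  by (auto simp: doubled_point_def glue_def sheets_def)

lemma doubled_point_eq_iff:
  assumes "z \<in> regular_polygon n" "z' \<in> regular_polygon n"
  shows "doubled_point n s z = doubled_point n s' z' \<longleftrightarrow> z = z' \<and> (s = s' \<or> z \<in> frontier (regular_polygon n))"
proof
  assume "doubled_point n s z = doubled_point n s' z'"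
  then have "(s, z) \<in> doubled_point n s' z'" using mem_doubled_point[OF assms(1), of s z s] by simp
  then show "z = z' \<and> (s = s' \<or> z \<in> frontier (regular_polygon n))"
    using mem_doubled_point[OF assms(2), of s z s'] by auto
next
  assume "z = z' \<and> (s = s' \<or> z \<in> frontier (regular_polygon n))"
  then show "doubled_point n s z = doubled_point n s' z'"
    by (intro set_eqI) (auto simp: mem_doubled_point assms)
qed

lemma doubled_dist_le_broken:
  assumes "X \<in> doubled_points n" "Y \<in> doubled_points n" "broken_path n X Y m p q"
  shows "doubled_dist n X Y \<le> (\<Sum>i\<le>m. dist (snd (p i)) (snd (q i)))"
proof -
  have "(\<Sum>i\<le>m. dist (snd (p i)) (snd (q i))) \<in> broken_path_lengths n X Y"
    using assms(3) unfolding broken_path_lengths_def by blast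
  from cInf_lower[OF this bdd_below_broken_path_lengths] show ?thesis
    using assms by (simp add: doubled_dist_def)
qed

lemma doubled_dist_same_sheet_le:
  assumes "z \<in> regular_polygon n" "z' \<in> regular_polygon n"
  shows "doubled_dist n (doubled_point n s z) (doubled_point n s z') \<le> dist z z'"
proof -
  have "broken_path n (doubled_point n s z) (doubled_point n s z') 0 (\<lambda>_. (s, z)) (\<lambda>_. (s, z'))"
    using assms by (simp add: broken_path_def mem_doubled_point sheets_def)
  from doubled_dist_le_broken[OF _ _ this] show ?thesis using assms by (simp add: doubled_point_in)
qed

lemma doubled_dist_via_frontier_le:
  assumes "z \<in> regular_polygon n" "z' \<in> regular_polygon n" "b \<in> frontier (regular_polygon n)"
  shows "doubled_dist n (doubled_point n s z) (doubled_point n s' z') \<le> dist z b + dist b z'"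
proof -
  have b: "b \<in> regular_polygon n" using assms(3) by (rule frontier_polygon_subset)
  have "doubled_point n s b = doubled_point n s' b" using b assms(3) by (simp add: doubled_point_eq_iff)
  then show ?thesis
    using doubled_dist_same_sheet_le[OF assms(1) b, of s] doubled_dist_same_sheet_le[OF b assms(2), of s']
      Metric_space.triangle[OF Metric_space_doubled doubled_point_in[OF assms(1)] doubled_point_in[OF b] doubled_point_in[OF assms(2)], of s s' s']
    by simp
qed

text \<open>The source of lower bounds on the metric: add up the Lipschitz estimates along a broken
  path, using that \<open>f\<close> does not see the gluing. Nearly shortest paths stay within
  \<open>\<kappa>\<close> of \<open>c\<close>, so the hypotheses on \<open>f\<close> are required
  only there.\<close>

lemma local_lipschitz_le_doubled_dist:
  fixes f :: "bool \<times> complex \<Rightarrow> 'a :: metric_space"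
  assumes z: "z \<in> regular_polygon n" "z' \<in> regular_polygon n"
    and lip: "\<And>s u v. \<lbrakk>u \<in> regular_polygon n; v \<in> regular_polygon n; dist c u < \<kappa>; dist c v < \<kappa>\<rbrakk>
      \<Longrightarrow> dist (f (s, u)) (f (s, v)) \<le> dist u v"
    and glued: "\<And>s s' u. \<lbrakk>u \<in> frontier (regular_polygon n); dist c u < \<kappa>\<rbrakk> \<Longrightarrow> f (s, u) = f (s', u)"
    and small: "dist c z + doubled_dist n (doubled_point n s z) (doubled_point n s' z') < \<kappa>"
  shows "dist (f (s, z)) (f (s', z')) \<le> doubled_dist n (doubled_point n s z) (doubled_point n s' z')"
proof -
  let ?X = "doubled_point n s z" and ?Y = "doubled_point n s' z'"
  let ?L = "broken_path_lengths n ?X ?Y"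
  have XY: "?X \<in> doubled_points n" "?Y \<in> doubled_points n" using z by (simp_all add: doubled_point_in)
  have D: "doubled_dist n ?X ?Y = Inf ?L" using XY by (simp add: doubled_dist_def)
  have main: "dist (f (s, z)) (f (s', z')) \<le> l" if L: "l \<in> ?L" "dist c z + l < \<kappa>" for l
  proof -
    obtain m p q where l: "l = (\<Sum>i\<le>m. dist (snd (p i)) (snd (q i)))" and bp: "broken_path n ?X ?Y m p q"
      using L(1) unfolding broken_path_lengths_def by blast
    have in_P: "snd (p i) \<in> regular_polygon n" "snd (q i) \<in> regular_polygon n" "fst (p i) = fst (q i)" if "i \<le> m" for i
      using bp that by (auto simp: broken_path_def sheets_def mem_Times_iff)
    have p0: "snd (p 0) = z" "fst (p 0) = s \<or> z \<in> frontier (regular_polygon n)"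
      using bp mem_doubled_point[OF z(1), of "fst (p 0)" "snd (p 0)" s] unfolding broken_path_def prod.collapse by blast+
    have qm: "snd (q m) = z'" "fst (q m) = s' \<or> z' \<in> frontier (regular_polygon n)"
      using bp mem_doubled_point[OF z(2), of "fst (q m)" "snd (q m)" s'] unfolding broken_path_def prod.collapse by blast+
    have near_q: "dist c (snd (q i)) < \<kappa>" if i: "i \<le> m" for i
    proof -
      have "dist z (snd (q i)) \<le> (\<Sum>j\<le>i. dist (snd (p j)) (snd (q j)))"
        using broken_path_dist_le[OF bp i] p0 by simp
      also have "\<dots> \<le> l" unfolding l using i by (intro sum_mono2) auto
      finally show ?thesis using L(2) dist_triangle[of c "snd (q i)" z] by linarith
    qed
    have "0 \<le> l" unfolding l by (intro sum_nonneg) auto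
    then have near_z: "dist c z < \<kappa>" using L(2) by linarith
    have glue: "snd (q i) = snd (p (Suc i))" "fst (q i) = fst (p (Suc i)) \<or> snd (q i) \<in> frontier (regular_polygon n)"
      if "i < m" for i
      using bp that by (auto simp: broken_path_def glue_def)
    have near_p: "dist c (snd (p i)) < \<kappa>" if "i \<le> m" for i
    proof (cases i)
      case (Suc j) then show ?thesis using near_q[of j] glue(1)[of j] that by simp
    qed (use near_z p0 in simp)
    have jump: "dist (f (p i)) (f (q i)) \<le> dist (snd (p i)) (snd (q i))" if "i \<le> m" for i
    proof -
      have "(fst (p i), snd (p i)) = p i" "(fst (p i), snd (q i)) = q i"
        using in_P(3)[OF that] by (simp_all add: prod_eq_iff)
      then show ?thesis
        using lip[OF in_P(1,2)[OF that] near_p near_q, OF that that, of "fst (p i)"] by (simp only:)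
    qed
    have "dist (f (p 0)) (f (q i)) \<le> (\<Sum>j\<le>i. dist (snd (p j)) (snd (q j)))" if "i \<le> m" for i
      using that
    proof (induction i)
      case 0 then show ?case using jump by simp
    next
      case (Suc i)
      have "f (fst (q i), snd (q i)) = f (fst (p (Suc i)), snd (q i))"
        using glue(2)[of i] glued[OF _ near_q[of i]] Suc.prems by fastforce
      then have "f (q i) = f (p (Suc i))" using glue(1)[of i] Suc.prems by (metis Suc_le_lessD prod.collapse)
      then show ?case
        using Suc jump[of "Suc i"] dist_triangle[of "f (p 0)" "f (q (Suc i))" "f (p (Suc i))"] by simp
    qed
    from this[of m] have "dist (f (p 0)) (f (q m)) \<le> l" by (simp add: l)
    moreover have "f (fst (p 0), z) = f (s, z)" using p0(2) glued[of z] near_z by auto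
    then have "f (p 0) = f (s, z)" using p0(1) by (metis prod.collapse)
    moreover have "f (fst (q m), z') = f (s', z')" using qm glued[of z'] near_q[of m] by auto
    then have "f (q m) = f (s', z')" using qm(1) by (metis prod.collapse)
    ultimately show ?thesis by simp
  qed
  show ?thesis
  proof (rule field_le_epsilon)
    fix \<epsilon> :: real assume "0 < \<epsilon>"
    \<comment> \<open>The second entry of the minimum keeps the chosen broken path inside the ball
      of radius \<open>\<kappa>\<close>.\<close>
    define \<epsilon>' where "\<epsilon>' = min \<epsilon> (\<kappa> - dist c z - Inf ?L)"
    have "0 < \<epsilon>'" using \<open>0 < \<epsilon>\<close> small by (simp add: \<epsilon>'_def D)
    then obtain l where l: "l \<in> ?L" "l < Inf ?L + \<epsilon>'"
      using cInf_lessD[OF broken_path_lengths_nonempty[OF XY], of "Inf ?L + \<epsilon>'"] by auto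
    then have "dist c z + l < \<kappa>" by (simp add: \<epsilon>'_def)
    then show "dist (f (s, z)) (f (s', z')) \<le> doubled_dist n ?X ?Y + \<epsilon>"
      using main[OF l(1)] l(2) by (simp add: D \<epsilon>'_def)
  qed
qed

lemma lipschitz_le_doubled_dist:
  fixes f :: "bool \<times> complex \<Rightarrow> 'a :: metric_space"
  assumes "z \<in> regular_polygon n" "z' \<in> regular_polygon n"
    and "\<And>s u v. \<lbrakk>u \<in> regular_polygon n; v \<in> regular_polygon n\<rbrakk> \<Longrightarrow> dist (f (s, u)) (f (s, v)) \<le> dist u v"
    and "\<And>s s' u. u \<in> frontier (regular_polygon n) \<Longrightarrow> f (s, u) = f (s', u)"
  shows "dist (f (s, z)) (f (s', z')) \<le> doubled_dist n (doubled_point n s z) (doubled_point n s' z')"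
  using assms
  by (intro local_lipschitz_le_doubled_dist[where c = z
      and \<kappa> = "doubled_dist n (doubled_point n s z) (doubled_point n s' z') + 1"]) auto

lemma dist_le_doubled_dist:
  assumes "z \<in> regular_polygon n" "z' \<in> regular_polygon n"
  shows "dist z z' \<le> doubled_dist n (doubled_point n s z) (doubled_point n s' z')"
  using lipschitz_le_doubled_dist[OF assms, of snd s s'] by simp

lemma doubled_dist_same_sheet:
  assumes "z \<in> regular_polygon n" "z' \<in> regular_polygon n"
  shows "doubled_dist n (doubled_point n s z) (doubled_point n s z') = dist z z'"
  using doubled_dist_same_sheet_le[OF assms] dist_le_doubled_dist[OF assms] by (intro antisym)

lemma dist_add_scaleR_sq:
  "(dist a (z + t *\<^sub>R v))\<^sup>2 = (dist a z)\<^sup>2 + 2 * t * inner v (z - a) + t\<^sup>2 * inner v v"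
  for a z v :: "'a :: real_inner"
proof -
  have "dist a (z + t *\<^sub>R v) = norm ((z - a) + t *\<^sub>R v)"
    by (simp add: dist_norm norm_minus_commute algebra_simps)
  then show ?thesis
    using dot_norm[of "z - a" "t *\<^sub>R v"]
    by (simp add: dist_norm norm_minus_commute power_mult_distrib inner_commute flip: power2_norm_eq_inner)
qed

text \<open>Unfolding across the line of edge \<open>e\<close>: the right-hand side is the squared
  distance from \<open>z\<close> to the mirror image \<open>w\<close> of \<open>z'\<close>. The
  segment to \<open>w\<close> meets the line at \<open>c\<close>, and folding it back there gives a
  path of the same length to \<open>z'\<close>.\<close>

lemma doubled_dist_sq_le:
  assumes n: "3 \<le> n" and z: "z \<in> regular_polygon n" "z' \<in> regular_polygon n"
  shows "(doubled_dist n (doubled_point n s z) (doubled_point n s' z'))\<^sup>2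
    \<le> (dist z z')\<^sup>2 + 4 * edge_height n e z * edge_height n e z'"
proof -
  define h h' where "h = edge_height n e z" and "h' = edge_height n e z'"
  define \<nu> where "\<nu> = edge_normal n e"
  have hh: "0 \<le> h" "0 \<le> h'" using edge_height_nonneg z n by (auto simp: h_def h'_def)
  have \<nu>: "inner \<nu> \<nu> = 1" by (simp add: \<nu>_def)
  define w where "w = z' + (2 * h') *\<^sub>R \<nu>"
  have hw: "edge_height n e w = - h'" by (simp add: w_def edge_height_add h'_def \<nu>_def)
  have zw: "(dist z w)\<^sup>2 = (dist z z')\<^sup>2 + 4 * h * h'"
  proof -
    have "inner \<nu> (z' - z) = h - h'" by (simp add: h_def h'_def edge_height_def \<nu>_def inner_diff_right)
    moreover have "(dist z w)\<^sup>2 = (dist z z')\<^sup>2 + 4 * h' * inner \<nu> (z' - z) + 4 * h' * h' * inner \<nu> \<nu>"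
      using dist_add_scaleR_sq[of z z' "2 * h'" \<nu>] by (simp add: w_def power2_eq_square)
    ultimately have "(dist z w)\<^sup>2 = (dist z z')\<^sup>2 + 4 * h' * (h - h') + 4 * h' * h' * 1" by (simp only: \<nu>)
    then show ?thesis by (simp add: algebra_simps)
  qed
  obtain a b where ab: "0 \<le> a" "0 \<le> b" "a + b = 1" "a * h = b * h'"
  proof (cases "h + h' = 0")
    case True
    then show ?thesis using that[of 1 0] hh by simp
  next
    case False
    then show ?thesis
      using that[of "h' / (h + h')" "h / (h + h')"] hh by (simp add: add_divide_distrib[symmetric] add.commute)
  qed
  define c where "c = a *\<^sub>R z + b *\<^sub>R w"
  have hc: "edge_height n e c = 0"
    using ab(4) unfolding c_def edge_height_convex[OF ab(3)] by (simp add: hw flip: h_def)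
  have len: "dist z c + dist c w = dist z w"
  proof -
    have "z - c = (1 - a) *\<^sub>R z - b *\<^sub>R w" "c - w = a *\<^sub>R z - (1 - b) *\<^sub>R w"
      by (simp_all add: c_def scaleR_left_diff_distrib)
    moreover have "1 - a = b" "1 - b = a" using ab(3) by simp_all
    ultimately have "z - c = b *\<^sub>R (z - w)" "c - w = a *\<^sub>R (z - w)"
      by (simp_all only: scaleR_right_diff_distrib)
    then have "dist z c + dist c w = (b + a) * dist z w"
      using ab(1,2) by (simp only: dist_norm norm_scaleR abs_of_nonneg distrib_right)
    then show ?thesis using ab(3) by (simp only: add.commute mult_1)
  qed
  have "(dist c w)\<^sup>2 = (dist c z')\<^sup>2"
  proof -
    have "inner \<nu> (z' - c) = - h'" using hc by (simp add: h'_def edge_height_def \<nu>_def inner_diff_right)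
    moreover have "(dist c w)\<^sup>2 = (dist c z')\<^sup>2 + 4 * h' * inner \<nu> (z' - c) + 4 * h' * h' * inner \<nu> \<nu>"
      using dist_add_scaleR_sq[of c z' "2 * h'" \<nu>] by (simp add: w_def power2_eq_square)
    ultimately have "(dist c w)\<^sup>2 = (dist c z')\<^sup>2 + 4 * h' * - h' + 4 * h' * h' * 1" by (simp only: \<nu>)
    then show ?thesis by simp
  qed
  then have cw: "dist c w = dist c z'" by (simp add: power2_eq_iff_nonneg)
  \<comment> \<open>The line may be crossed beyond the edge, outside the polygon; the segment from
    \<open>z\<close> to \<open>c\<close> then meets the boundary earlier, at \<open>b\<close>, and
    the triangle inequality covers the detour.\<close>
  have "c \<notin> interior (regular_polygon n)" using edge_height_pos[of n c e] n hc by auto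
  obtain b where b: "b \<in> frontier (regular_polygon n)" "b \<in> closed_segment z c"
  proof (cases "c \<in> regular_polygon n")
    case True
    then show ?thesis using that[of c] frontier_regular_polygon[OF n True] hc by auto
  next
    case False
    then have "closed_segment z c \<inter> frontier (regular_polygon n) \<noteq> {}"
      using z(1) by (intro connected_Int_frontier) auto
    then show ?thesis using that by blast
  qed
  have "doubled_dist n (doubled_point n s z) (doubled_point n s' z') \<le> dist z b + dist b z'"
    by (rule doubled_dist_via_frontier_le[OF z b(1)])
  also have "\<dots> \<le> dist z b + dist b c + dist c z'" using dist_triangle[of b z' c] by simp
  also have "dist z b + dist b c = dist z c" using b(2) between[of z c b] between_mem_segment[of z c b] by simp
  also have "dist z c + dist c z' = dist z w" using len cw by simp
  finally have "doubled_dist n (doubled_point n s z) (doubled_point n s' z') \<le> dist z w" .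
  moreover have "0 \<le> doubled_dist n (doubled_point n s z) (doubled_point n s' z')"
    by (rule Metric_space.nonneg[OF Metric_space_doubled])
  ultimately show ?thesis
    unfolding h_def[symmetric] h'_def[symmetric] zw[symmetric] by (rule power_mono)
qed

section \<open>Geodesics as billiard trajectories\<close>

lemma edge_height_pos_iff:
  assumes "3 \<le> n" "z \<in> regular_polygon n"
  shows "z \<notin> frontier (regular_polygon n) \<longleftrightarrow> (\<forall>e. 0 < edge_height n e z)"
  using frontier_regular_polygon[OF assms] edge_height_nonneg[OF _ assms(2)] assms(1)
  by (metis less_le less_irrefl not_numeral_le_zero gr0I)

lemma dist_eq_imp_affine:
  fixes x y z :: "'a :: real_inner"
  assumes "dist x y = a" "dist y z = b" "dist x z = a + b"
  shows "(a + b) *\<^sub>R y = b *\<^sub>R x + a *\<^sub>R z"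
proof -
  have "dist x z = dist x y + dist y z" using assms by simp
  then have "a *\<^sub>R (y - z) = b *\<^sub>R (x - y)"
    using assms unfolding dist_triangle_eq by (simp add: dist_norm)
  then show ?thesis by (simp add: algebra_simps)
qed

text \<open>Equality in the triangle inequality places the middle of three points on the segment of
  the outer ones, so two known points determine a third. The straight part grows by steps of
  \<open>l / 2\<close>, the known points being at \<open>t - l\<close> and
  \<open>t - l / 2\<close>.\<close>

lemma local_isometry_affine:
  fixes z :: "real \<Rightarrow> 'a :: real_inner"
  assumes l: "0 < l" and ab: "a < b"
    and iso: "\<And>t u. \<lbrakk>t \<in> {a..b}; u \<in> {a..b}; \<bar>t - u\<bar> \<le> l\<rbrakk> \<Longrightarrow> dist (z t) (z u) = \<bar>t - u\<bar>"
  obtains w where "norm w = 1" "\<And>t. t \<in> {a..b} \<Longrightarrow> z t = z a + (t - a) *\<^sub>R w"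
proof -
  define m where "m = min l (b - a)"
  have m: "0 < m" "m \<le> l" "a + m \<le> b" using l ab by (auto simp: m_def)
  define w where "w = (1 / m) *\<^sub>R (z (a + m) - z a)"
  have step: "(v - t) *\<^sub>R z u = (v - u) *\<^sub>R z t + (u - t) *\<^sub>R z v"
    if "a \<le> t" "t \<le> u" "u \<le> v" "v \<le> b" "v - t \<le> l" for t u v
    using dist_eq_imp_affine[of "z t" "z u" "u - t" "z v" "v - u"] iso[of t u] iso[of u v] iso[of t v] that by simp
  have base: "z t = z a + (t - a) *\<^sub>R w" if "a \<le> t" "t \<le> a + m" for t
  proof -
    have "m *\<^sub>R z t = (m - (t - a)) *\<^sub>R z a + (t - a) *\<^sub>R z (a + m)"
      using step[of a t "a + m"] that m by (simp add: algebra_simps)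
    also have "z (a + m) = z a + m *\<^sub>R w" using m by (simp add: w_def)
    also have "(m - (t - a)) *\<^sub>R z a + (t - a) *\<^sub>R (z a + m *\<^sub>R w) = m *\<^sub>R (z a + (t - a) *\<^sub>R w)"
      by (simp add: algebra_simps)
    finally show ?thesis using m by simp
  qed
  have main: "\<forall>t\<in>{a..b}. t \<le> a + m + real i * (l / 2) \<longrightarrow> z t = z a + (t - a) *\<^sub>R w" for i
  proof (induction i)
    case 0
    then show ?case by (intro ballI impI base) auto
  next
    case (Suc i)
    show ?case
    proof (intro ballI impI)
      fix t assume t: "t \<in> {a..b}" "t \<le> a + m + real (Suc i) * (l / 2)"
      show "z t = z a + (t - a) *\<^sub>R w"
      proof (cases "t \<le> a + m")
        case False
        then have "m = l" using t by (auto simp: m_def min_def split: if_splits)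
        define x y where "x = t - l" and "y = t - l / 2"
        have xy: "a \<le> x" "x < y" "y < t" using False \<open>m = l\<close> l by (auto simp: x_def y_def)
        have "t \<le> a + m + real i * (l / 2) + l / 2" using t(2) by (simp add: field_simps)
        then have "x \<le> a + m + real i * (l / 2)" "y \<le> a + m + real i * (l / 2)"
          using l by (simp_all add: x_def y_def)
        then have "z x = z a + (x - a) *\<^sub>R w" "z y = z a + (y - a) *\<^sub>R w"
          using Suc[rule_format, of x] Suc[rule_format, of y] t xy by simp_all
        moreover have "(t - x) *\<^sub>R z y = (t - y) *\<^sub>R z x + (y - x) *\<^sub>R z t"
          using step[of x y t] xy t by (simp add: x_def)
        ultimately have "(t - x) *\<^sub>R (z a + (y - a) *\<^sub>R w) = (t - y) *\<^sub>R (z a + (x - a) *\<^sub>R w) + (y - x) *\<^sub>R z t"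
          by (simp only:)
        then have "(y - x) *\<^sub>R z t = (y - x) *\<^sub>R (z a + (t - a) *\<^sub>R w)"
          by (simp add: algebra_simps)
        then show ?thesis using xy by simp
      qed (use base[of t] t in simp)
    qed
  qed
  have "z t = z a + (t - a) *\<^sub>R w" if t: "t \<in> {a..b}" for t
  proof -
    obtain i :: nat where "t - a - m < real i * (l / 2)"
      using reals_Archimedean3[of "l / 2"] l half_gt_zero by blast
    then show ?thesis using main[of i, rule_format, OF t] by simp
  qed
  moreover have "norm w = 1"
    using iso[of a "a + m"] m ab by (simp add: w_def dist_norm norm_minus_commute)
  ultimately show ?thesis using that by blast
qed

lemma unit_vectors_eqI:
  fixes v v' :: "'a :: real_inner"
  assumes "norm v = 1" "norm v' = 1" "1 \<le> inner v v'"
  shows "v = v'"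
proof -
  have "(norm (v - v'))\<^sup>2 = 2 - 2 * inner v v'"
    using dot_norm_neg[of v v'] assms(1,2) by simp
  then have "(norm (v - v'))\<^sup>2 \<le> 0" using assms(3) by simp
  then show ?thesis by simp
qed

text \<open>A \<open>1/k\<close> geodesic parametrized by arc length, lifted to a sheet
  \<open>s t\<close> and a position \<open>z t\<close>; its length is \<open>k * l\<close> and each
  piece of length \<open>l\<close> is minimizing. At boundary points the sheet is an arbitrary
  choice, so periodicity is stated for classes.\<close>

locale polygon_geodesic =
  fixes n k :: nat and l :: real and s :: "real \<Rightarrow> bool" and z :: "real \<Rightarrow> complex"
  assumes n: "3 \<le> n" and k: "2 \<le> k" and l: "0 < l"
    and z_in: "\<And>t. z t \<in> regular_polygon n"
    and iso: "\<And>t u. \<bar>t - u\<bar> \<le> l \<Longrightarrow>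
      doubled_dist n (doubled_point n (s t) (z t)) (doubled_point n (s u) (z u)) = \<bar>t - u\<bar>"
    and periodic: "\<And>t. doubled_point n (s (t + k * l)) (z (t + k * l)) = doubled_point n (s t) (z t)"
begin

section \<open>Boundary times and the gaps between them\<close>

definition F :: "real set" where
  "F = {t. z t \<in> frontier (regular_polygon n)}"

lemma not_F: "t \<notin> F \<Longrightarrow> 0 < edge_height n e (z t)"
  using edge_height_pos_iff[OF n z_in] by (auto simp: F_def)

lemma F_iff: "t \<in> F \<longleftrightarrow> (\<exists>e. edge_height n e (z t) = 0)"
  using frontier_regular_polygon[OF n z_in] by (simp add: F_def)

lemma height_nonneg: "0 \<le> edge_height n e (z t)"
  using edge_height_nonneg z_in n by auto

text \<open>A boundary point belongs to both sheets and may be moved to the sheet of the other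
  point, where the metric is Euclidean.\<close>

lemma dist_same_sheet:
  assumes "\<bar>t - u\<bar> \<le> l" "s t = s u \<or> t \<in> F \<or> u \<in> F"
  shows "dist (z t) (z u) = \<bar>t - u\<bar>"
proof -
  have "doubled_point n (s t) (z t) = doubled_point n (s u) (z t) \<or>
      doubled_point n (s u) (z u) = doubled_point n (s t) (z u)"
    using assms(2) z_in by (auto simp: doubled_point_eq_iff F_def)
  then show ?thesis
    using iso[OF assms(1)] doubled_dist_same_sheet[OF z_in z_in] by metis
qed

lemma z_periodic: "z (t + k * l) = z t"
  and F_periodic: "t + k * l \<in> F \<longleftrightarrow> t \<in> F"
  and s_periodic: "t \<notin> F \<Longrightarrow> s (t + k * l) = s t"
  using periodic[of t] z_in by (auto simp: doubled_point_eq_iff F_def)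

text \<open>Such a curve would be a straight ray, and the polygon is bounded.\<close>

lemma no_infinite_ray:
  assumes "\<And>t u. \<lbrakk>a \<le> t; a \<le> u; \<bar>t - u\<bar> \<le> l\<rbrakk> \<Longrightarrow> dist (z t) (z u) = \<bar>t - u\<bar>"
  shows False
proof -
  obtain B where B: "0 < B" "\<And>x. x \<in> regular_polygon n \<Longrightarrow> norm x \<le> B"
    using compact_regular_polygon[of n] compact_imp_bounded bounded_pos by metis
  define b where "b = a + 2 * B + 1"
  have "a < b" using B by (simp add: b_def)
  then obtain w where w: "norm w = 1" "\<And>t. t \<in> {a..b} \<Longrightarrow> z t = z a + (t - a) *\<^sub>R w"
    using local_isometry_affine[of l a b z] l assms by auto
  have "z b = z a + (b - a) *\<^sub>R w" using w(2)[of b] \<open>a < b\<close> by simp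
  then have "norm (z b - z a) = b - a" using w(1) \<open>a < b\<close> by simp
  moreover have "norm (z b - z a) \<le> B + B" by (rule order_trans[OF norm_triangle_ineq4 add_mono[OF B(2) B(2)]]) (rule z_in)+
  ultimately show False by (simp add: b_def)
qed

text \<open>The point at time \<open>u\<close> lies strictly between those at \<open>t\<close> and
  \<open>v\<close> on a Euclidean segment. Its height over some edge is 0 and a convex combination
  of nonnegative heights, so the height at \<open>v\<close> is 0 too.\<close>

lemma F_continues:
  assumes "t \<in> F" "u \<in> F" "t < u" "u \<le> v" "v - t \<le> l"
  shows "v \<in> F"
proof (cases "u = v")
  case False
  then have uv: "u < v" using assms by simp
  obtain e where e: "edge_height n e (z u) = 0" using assms(2) F_iff by blast
  have "(v - t) *\<^sub>R z u = (v - u) *\<^sub>R z t + (u - t) *\<^sub>R z v"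
    using dist_eq_imp_affine[of "z t" "z u" "u - t" "z v" "v - u"]
      dist_same_sheet[of t u] dist_same_sheet[of u v] dist_same_sheet[of t v] assms uv by simp
  then have "z u = (1 / (v - t)) *\<^sub>R ((v - u) *\<^sub>R z t + (u - t) *\<^sub>R z v)"
    using assms uv by (metis diff_gt_0_iff_gt less_numeral_extra(3) order.strict_trans scaleR_one scaleR_scaleR divide_self times_divide_eq_left mult_1)
  also have "\<dots> = ((v - u) / (v - t)) *\<^sub>R z t + ((u - t) / (v - t)) *\<^sub>R z v"
    by (simp add: scaleR_right_distrib)
  finally have "edge_height n e (z u)
      = (v - u) / (v - t) * edge_height n e (z t) + (u - t) / (v - t) * edge_height n e (z v)"
    using edge_height_convex[of "(v - u) / (v - t)" "(u - t) / (v - t)" n e "z t" "z v"] assms uv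
    by (simp add: add_divide_distrib[symmetric])
  then have "0 = (v - u) / (v - t) * edge_height n e (z t) + (u - t) / (v - t) * edge_height n e (z v)"
    using e by simp
  moreover have "0 \<le> (v - u) / (v - t) * edge_height n e (z t)"
    using assms uv height_nonneg by simp
  moreover have "0 \<le> edge_height n e (z v)" "0 < (u - t) / (v - t)" using height_nonneg assms uv by simp_all
  ultimately have "edge_height n e (z v) = 0"
    by (smt (verit) mult_pos_pos)
  then show ?thesis using F_iff by blast
qed (use assms in simp)

text \<open>Otherwise \<open>F_continues\<close> applies repeatedly and advances by
  \<open>\<eta>\<close> each time, so the curve stays in the boundary forever and traces an infinite
  ray.\<close>

lemma F_gap:
  assumes "t \<in> F" "u \<in> F" "t < u"
  shows "l \<le> u - t"
proof (rule ccontr)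
  assume "\<not> l \<le> u - t"
  define \<eta> where "\<eta> = t + l - u"
  have \<eta>: "0 < \<eta>" "\<eta> < l" using \<open>\<not> l \<le> u - t\<close> assms by (auto simp: \<eta>_def)
  have "\<forall>v. u \<le> v \<longrightarrow> v \<le> u + real (Suc i) * \<eta> \<longrightarrow> v \<in> F" for i
  proof (induction i)
    case 0
    then show ?case using F_continues[OF assms] by (auto simp: \<eta>_def)
  next
    case (Suc i)
    show ?case
    proof (intro allI impI)
      fix v assume v: "u \<le> v" "v \<le> u + real (Suc (Suc i)) * \<eta>"
      show "v \<in> F"
      proof (cases "v \<le> u + real (Suc i) * \<eta>")
        case False
        have pos: "0 < real (Suc i) * \<eta>" using \<eta> by simp
        show ?thesis
        proof (rule F_continues[of "max u (v - l)" "u + real (Suc i) * \<eta>"])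
          show "u + real (Suc i) * \<eta> \<in> F" using Suc pos by simp
          show "max u (v - l) < u + real (Suc i) * \<eta>" using v pos \<eta> by (simp add: algebra_simps)
          then show "max u (v - l) \<in> F" using Suc by simp
        qed (use False in auto)
      qed (use Suc v in auto)
    qed
  qed
  moreover have "\<exists>i. v \<le> u + real (Suc i) * \<eta>" for v
  proof -
    obtain i :: nat where "v - u < real i * \<eta>" using reals_Archimedean3[OF \<eta>(1)] by auto
    then show ?thesis using \<eta> by (intro exI[of _ i]) (simp add: algebra_simps)
  qed
  ultimately have "v \<in> F" if "u \<le> v" for v using that by blast
  then show False using no_infinite_ray[of u] dist_same_sheet by blast
qed

text \<open>Measured with a sign given by the sheet, the distance to the boundary is 1-Lipschitz on the
  doubled polygon and vanishes exactly on the boundary, so the intermediate value theorem applies.\<close>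

lemma sheet_constant:
  assumes "\<And>v. \<lbrakk>t \<le> v; v \<le> u\<rbrakk> \<Longrightarrow> v \<notin> F" "t \<le> u"
  shows "s t = s u"
proof (rule ccontr)
  assume ne: "s t \<noteq> s u"
  let ?Fr = "frontier (regular_polygon n)"
  define \<Phi> where "\<Phi> x = (if fst x then 1 else - 1) * infdist (snd x) ?Fr" for x :: "bool \<times> complex"
  have Fr: "?Fr \<noteq> {}"
    using z_in[of 0] compact_regular_polygon[of n] not_compact_UNIV frontier_not_empty by (metis empty_iff)
  define g where "g v = \<Phi> (s v, z v)" for v
  have lip: "dist (g v) (g w) \<le> \<bar>v - w\<bar>" if "\<bar>v - w\<bar> \<le> l" for v w
    unfolding g_def iso[OF that, symmetric]
    by (rule lipschitz_le_doubled_dist[OF z_in z_in])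
      (auto simp: \<Phi>_def dist_real_def abs_minus_commute infdist_triangle_abs)
  have cont: "continuous_on {t..u} g"
    unfolding continuous_on_iff
  proof (intro ballI allI impI)
    fix v e :: real assume "0 < e"
    then have "dist (g w) (g v) < e" if "dist w v < min e l" for w
      using lip[of w v] that by (simp add: dist_real_def)
    then show "\<exists>d>0. \<forall>w\<in>{t..u}. dist w v < d \<longrightarrow> dist (g w) (g v) < e"
      using l \<open>0 < e\<close> by (intro exI[of _ "min e l"]) simp
  qed
  have g0: "g v \<noteq> 0" if "v \<in> {t..u}" for v
    using assms(1)[of v] that in_closed_iff_infdist_zero[OF frontier_closed Fr] by (auto simp: g_def \<Phi>_def F_def)
  have sgn: "g v \<ge> 0 \<longleftrightarrow> s v" if "v \<in> {t..u}" for v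
    using g0[OF that] infdist_nonneg[of "z v" ?Fr] by (auto simp: g_def \<Phi>_def)
  show False
  proof (cases "s t")
    case True
    then have "g u \<le> 0" "0 \<le> g t" using sgn[of t] sgn[of u] ne assms by auto
    then show False using IVT2'[of g u 0 t] cont assms g0 by auto
  next
    case False
    then have "g t \<le> 0" "0 \<le> g u" using sgn[of t] sgn[of u] ne assms by auto
    then show False using IVT'[of g t 0 u] cont assms g0 by auto
  qed
qed

text \<open>The sheet is constant between the two boundary times, and the endpoints belong to both
  sheets, so the closed piece is a local isometry into the plane.\<close>

lemma chord_affine:
  assumes "a \<in> F" "b \<in> F" "a < b" "\<And>v. \<lbrakk>a < v; v < b\<rbrakk> \<Longrightarrow> v \<notin> F"
  obtains w where "norm w = 1" "\<And>t. t \<in> {a..b} \<Longrightarrow> z t = z a + (t - a) *\<^sub>R w"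
proof -
  have "dist (z t) (z u) = \<bar>t - u\<bar>" if "t \<in> {a..b}" "u \<in> {a..b}" "\<bar>t - u\<bar> \<le> l" for t u
  proof (rule dist_same_sheet[OF that(3)])
    show "s t = s u \<or> t \<in> F \<or> u \<in> F"
    proof (cases "t \<in> {a<..<b} \<and> u \<in> {a<..<b}")
      case True
      then have "s t = s u"
      proof (induction t u rule: linorder_wlog)
        case (le t u)
        then show ?case by (intro sheet_constant assms(4)) auto
      qed simp
      then show ?thesis by simp
    qed (use that assms(1,2) in \<open>force simp: less_le\<close>)
  qed
  then show ?thesis using local_isometry_affine[OF l assms(3)] that by blast
qed

section \<open>The sequence of bounce times\<close>

definition is_next :: "real \<Rightarrow> real \<Rightarrow> bool" where
  "is_next t u \<longleftrightarrow> u \<in> F \<and> t < u \<and> (\<forall>v\<in>F. t < v \<longrightarrow> u \<le> v)"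

lemma is_next_unique: "is_next t u \<Longrightarrow> is_next t v \<Longrightarrow> u = v"
  unfolding is_next_def by (meson order_antisym)

text \<open>Without a later boundary time the curve would stay in one sheet and trace a ray. The
  infimum of these times is attained because they are at least \<open>l\<close> apart.\<close>

lemma ex_next: "\<exists>u. is_next t u"
proof -
  define S where "S = {u\<in>F. t < u}"
  have "S \<noteq> {}"
  proof
    assume "S = {}"
    then have no: "v \<notin> F" if "t < v" for v using that by (auto simp: S_def)
    have "s u = s v" if "t + 1 \<le> u" "t + 1 \<le> v" for u v
      using that
    proof (induction u v rule: linorder_wlog)
      case (le u v)
      then show ?case by (intro sheet_constant no) auto
    qed simp
    then show False using no_infinite_ray[of "t + 1"] dist_same_sheet by blast
  qed
  moreover have bdd: "bdd_below S" by (auto simp: S_def bdd_below_def intro: less_imp_le)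
  ultimately obtain u where u: "u \<in> S" "u < Inf S + l"
    using cInf_lessD[of S "Inf S + l"] l by auto
  have "u \<le> v" if "v \<in> S" for v
  proof (rule ccontr)
    assume "\<not> u \<le> v"
    then have "l \<le> u - v" using F_gap[of v u] u(1) that by (auto simp: S_def)
    then show False using cInf_lower[OF that bdd] u(2) by linarith
  qed
  then show ?thesis using u(1) by (auto simp: S_def is_next_def)
qed

definition nxt :: "real \<Rightarrow> real" where
  "nxt t = (THE u. is_next t u)"

lemma is_next_nxt: "is_next t (nxt t)"
  unfolding nxt_def using ex_next is_next_unique by (metis theI)

lemma nxt_periodic: "nxt (t + k * l) = nxt t + k * l"
proof -
  have "is_next (t + k * l) (nxt t + k * l)"
    unfolding is_next_def
  proof (intro conjI ballI impI)
    show "nxt t + k * l \<in> F" "t + k * l < nxt t + k * l"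
      using is_next_nxt[of t] by (auto simp: is_next_def F_periodic)
    fix v assume "v \<in> F" "t + k * l < v"
    then show "nxt t + k * l \<le> v"
      using is_next_nxt[of t] F_periodic[of "v - k * l"] unfolding is_next_def by (auto simp: algebra_simps)
  qed
  then show ?thesis using is_next_unique is_next_nxt by blast
qed

text \<open>The exponent \<open>Suc i\<close> makes even \<open>\<tau> 0\<close> a boundary time,
  which the time 0 itself need not be.\<close>

definition \<tau> :: "nat \<Rightarrow> real" where
  "\<tau> i = (nxt ^^ Suc i) 0"

lemma \<tau>_Suc: "\<tau> (Suc i) = nxt (\<tau> i)"
  by (simp add: \<tau>_def)

lemma \<tau>_F: "\<tau> i \<in> F"
  using is_next_nxt by (cases i) (auto simp: \<tau>_def is_next_def)

lemma \<tau>_less: "\<tau> i < \<tau> (Suc i)"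
  using is_next_nxt[of "\<tau> i"] by (simp add: \<tau>_Suc is_next_def)

lemma \<tau>_between: "\<tau> i < v \<Longrightarrow> v < \<tau> (Suc i) \<Longrightarrow> v \<notin> F"
  using is_next_nxt[of "\<tau> i"] by (force simp: \<tau>_Suc is_next_def)

lemma \<tau>_gap: "\<tau> i + l \<le> \<tau> (Suc i)"
  using F_gap[OF \<tau>_F \<tau>_F \<tau>_less, of i] by simp

text \<open>Gaps of at least \<open>l\<close> bring \<open>\<tau>\<close> past
  \<open>\<tau> 0 + k * l\<close> within \<open>k\<close> steps. That time is itself a boundary
  time, so the sequence cannot skip it.\<close>

lemma ex_period: "\<exists>N. 0 < N \<and> N \<le> k \<and> (\<forall>i. \<tau> (i + N) = \<tau> i + k * l)"
proof -
  have low: "\<tau> 0 + real i * l \<le> \<tau> i" for i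
  proof (induction i)
    case (Suc i)
    then show ?case using \<tau>_gap[of i] by (simp add: algebra_simps)
  qed simp
  define N where "N = (LEAST m. \<tau> 0 + k * l \<le> \<tau> m)"
  have N: "\<tau> 0 + k * l \<le> \<tau> N" unfolding N_def by (rule LeastI[of _ k]) (rule low)
  have Nk: "N \<le> k" unfolding N_def by (rule Least_le) (rule low)
  have "0 < k * l" using k l by simp
  then have "0 < N" using N by (cases N) auto
  then obtain M where M: "N = Suc M" by (cases N) auto
  have "\<not> \<tau> 0 + k * l \<le> \<tau> M" by (rule not_less_Least) (use M N_def in simp)
  then have "\<tau> N \<le> \<tau> 0 + k * l"
    using is_next_nxt[of "\<tau> M"] \<tau>_F[of 0] F_periodic[of "\<tau> 0"] by (simp add: M \<tau>_Suc is_next_def)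
  then have "\<tau> N = \<tau> 0 + k * l" using N by simp
  then have "\<tau> (i + N) = \<tau> i + k * l" for i
    by (induction i) (simp_all add: \<tau>_Suc nxt_periodic)
  then show ?thesis using \<open>0 < N\<close> Nk by blast
qed

section \<open>Chord directions and the law of reflection\<close>

definition w :: "nat \<Rightarrow> complex" where
  "w i = (1 / l) *\<^sub>R (z (\<tau> i + l) - z (\<tau> i))"

lemma norm_w [simp]: "norm (w i) = 1"
  and z_chord: "\<And>t. t \<in> {\<tau> i..\<tau> (Suc i)} \<Longrightarrow> z t = z (\<tau> i) + (t - \<tau> i) *\<^sub>R w i"
proof -
  have "\<exists>v. norm v = 1 \<and> (\<forall>t\<in>{\<tau> i..\<tau> (Suc i)}. z t = z (\<tau> i) + (t - \<tau> i) *\<^sub>R v)"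
    by (rule chord_affine[OF \<tau>_F[of i] \<tau>_F[of "Suc i"] \<tau>_less[of i]]) (use \<tau>_between in blast)+
  then obtain v where v: "norm v = 1" "\<And>t. t \<in> {\<tau> i..\<tau> (Suc i)} \<Longrightarrow> z t = z (\<tau> i) + (t - \<tau> i) *\<^sub>R v"
    by blast
  have "w i = v" using v(2)[of "\<tau> i + l"] \<tau>_gap[of i] l by (simp add: w_def)
  then show "norm (w i) = 1" "\<And>t. t \<in> {\<tau> i..\<tau> (Suc i)} \<Longrightarrow> z t = z (\<tau> i) + (t - \<tau> i) *\<^sub>R w i"
    using v by blast+
qed

text \<open>The choice depends on the bounce point alone, even at a vertex, so \<open>e\<close>
  inherits the periodicity of \<open>z\<close>.\<close>

definition e :: "nat \<Rightarrow> int" where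
  "e i = (SOME j. edge_height n j (z (\<tau> i)) = 0)"

lemma height_e: "edge_height n (e i) (z (\<tau> i)) = 0"
  unfolding e_def by (rule someI_ex) (use \<tau>_F[of i] F_iff in simp)

lemma z_after: "z (\<tau> i + l / 2) = z (\<tau> i) + (l / 2) *\<^sub>R w i"
  and z_before: "z (\<tau> (Suc i) - l / 2) = z (\<tau> (Suc i)) - (l / 2) *\<^sub>R w i"
  and z_next: "z (\<tau> (Suc i)) = z (\<tau> i) + (\<tau> (Suc i) - \<tau> i) *\<^sub>R w i"
  and after_not_F: "\<tau> i + l / 2 \<notin> F"
  and before_not_F: "\<tau> (Suc i) - l / 2 \<notin> F"
proof -
  have \<tau>: "\<tau> i < \<tau> i + l / 2" "\<tau> i + l / 2 < \<tau> (Suc i)" "\<tau> i < \<tau> (Suc i) - l / 2" "\<tau> (Suc i) - l / 2 < \<tau> (Suc i)"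
    using \<tau>_gap[of i] l by linarith+
  show "z (\<tau> i + l / 2) = z (\<tau> i) + (l / 2) *\<^sub>R w i"
    using z_chord[of "\<tau> i + l / 2" i] \<tau> by simp
  show eq: "z (\<tau> (Suc i)) = z (\<tau> i) + (\<tau> (Suc i) - \<tau> i) *\<^sub>R w i"
    using z_chord[of "\<tau> (Suc i)" i] \<tau>_less[of i] by simp
  show "z (\<tau> (Suc i) - l / 2) = z (\<tau> (Suc i)) - (l / 2) *\<^sub>R w i"
    using z_chord[of "\<tau> (Suc i) - l / 2" i] \<tau> unfolding eq by (simp add: algebra_simps)
  show "\<tau> i + l / 2 \<notin> F" "\<tau> (Suc i) - l / 2 \<notin> F"
    using \<tau>_between \<tau> by blast+
qed

lemma w_out: "inner (edge_normal n (e i)) (w i) < 0"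
  using not_F[OF after_not_F, of "e i" i] height_e[of i] l
  by (simp add: z_after edge_height_add mult_less_0_iff)

lemma w_in: "0 < inner (edge_normal n (e (Suc i))) (w i)"
proof -
  have "0 < l / 2 * inner (edge_normal n (e (Suc i))) (w i)"
    using not_F[OF before_not_F, of "e (Suc i)" i] height_e[of "Suc i"]
      edge_height_add[of n "e (Suc i)" "z (\<tau> (Suc i))" "- ((l / 2) *\<^sub>R w i)"]
    by (simp add: z_before)
  then show ?thesis using l by (simp add: zero_less_mult_iff)
qed

lemma dist_across: "(dist (z (\<tau> (Suc i) - l / 2)) (z (\<tau> (Suc i) + l / 2)))\<^sup>2
    = l\<^sup>2 / 4 * (2 + 2 * inner (w i) (w (Suc i)))"
proof -
  have "z (\<tau> (Suc i) - l / 2) - z (\<tau> (Suc i) + l / 2) = - ((l / 2) *\<^sub>R (w i + w (Suc i)))"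
    unfolding z_before z_after by (simp add: algebra_simps)
  then have "(dist (z (\<tau> (Suc i) - l / 2)) (z (\<tau> (Suc i) + l / 2)))\<^sup>2 = (l / 2)\<^sup>2 * (norm (w i + w (Suc i)))\<^sup>2"
    by (simp add: dist_norm power_mult_distrib power_divide)
  also have "(norm (w i + w (Suc i)))\<^sup>2 = 2 + 2 * inner (w i) (w (Suc i))"
    using dot_norm[of "w i" "w (Suc i)"] by simp
  finally show ?thesis by (simp add: power_divide)
qed

text \<open>On one sheet the points \<open>l / 2\<close> before and after the bounce would be at
  Euclidean distance \<open>l\<close>, making the two directions equal; but one points towards the
  edge and the other away from it.\<close>

lemma sheet_alternates: "s (\<tau> (Suc i) + l / 2) \<noteq> s (\<tau> i + l / 2)"
proof
  assume eq: "s (\<tau> (Suc i) + l / 2) = s (\<tau> i + l / 2)"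
  have "s (\<tau> i + l / 2) = s (\<tau> (Suc i) - l / 2)"
  proof (rule sheet_constant)
    fix v assume "\<tau> i + l / 2 \<le> v" "v \<le> \<tau> (Suc i) - l / 2"
    then show "v \<notin> F" using l by (intro \<tau>_between[of i]) linarith+
  qed (use \<tau>_gap[of i] in simp)
  then have "dist (z (\<tau> (Suc i) - l / 2)) (z (\<tau> (Suc i) + l / 2)) = l"
    using dist_same_sheet[of "\<tau> (Suc i) - l / 2" "\<tau> (Suc i) + l / 2"] l eq by simp
  then have "l\<^sup>2 = l\<^sup>2 / 4 * (2 + 2 * inner (w i) (w (Suc i)))" using dist_across[of i] by simp
  then have "inner (w i) (w (Suc i)) = 1" using l by (simp add: field_simps)
  then have "w i = w (Suc i)" using unit_vectors_eqI[OF norm_w norm_w, of i "Suc i"] by simp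
  then show False using w_in[of i] w_out[of "Suc i"] by simp
qed

text \<open>\<open>doubled_dist_sq_le\<close> for the points \<open>l / 2\<close> before and after a
  bounce, which are at distance exactly \<open>l\<close> in the double. Every edge \<open>j\<close>
  yields a constraint.\<close>

lemma product_of_heights: "l\<^sup>2 \<le> l\<^sup>2 / 4 * (2 + 2 * inner (w i) (w (Suc i)))
    + 4 * edge_height n j (z (\<tau> (Suc i) - l / 2)) * edge_height n j (z (\<tau> (Suc i) + l / 2))"
proof -
  have "doubled_dist n (doubled_point n (s (\<tau> (Suc i) - l / 2)) (z (\<tau> (Suc i) - l / 2)))
      (doubled_point n (s (\<tau> (Suc i) + l / 2)) (z (\<tau> (Suc i) + l / 2))) = l"
    using iso[of "\<tau> (Suc i) - l / 2" "\<tau> (Suc i) + l / 2"] l by simp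
  then show ?thesis
    using doubled_dist_sq_le[OF n z_in[of "\<tau> (Suc i) - l / 2"] z_in[of "\<tau> (Suc i) + l / 2"],
        of "s (\<tau> (Suc i) - l / 2)" "s (\<tau> (Suc i) + l / 2)" j]
    by (simp only: dist_across)
qed

text \<open>For the crossed edge, \<open>product_of_heights\<close> says that the inner product of
  \<open>w i\<close> with the mirror image of \<open>w (Suc i)\<close> is at least 1, and both are
  unit vectors.\<close>

lemma reflection_law:
  "w i = w (Suc i) - (2 * inner (edge_normal n (e (Suc i))) (w (Suc i))) *\<^sub>R edge_normal n (e (Suc i))"
proof -
  define \<nu> where "\<nu> = edge_normal n (e (Suc i))"
  have \<nu>: "inner \<nu> \<nu> = 1" by (simp add: \<nu>_def)
  define a p q where "a = inner (w i) (w (Suc i))" and "p = inner \<nu> (w i)" and "q = inner \<nu> (w (Suc i))"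
  have before: "edge_height n (e (Suc i)) (z (\<tau> (Suc i) - l / 2)) = l / 2 * p"
    using edge_height_add[of n "e (Suc i)" "z (\<tau> (Suc i))" "- ((l / 2) *\<^sub>R w i)"] height_e[of "Suc i"]
    by (simp add: z_before \<nu>_def p_def)
  have after: "edge_height n (e (Suc i)) (z (\<tau> (Suc i) + l / 2)) = - (l / 2 * q)"
    using height_e[of "Suc i"] by (simp add: z_after edge_height_add \<nu>_def q_def)
  have "l\<^sup>2 * 1 \<le> l\<^sup>2 * ((1 + a) / 2 - p * q)"
    using product_of_heights[of i "e (Suc i)"] unfolding before after a_def[symmetric]
    by (simp add: power2_eq_square algebra_simps)
  then have "1 \<le> (1 + a) / 2 - p * q"
    using l by (subst (asm) mult_le_cancel_left_pos) auto
  then have *: "1 \<le> a - 2 * (p * q)" by (simp add: field_simps)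
  let ?r = "w (Suc i) - (2 * inner \<nu> (w (Suc i))) *\<^sub>R \<nu>"
  have "(norm ?r)\<^sup>2 = 1 + 2 * (- 2 * q) * q + (- 2 * q)\<^sup>2 * 1"
    using dist_add_scaleR_sq[of 0 "w (Suc i)" "- 2 * q" \<nu>] unfolding \<nu> by (simp add: q_def)
  then have "(norm ?r)\<^sup>2 = 1\<^sup>2" by (simp add: power2_eq_square)
  then have "norm ?r = 1" by (simp only: power2_eq_iff_nonneg norm_ge_zero zero_le_one)
  moreover have "1 \<le> inner (w i) ?r" using * by (simp add: inner_diff_right inner_commute[of "w i" \<nu>] a_def p_def q_def mult_ac)
  ultimately show ?thesis using unit_vectors_eqI[of "w i" ?r] by (simp add: \<nu>_def)
qed

end

section \<open>Coordinates of a bounce in the rotated frame of its edge\<close>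

lemma inner_mult_unit:
  fixes \<nu> x y :: complex
  assumes "norm \<nu> = 1"
  shows "inner (\<nu> * x) (\<nu> * y) = inner x y"
proof -
  have inner: "inner a b = Re (cnj a * b)" for a b :: complex by (simp add: inner_complex_def)
  have "cnj (\<nu> * x) * (\<nu> * y) = (\<nu> * cnj \<nu>) * (cnj x * y)" by (simp add: mult_ac)
  also have "\<nu> * cnj \<nu> = 1" using assms by (simp add: complex_norm_square[symmetric])
  finally have "cnj (\<nu> * x) * (\<nu> * y) = 1 * (cnj x * y)" .
  then show ?thesis unfolding inner by (simp only: mult_1)
qed

lemma unit_frame:
  fixes \<nu> x :: complex
  assumes "norm \<nu> = 1"
  shows "x = \<nu> * Complex (inner \<nu> x) (Im (cnj \<nu> * x))"
proof -
  have "Complex (inner \<nu> x) (Im (cnj \<nu> * x)) = cnj \<nu> * x"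
    by (simp add: complex_eq_iff inner_complex_def)
  moreover have "\<nu> * cnj \<nu> = 1" using assms by (simp add: complex_norm_square[symmetric])
  ultimately show ?thesis by (metis mult.assoc mult_1)
qed

lemma edge_normal_add: "edge_normal n (j + m) = edge_normal n j * cis (2 * pi * m / n)"
  by (simp add: edge_normal_def cis_mult add_divide_distrib algebra_simps)

context polygon_geodesic
begin

definition \<nu> :: "nat \<Rightarrow> complex" where "\<nu> i = edge_normal n (e i)"
definition b :: "nat \<Rightarrow> complex" where "b i = z (\<tau> i)"
text \<open>In the frame formed by the outward normal \<open>\<nu> i\<close> and the tangent
  \<open>\<i> * \<nu> i\<close>, \<open>\<phi> i\<close> is the signed angle of the outgoing
  direction with the inward normal, and \<open>u i\<close> below is the signed offset from the
  midpoint of the edge.\<close>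

definition \<phi> :: "nat \<Rightarrow> real" where "\<phi> i = arcsin (Im (cnj (\<nu> i) * w i))"
definition u :: "nat \<Rightarrow> real" where "u i = Im (cnj (\<nu> i) * b i)"

lemma norm_\<nu> [simp]: "norm (\<nu> i) = 1"
  by (simp add: \<nu>_def)

lemma \<phi>_bound: "\<bar>\<phi> i\<bar> < pi / 2"
  and w_out_frame: "w i = \<nu> i * Complex (- cos (\<phi> i)) (sin (\<phi> i))"
proof -
  define c where "c = - inner (\<nu> i) (w i)"
  define S where "S = Im (cnj (\<nu> i) * w i)"
  have c: "0 < c" using w_out[of i] by (simp add: c_def \<nu>_def)
  have wi: "w i = \<nu> i * Complex (- c) S" using unit_frame[OF norm_\<nu>, of "w i" i] by (simp add: c_def S_def)
  have "norm (w i) = norm (Complex (- c) S)" by (subst wi) (simp add: norm_mult)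
  then have cS: "c\<^sup>2 + S\<^sup>2 = 1" by (simp add: complex_norm)
  have "0 < c\<^sup>2" using c by simp
  then have "S\<^sup>2 < 1" using cS by linarith
  then have S: "\<bar>S\<bar> < 1" by (simp add: abs_square_less_1)
  have \<phi>: "\<phi> i = arcsin S" by (simp only: \<phi>_def S_def)
  show "\<bar>\<phi> i\<bar> < pi / 2"
    using arcsin_lt_bounded[of S] S unfolding \<phi> abs_less_iff by linarith
  have "sin (\<phi> i) = S" using S by (simp add: \<phi> abs_less_iff)
  moreover have "cos (\<phi> i) = sqrt (1 - S\<^sup>2)" using S by (simp add: \<phi> cos_arcsin abs_less_iff)
  moreover have "sqrt (1 - S\<^sup>2) = c" using cS c by (intro real_sqrt_unique) auto
  ultimately show "w i = \<nu> i * Complex (- cos (\<phi> i)) (sin (\<phi> i))" using wi by simp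
qed

lemma cos_\<phi>: "0 < cos (\<phi> i)"
  using \<phi>_bound[of i] by (intro cos_gt_zero_pi) (auto simp: abs_less_iff)

lemma inner_\<nu>_w: "inner (\<nu> i) (w i) = - cos (\<phi> i)"
  using inner_mult_unit[OF norm_\<nu>, of i 1 "Complex (- cos (\<phi> i)) (sin (\<phi> i))"] w_out_frame[of i]
  by (simp add: inner_complex_def)

text \<open>Reflection changes only the normal component, so arrival and departure share the
  tangential component \<open>sin (\<phi> (Suc i))\<close>.\<close>

lemma w_in_frame: "w i = \<nu> (Suc i) * Complex (cos (\<phi> (Suc i))) (sin (\<phi> (Suc i)))"
proof -
  have "w i = w (Suc i) + (2 * cos (\<phi> (Suc i))) *\<^sub>R \<nu> (Suc i)"
    using reflection_law[of i] inner_\<nu>_w[of "Suc i"] by (simp add: \<nu>_def)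
  also have "\<dots> = \<nu> (Suc i) * (Complex (- cos (\<phi> (Suc i))) (sin (\<phi> (Suc i))) + of_real (2 * cos (\<phi> (Suc i))))"
    by (subst w_out_frame) (simp add: scaleR_conv_of_real algebra_simps)
  also have "Complex (- cos (\<phi> (Suc i))) (sin (\<phi> (Suc i))) + of_real (2 * cos (\<phi> (Suc i)))
      = Complex (cos (\<phi> (Suc i))) (sin (\<phi> (Suc i)))"
    by (simp add: complex_eq_iff)
  finally show ?thesis .
qed

lemma b_frame: "b i = \<nu> i * Complex (apothem n) (u i)"
proof -
  have "inner (\<nu> i) (b i) = apothem n" using height_e[of i] by (simp add: \<nu>_def b_def edge_height_def)
  then show ?thesis using unit_frame[OF norm_\<nu>, of "b i" i] by (simp add: u_def)
qed

lemma b_Suc: "b (Suc i) = b i + (\<tau> (Suc i) - \<tau> i) *\<^sub>R w i"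
  by (simp add: b_def z_next)

text \<open>One direction is written in the frames at both ends of its chord. The arguments agree up
  to a multiple of \<open>2 * pi\<close>, which enters \<open>d\<close> as a multiple of
  \<open>n\<close>.\<close>

lemma ex_turn: "\<exists>d :: int. \<phi> i + \<phi> (Suc i) = pi - 2 * pi * d / n \<and> int n dvd d - (e (Suc i) - e i)"
proof -
  have n0: "real n \<noteq> 0" using n by simp
  have "w i = \<nu> i * - cis (- \<phi> i)" "w i = \<nu> (Suc i) * cis (\<phi> (Suc i))"
    using w_out_frame[of i] w_in_frame[of i] by (simp_all add: complex_eq_iff cis.ctr)
  then have "cis ((2 * e i + 1) * pi / n + (- \<phi> i + pi)) = cis ((2 * e (Suc i) + 1) * pi / n + \<phi> (Suc i))"
    by (simp add: \<nu>_def edge_normal_def minus_cis flip: cis_mult)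
  then obtain m :: int where m: "(2 * e i + 1) * pi / n + (- \<phi> i + pi) = (2 * e (Suc i) + 1) * pi / n + \<phi> (Suc i) + 2 * pi * m"
    using sin_cos_eq_iff[of "(2 * e i + 1) * pi / n + (- \<phi> i + pi)" "(2 * e (Suc i) + 1) * pi / n + \<phi> (Suc i)"]
    by (auto simp: complex_eq_iff)
  have "\<phi> i + \<phi> (Suc i) = pi + ((2 * e i + 1) * pi / n - (2 * e (Suc i) + 1) * pi / n) - 2 * pi * m"
    using m by linarith
  also have "\<dots> = pi - 2 * pi * of_int (e (Suc i) - e i + int n * m) / n"
    using n0 by (simp add: field_simps)
  finally show ?thesis by (intro exI[of _ "e (Suc i) - e i + int n * m"]) simp
qed

text \<open>The cross product of position and direction, the angular momentum about the centre, is
  constant along a chord; both sides are its values at the ends.\<close>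

lemma momentum: "apothem n * sin (\<phi> i) + u i * cos (\<phi> i)
    = apothem n * sin (\<phi> (Suc i)) - u (Suc i) * cos (\<phi> (Suc i))"
proof -
  have cross: "Im (cnj (\<mu> * x) * (\<mu> * y)) = Im (cnj x * y)" if "norm \<mu> = 1" for \<mu> x y :: complex
  proof -
    have "cnj (\<mu> * x) * (\<mu> * y) = (\<mu> * cnj \<mu>) * (cnj x * y)" by (simp add: mult_ac)
    also have "\<mu> * cnj \<mu> = 1" using that by (simp add: complex_norm_square[symmetric])
    finally have "cnj (\<mu> * x) * (\<mu> * y) = 1 * (cnj x * y)" .
    then show ?thesis by (simp only: mult_1)
  qed
  have "Im (cnj (b (Suc i)) * w i) = Im (cnj (b i) * w i)"
    unfolding b_Suc by (simp add: algebra_simps)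
  moreover have "Im (cnj (b i) * w i) = apothem n * sin (\<phi> i) + u i * cos (\<phi> i)"
    by (subst b_frame, subst w_out_frame, subst cross) auto
  moreover have "Im (cnj (b (Suc i)) * w i) = apothem n * sin (\<phi> (Suc i)) - u (Suc i) * cos (\<phi> (Suc i))"
    by (subst b_frame, subst w_in_frame, subst cross) auto
  ultimately show ?thesis by simp
qed

lemma chord_length: "\<tau> (Suc i) - \<tau> i
    = apothem n * (cos (\<phi> i) + cos (\<phi> (Suc i))) + u (Suc i) * sin (\<phi> (Suc i)) - u i * sin (\<phi> i)"
proof -
  have "inner (w i) (b (Suc i)) - inner (w i) (b i) = (\<tau> (Suc i) - \<tau> i) * inner (w i) (w i)"
    by (simp add: b_Suc inner_add_right)
  moreover have "inner (w i) (b i) = - apothem n * cos (\<phi> i) + u i * sin (\<phi> i)"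
    by (subst b_frame, subst w_out_frame, subst inner_mult_unit) (auto simp: inner_complex_def)
  moreover have "inner (w i) (b (Suc i)) = apothem n * cos (\<phi> (Suc i)) + u (Suc i) * sin (\<phi> (Suc i))"
    by (subst b_frame, subst w_in_frame, subst inner_mult_unit) (auto simp: inner_complex_def)
  ultimately show ?thesis by (simp add: dot_square_norm algebra_simps)
qed

text \<open>Reflecting in a neighbouring edge instead must not give a shorter path; for the two points at
  distance \<open>l / 2\<close> before and after the crossing this keeps the crossing away from the vertices.\<close>

lemma offset_bound: "\<bar>u (Suc i) / apothem n\<bar> \<le> (1 - l / 2 * cos (\<phi> (Suc i)) / apothem n) * tan (pi / n)"
proof -
  define r where "r = apothem n"
  define \<beta> where "\<beta> = pi / n"
  define c S where "c = cos (\<phi> (Suc i))" and "S = sin (\<phi> (Suc i))"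
  define a v where "a = l / 2 * c" and "v = u (Suc i)"
  have r: "0 < r" "r = cos \<beta>" using apothem_pos[OF n] by (simp_all add: r_def apothem_def \<beta>_def)
  have "\<beta> < pi" using n by (simp add: \<beta>_def field_simps)
  then have s\<beta>: "0 < sin \<beta>" using n by (intro sin_gt_zero) (auto simp: \<beta>_def)
  have a: "0 < a" using cos_\<phi> l by (simp add: a_def c_def)
  have cS: "c\<^sup>2 + S\<^sup>2 = 1" by (simp add: c_def S_def)
  have before: "z (\<tau> (Suc i) - l / 2) = \<nu> (Suc i) * Complex (r - a) (v - l / 2 * S)"
  proof -
    have "z (\<tau> (Suc i) - l / 2) = \<nu> (Suc i) * (Complex r v - (l / 2) *\<^sub>R Complex c S)"
      using z_before[of i] b_frame[of "Suc i"] w_in_frame[of i]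
      by (simp add: b_def r_def v_def c_def S_def right_diff_distrib)
    then show ?thesis by (simp add: a_def complex_scaleR complex_diff)
  qed
  have after: "z (\<tau> (Suc i) + l / 2) = \<nu> (Suc i) * Complex (r - a) (v + l / 2 * S)"
  proof -
    have "z (\<tau> (Suc i) + l / 2) = \<nu> (Suc i) * (Complex r v + (l / 2) *\<^sub>R Complex (- c) S)"
      using z_after[of "Suc i"] b_frame[of "Suc i"] w_out_frame[of "Suc i"]
      by (simp add: b_def r_def v_def c_def S_def distrib_left)
    then show ?thesis by (simp add: a_def complex_scaleR complex_add)
  qed
  have "inner (w i) (w (Suc i)) = S\<^sup>2 - c\<^sup>2"
    by (subst w_in_frame, subst w_out_frame, subst inner_mult_unit)
      (auto simp: inner_complex_def c_def S_def power2_eq_square)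
  then have "2 + 2 * inner (w i) (w (Suc i)) = 4 * S\<^sup>2" using cS by simp
  \<comment> \<open>Both points have height \<open>a\<close> over the crossed edge, so the product
    of their heights over any other edge is at least \<open>a\<^sup>2\<close>.\<close>
  then have prod: "a\<^sup>2 \<le> edge_height n j (z (\<tau> (Suc i) - l / 2)) * edge_height n j (z (\<tau> (Suc i) + l / 2))" for j
  proof -
    have "l\<^sup>2 \<le> l\<^sup>2 * S\<^sup>2 + 4 * (edge_height n j (z (\<tau> (Suc i) - l / 2)) * edge_height n j (z (\<tau> (Suc i) + l / 2)))"
      using product_of_heights[of i j] \<open>2 + 2 * inner (w i) (w (Suc i)) = 4 * S\<^sup>2\<close> by (simp add: mult.assoc)
    moreover have "4 * a\<^sup>2 = l\<^sup>2 - l\<^sup>2 * S\<^sup>2"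
    proof -
      have "4 * a\<^sup>2 = l\<^sup>2 * c\<^sup>2" by (simp add: a_def power_mult_distrib power_divide)
      also have "c\<^sup>2 = 1 - S\<^sup>2" using cS by simp
      finally show ?thesis by (simp add: right_diff_distrib)
    qed
    ultimately show ?thesis by linarith
  qed
  have one_side: "\<epsilon> * v * r \<le> (r - a) * sin \<beta>" if \<epsilon>: "\<epsilon> = of_int j" "j = 1 \<or> j = - 1" for \<epsilon> j
  proof -
    have height: "edge_height n (e (Suc i) + j) (\<nu> (Suc i) * Complex (r - a) y)
        = r - cos (2 * \<beta>) * (r - a) - \<epsilon> * sin (2 * \<beta>) * y" for y
    proof -
      have "edge_normal n (e (Suc i) + j) = \<nu> (Suc i) * cis (\<epsilon> * (2 * \<beta>))"
        by (simp add: edge_normal_add \<nu>_def \<epsilon>(1) \<beta>_def mult_ac)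
      moreover have "inner (cis (\<epsilon> * (2 * \<beta>))) (Complex (r - a) y) = cos (2 * \<beta>) * (r - a) + \<epsilon> * sin (2 * \<beta>) * y"
        using \<epsilon> by (auto simp: inner_complex_def)
      ultimately show ?thesis by (simp add: edge_height_def inner_mult_unit r_def)
    qed
    define m where "m = r - cos (2 * \<beta>) * (r - a) - \<epsilon> * sin (2 * \<beta>) * v"
    define q where "q = \<epsilon> * sin (2 * \<beta>) * (l / 2 * S)"
    have H: "edge_height n (e (Suc i) + j) (z (\<tau> (Suc i) - l / 2)) = m + q"
      "edge_height n (e (Suc i) + j) (z (\<tau> (Suc i) + l / 2)) = m - q"
      unfolding before after height by (simp_all add: m_def q_def algebra_simps)
    \<comment> \<open>Here \<open>m\<close> is the height of the midpoint of the two points; a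
      product of heights is at most the square of their mean.\<close>
    have "a\<^sup>2 \<le> (m + q) * (m - q)" using prod[of "e (Suc i) + j"] unfolding H .
    also have "\<dots> \<le> m\<^sup>2" by (simp add: algebra_simps power2_eq_square)
    finally have "a\<^sup>2 \<le> m\<^sup>2" .
    moreover have "0 \<le> m"
      using height_nonneg[of "e (Suc i) + j" "\<tau> (Suc i) - l / 2"] height_nonneg[of "e (Suc i) + j" "\<tau> (Suc i) + l / 2"]
      unfolding H by linarith
    ultimately have "a \<le> m" by (rule power2_le_imp_le)
    then have "\<epsilon> * v * sin (2 * \<beta>) \<le> (r - a) * (1 - cos (2 * \<beta>))" by (simp add: m_def algebra_simps)
    moreover have "1 - cos (2 * \<beta>) = 2 * sin \<beta> * sin \<beta>" by (simp add: cos_double_sin power2_eq_square)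
    moreover have "sin (2 * \<beta>) = 2 * sin \<beta> * r" by (simp add: sin_double r(2))
    ultimately have "(2 * sin \<beta>) * (\<epsilon> * v * r) \<le> (2 * sin \<beta>) * ((r - a) * sin \<beta>)"
      by (simp only: mult_ac)
    then show ?thesis using s\<beta> by simp
  qed
  have "\<bar>v * r\<bar> \<le> (r - a) * sin \<beta>" using one_side[of 1 1] one_side[of "- 1" "- 1"] by (simp add: abs_le_iff)
  then have "\<bar>v\<bar> * r \<le> (r - a) * sin \<beta>" using r by (simp add: abs_mult)
  then have "\<bar>v\<bar> * r / (r * r) \<le> (r - a) * sin \<beta> / (r * r)" using r by (intro divide_right_mono) auto
  then have "\<bar>v\<bar> / r \<le> (r - a) * sin \<beta> / (r * r)" using r(1) by simp
  also have "\<dots> = (1 - a / r) * tan \<beta>" using r(1) by (simp add: tan_def r(2)[symmetric] field_simps)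
  finally show ?thesis using r(1) by (simp add: r_def v_def a_def c_def \<beta>_def)
qed

text \<open>One period of bounces provides the data of \<open>no_closed_chord_sequence\<close>, with
  the offsets divided by the apothem.\<close>

lemma not_prime_of_small_angle:
  fixes q \<eta> :: real
  assumes p: "prime n" "k < n"
    and q: "q = (1 + cos (pi / k)) / 2" and \<eta>: "\<eta> = (1 - q\<^sup>2) / (2 * k)"
    and small: "4 * k * tan (pi / n) \<le> 1 - cos (pi / k)" "2 * tan (pi / n) \<le> sqrt (1 - q\<^sup>2)"
      "(1 - \<eta>) * (n / pi * tan (pi / n)) \<le> 1 - \<eta> / 2"
      "48 * k * (n / pi * (tan (pi / n))\<^sup>2) < \<eta> * (1 - q\<^sup>2)"
  shows False
proof -
  obtain N where N: "0 < N" "N \<le> k" "\<And>i. \<tau> (i + N) = \<tau> i + k * l" using ex_period by blast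
  have b_per: "b (i + N) = b i" for i by (simp add: b_def N z_periodic)
  have e_per: "e (i + N) = e i" for i by (simp add: e_def N z_periodic)
  have w_per: "w (i + N) = w i" for i
  proof -
    have "z (\<tau> i + k * l + l) = z (\<tau> i + l)" using z_periodic[of "\<tau> i + l"] by (simp add: add_ac)
    then show ?thesis by (simp only: w_def N(3) z_periodic)
  qed
  have \<nu>_per: "\<nu> (i + N) = \<nu> i" for i by (simp add: \<nu>_def e_per)
  have \<phi>_per: "\<phi> (i + N) = \<phi> i" and u_per: "u (i + N) = u i" for i
    by (simp_all add: \<phi>_def u_def \<nu>_per w_per b_per)
  have sheet: "s (\<tau> i + l / 2) \<longleftrightarrow> (s (\<tau> 0 + l / 2) \<longleftrightarrow> even i)" for i
    by (induction i) (use sheet_alternates in auto)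
  have "s (\<tau> N + l / 2) = s (\<tau> 0 + l / 2)"
    using s_periodic[OF after_not_F[of 0]] N(3)[of 0] by (simp add: add_ac)
  then have evenN: "even N" using sheet[of N] by blast
  obtain d :: "nat \<Rightarrow> int" where
    d: "\<And>i. \<phi> i + \<phi> (Suc i) = pi - 2 * pi * d i / n" "\<And>i. int n dvd d i - (e (Suc i) - e i)"
    using ex_turn by metis
  define r where "r = apothem n"
  define T where "T i = u i / r" for i
  have r: "0 < r" using apothem_pos[OF n] by (simp add: r_def)
  have uT: "u i = r * T i" for i using r by (simp add: T_def)
  have T_per: "T (i + N) = T i" for i by (simp add: T_def u_per)
  have T_bound: "\<bar>T i\<bar> \<le> (1 - l / 2 * cos (\<phi> i) / r) * tan (pi / n)" for i
  proof -
    \<comment> \<open>\<open>offset_bound\<close> speaks of successor indices only; going once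
      around the period covers index 0.\<close>
    obtain M where M: "i + N = Suc M" using N(1) by (cases N) auto
    have "\<bar>T (i + N)\<bar> \<le> (1 - l / 2 * cos (\<phi> (i + N)) / r) * tan (pi / n)"
      using offset_bound[of M] by (simp only: M T_def r_def)
    then show ?thesis by (simp only: \<phi>_per T_per)
  qed
  \<comment> \<open>\<open>d\<close> agrees with the differences of edge indices only modulo
    \<open>n\<close>, and those telescope to 0 over a period.\<close>
  have "int n dvd (\<Sum>i<N. d i - (e (Suc i) - e i))" by (intro dvd_sum d(2))
  moreover have "(\<Sum>i<N. e (Suc i) - e i) = 0" using e_per[of 0] by (simp add: sum_lessThan_telescope)
  ultimately have closing: "int n dvd (\<Sum>i<N. d i)" by (simp add: sum_subtractf)
  have mom: "sin (\<phi> i) + T i * cos (\<phi> i) = sin (\<phi> (Suc i)) - T (Suc i) * cos (\<phi> (Suc i))" for i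
  proof -
    have "r * (sin (\<phi> i) + T i * cos (\<phi> i)) = r * (sin (\<phi> (Suc i)) - T (Suc i) * cos (\<phi> (Suc i)))"
      using momentum[of i] unfolding uT r_def[symmetric] by (simp add: algebra_simps)
    then show ?thesis using r by simp
  qed
  have chord: "r * (cos (\<phi> 0) + cos (\<phi> 1) + T 1 * sin (\<phi> 1) - T 0 * sin (\<phi> 0)) \<le> k * l"
  proof -
    have "\<tau> (Suc 0) \<le> \<tau> N" by (rule lift_Suc_mono_le[of \<tau>, OF less_imp_le[OF \<tau>_less]]) (use N(1) in simp)
    then have "\<tau> (Suc 0) - \<tau> 0 \<le> k * l" using N(3)[of 0] by simp
    then show ?thesis using chord_length[of 0] unfolding uT r_def[symmetric] by (simp add: algebra_simps)
  qed
  show False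
    by (rule no_closed_chord_sequence[OF refl r_def[unfolded apothem_def] k p q \<eta> small evenN N(1,2)
        \<phi>_per T_per \<phi>_bound d(1) mom T_bound l chord closing])
qed

end

section \<open>Geodesics and local isometries\<close>

lemma mdist_le_curve_length:
  assumes "a \<le> b"
  shows "ennreal (mdist X (\<gamma> a) (\<gamma> b)) \<le> curve_length X \<gamma> a b"
proof -
  define t where "t i = (if i = 0 then a else b)" for i :: nat
  have "(\<Sum>i<1. ennreal (mdist X (\<gamma> (t i)) (\<gamma> (t (Suc i))))) \<le> curve_length X \<gamma> a b"
    unfolding curve_length_def using assms
    by (intro Sup_upper CollectI exI[of _ 1] exI[of _ t]) (simp add: t_def)
  then show ?thesis by (simp add: t_def)
qed

text \<open>Distance is at most arc length, with equality over each parameter interval of length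
  \<open>2 * pi / k\<close>; the triangle inequality forces equality on all shorter ones.\<close>

lemma one_over_geodesic_mdist:
  assumes \<gamma>: "one_over_geodesic X k \<gamma>" and k: "0 < k"
  obtains c where "0 < c" "\<And>t. \<gamma> t \<in> mspace X" "\<And>t. \<gamma> (t + 2 * pi) = \<gamma> t"
    "\<And>s t. \<bar>s - t\<bar> \<le> 2 * pi / k \<Longrightarrow> mdist X (\<gamma> s) (\<gamma> t) = c * \<bar>s - t\<bar>"
proof -
  have geo: "closed_geodesic X \<gamma>" using \<gamma> by (simp add: one_over_geodesic_def)
  then obtain c where c: "0 \<le> c" "\<And>a b. a \<le> b \<Longrightarrow> curve_length X \<gamma> a b = ennreal (c * (b - a))"
    by (auto simp: closed_geodesic_def constant_speed_def)
  have "continuous_map euclidean (mtopology_of X) \<gamma>" and per: "\<gamma> (t + 2 * pi) = \<gamma> t" for t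
    using geo by (auto simp: closed_geodesic_def closed_curve_def)
  then have sp: "\<gamma> t \<in> mspace X" for t
    using continuous_map_image_subset_topspace by fastforce
  have le: "mdist X (\<gamma> s) (\<gamma> t) \<le> c * (t - s)" if "s \<le> t" for s t
    using mdist_le_curve_length[OF that, of X \<gamma>] c that by (simp add: ennreal_le_iff)
  have "c \<noteq> 0"
  proof
    assume "c = 0"
    then have "\<gamma> s = \<gamma> t" if "s \<le> t" for s t
      using le[OF that] sp mdist_nonneg[of X "\<gamma> s" "\<gamma> t"] by simp
    then have "\<gamma> s = \<gamma> t" for s t by (metis linorder_le_cases)
    then show False using geo by (auto simp: closed_geodesic_def)
  qed
  then have "0 < c" using c by simp
  define h where "h = 2 * pi / k"
  have h: "0 < h" using k by (simp add: h_def)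
  have full: "mdist X (\<gamma> t) (\<gamma> (t + h)) = c * h" for t
  proof -
    have "ennreal (mdist X (\<gamma> t) (\<gamma> (t + h))) = ennreal (c * (2 * pi)) / of_nat k"
      using \<gamma> c(2)[of 0 "2 * pi"] by (simp add: one_over_geodesic_def h_def)
    also have "\<dots> = ennreal (c * (2 * pi) / k)"
      using k c(1) by (simp add: divide_ennreal ennreal_of_nat_eq_real_of_nat)
    finally show ?thesis using c(1) k by (simp add: h_def)
  qed
  have "mdist X (\<gamma> s) (\<gamma> t) = c * (t - s)" if "s \<le> t" "t \<le> s + h" for s t
  proof -
    have "c * h \<le> mdist X (\<gamma> s) (\<gamma> t) + mdist X (\<gamma> t) (\<gamma> (s + h))"
      using mdist_triangle[of "\<gamma> s" X "\<gamma> t" "\<gamma> (s + h)"] sp full[of s] by simp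
    then show ?thesis using le[of s t] le[of t "s + h"] that by (simp add: algebra_simps)
  qed
  then have iso: "mdist X (\<gamma> s) (\<gamma> t) = c * \<bar>s - t\<bar>" if "\<bar>s - t\<bar> \<le> h" for s t
    using that mdist_commute[of X "\<gamma> s" "\<gamma> t"] by (cases "s \<le> t") auto
  show ?thesis using that[OF \<open>0 < c\<close> sp per] iso by (simp add: h_def)
qed

text \<open>Refining partitions shows that arc length is \<open>c\<close> times parameter length, so
  short pieces are as long as the distance of their ends and hence minimizing. Any
  \<open>k \<ge> 2\<close> with \<open>2 * pi / k \<le> \<epsilon>\<close> serves.\<close>

lemma one_over_geodesic_of_local_isometry:
  assumes c: "0 < c" and \<epsilon>: "0 < \<epsilon>"
    and sp: "\<And>t. \<gamma> t \<in> mspace X" and per: "\<And>t. \<gamma> (t + 2 * pi) = \<gamma> t"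
    and iso: "\<And>s t. \<bar>s - t\<bar> \<le> \<epsilon> \<Longrightarrow> mdist X (\<gamma> s) (\<gamma> t) = c * \<bar>s - t\<bar>"
  shows "\<exists>k\<ge>2. one_over_geodesic X k \<gamma>"
proof -
  have lip: "mdist X (\<gamma> s) (\<gamma> t) \<le> c * (t - s)" if "s \<le> t" for s t
  proof -
    have "\<forall>s t. s \<le> t \<longrightarrow> t \<le> s + real n * \<epsilon> \<longrightarrow> mdist X (\<gamma> s) (\<gamma> t) \<le> c * (t - s)" for n
    proof (induction n)
      case 0
      then show ?case using iso \<epsilon> by auto
    next
      case (Suc n)
      show ?case
      proof (intro allI impI)
        fix s t assume st: "s \<le> t" "t \<le> s + real (Suc n) * \<epsilon>"
        show "mdist X (\<gamma> s) (\<gamma> t) \<le> c * (t - s)"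
        proof (cases "t - \<epsilon> \<le> s")
          case True
          then show ?thesis using iso[of s t] st by simp
        next
          case False
          then have "mdist X (\<gamma> s) (\<gamma> (t - \<epsilon>)) \<le> c * (t - \<epsilon> - s)"
            using Suc[rule_format, of s "t - \<epsilon>"] st by (simp add: algebra_simps)
          then show ?thesis
            using mdist_triangle[OF sp[of s] sp[of "t - \<epsilon>"] sp[of t]] iso[of "t - \<epsilon>" t] \<epsilon>
            by (simp add: algebra_simps)
        qed
      qed
    qed
    moreover obtain n :: nat where "t - s < real n * \<epsilon>" using reals_Archimedean3[OF \<epsilon>] by blast
    ultimately show ?thesis using that by (metis add.commute diff_le_eq less_imp_le)
  qed
  have len: "curve_length X \<gamma> a b = ennreal (c * (b - a))" if ab: "a \<le> b" for a b
  proof (rule antisym)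
    show "curve_length X \<gamma> a b \<le> ennreal (c * (b - a))"
      unfolding curve_length_def
    proof (rule Sup_least)
      fix x assume "x \<in> {(\<Sum>i<n. ennreal (mdist X (\<gamma> (t i)) (\<gamma> (t (Suc i))))) |n t.
            t 0 = a \<and> t n = b \<and> (\<forall>i<n. t i \<le> t (Suc i))}"
      then obtain n t where x: "x = (\<Sum>i<n. ennreal (mdist X (\<gamma> (t i)) (\<gamma> (t (Suc i)))))"
        and t: "t 0 = a" "t n = b" "\<forall>i<n. t i \<le> t (Suc i)" by blast
      have "x = ennreal (\<Sum>i<n. mdist X (\<gamma> (t i)) (\<gamma> (t (Suc i))))"
        by (simp add: x sum_ennreal)
      also have "\<dots> \<le> ennreal (\<Sum>i<n. c * (t (Suc i) - t i))"
        using lip t(3) by (intro ennreal_leI sum_mono) auto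
      also have "(\<Sum>i<n. c * (t (Suc i) - t i)) = c * (b - a)"
        by (simp add: sum_distrib_left[symmetric] sum_lessThan_telescope t)
      finally show "x \<le> ennreal (c * (b - a))" .
    qed
    obtain n :: nat where n: "b - a < real n * \<epsilon>" using reals_Archimedean3[OF \<epsilon>] by blast
    then have n0: "0 < n" using ab by (cases n) auto
    define t where "t i = a + real i * ((b - a) / n)" for i
    have "real (Suc i) * x = real i * x + x" for i and x :: real by (simp add: distrib_right)
    from this[of _ "(b - a) / n"] have step: "t (Suc i) - t i = (b - a) / n" for i
      unfolding t_def by simp
    have "(b - a) / n \<le> \<epsilon>" "0 \<le> (b - a) / n" using n n0 ab by (simp_all add: field_simps)
    then have d: "mdist X (\<gamma> (t i)) (\<gamma> (t (Suc i))) = c * ((b - a) / n)" for i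
      using iso[of "t i" "t (Suc i)"] step[of i] by (simp add: abs_minus_commute)
    have "(\<Sum>i<n. ennreal (mdist X (\<gamma> (t i)) (\<gamma> (t (Suc i))))) = ennreal (\<Sum>i<n. c * ((b - a) / n))"
      unfolding d using c ab by (intro sum_ennreal) auto
    also have "(\<Sum>i<n. c * ((b - a) / n)) = c * (b - a)" using n0 by simp
    finally have sum: "(\<Sum>i<n. ennreal (mdist X (\<gamma> (t i)) (\<gamma> (t (Suc i))))) = ennreal (c * (b - a))" .
    have "(\<Sum>i<n. ennreal (mdist X (\<gamma> (t i)) (\<gamma> (t (Suc i))))) \<le> curve_length X \<gamma> a b"
      unfolding curve_length_def
    proof (intro Sup_upper CollectI exI[of _ n] exI[of _ t] conjI refl allI impI)
      show "t 0 = a" "t n = b" using n0 by (simp_all add: t_def)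
      show "t i \<le> t (Suc i)" for i using step[of i] \<open>0 \<le> (b - a) / n\<close> by linarith
    qed
    then show "ennreal (c * (b - a)) \<le> curve_length X \<gamma> a b" unfolding sum .
  qed
  have "Lipschitz_continuous_map euclidean_metric X \<gamma>"
    unfolding Lipschitz_continuous_map_def
  proof (intro conjI exI ballI)
    show "\<gamma> \<in> mspace euclidean_metric \<rightarrow> mspace X" using sp by auto
    show "mdist X (\<gamma> s) (\<gamma> t) \<le> c * mdist euclidean_metric s t" for s t
      using lip[of s t] lip[of t s] mdist_commute[of X "\<gamma> s" "\<gamma> t"]
      by (cases "s \<le> t") (simp_all add: dist_real_def)
  qed
  then have cont: "continuous_map euclidean (mtopology_of X) \<gamma>"
    using Lipschitz_continuous_imp_continuous_map by (metis mtopology_of_euclidean)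
  have "locally_length_minimizing X \<gamma>"
    unfolding locally_length_minimizing_def
  proof (intro allI exI[of _ "\<epsilon> / 2"] conjI impI)
    fix t a b assume ab: "t - \<epsilon> / 2 \<le> a \<and> a \<le> b \<and> b \<le> t + \<epsilon> / 2"
    show "length_minimizing_on X \<gamma> a b"
      unfolding length_minimizing_on_def
    proof (intro allI impI)
      fix \<sigma> assume \<sigma>: "continuous_map (top_of_set {a..b}) (mtopology_of X) \<sigma> \<and> \<sigma> a = \<gamma> a \<and> \<sigma> b = \<gamma> b"
      have "mdist X (\<gamma> a) (\<gamma> b) = c * (b - a)" using iso[of a b] ab by simp
      then show "curve_length X \<gamma> a b \<le> curve_length X \<sigma> a b"
        using mdist_le_curve_length[of a b X \<sigma>] ab \<sigma> len[of a b] by simp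
    qed
  qed (use \<epsilon> in simp)
  moreover have "\<gamma> 0 \<noteq> \<gamma> \<epsilon>"
  proof
    assume "\<gamma> 0 = \<gamma> \<epsilon>"
    then have "mdist X (\<gamma> 0) (\<gamma> \<epsilon>) = 0" using sp by simp
    then show False using iso[of 0 \<epsilon>] c \<epsilon> by simp
  qed
  moreover have "constant_speed X \<gamma>" unfolding constant_speed_def using c len by (intro exI[of _ c]) simp
  ultimately have geo: "closed_geodesic X \<gamma>"
    using cont per by (auto simp: closed_geodesic_def closed_curve_def)
  obtain k0 :: nat where k0: "2 * pi < real k0 * \<epsilon>" using reals_Archimedean3[OF \<epsilon>] by blast
  define k where "k = max 2 k0"
  have "real k0 * \<epsilon> \<le> real k * \<epsilon>" using \<epsilon> by (intro mult_right_mono) (auto simp: k_def)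
  then have k: "2 \<le> k" "2 * pi / k \<le> \<epsilon>" using k0 by (auto simp: k_def field_simps)
  have "one_over_geodesic X k \<gamma>"
    unfolding one_over_geodesic_def
  proof (intro conjI allI geo)
    fix t
    have "mdist X (\<gamma> t) (\<gamma> (t + 2 * pi / k)) = c * (2 * pi) / k"
      using iso[of t "t + 2 * pi / k"] k by simp
    moreover have "curve_length X \<gamma> 0 (2 * pi) / of_nat k = ennreal (c * (2 * pi) / k)"
      using len[of 0 "2 * pi"] k c by (simp add: divide_ennreal ennreal_of_nat_eq_real_of_nat)
    ultimately show "ennreal (mdist X (\<gamma> t) (\<gamma> (t + 2 * pi / k))) = curve_length X \<gamma> 0 (2 * pi) / of_nat k"
      by simp
  qed
  then show ?thesis using k by blast
qed

section \<open>A closed geodesic on the double of an odd polygon\<close>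

text \<open>With \<open>\<alpha>\<close> half the angle between the two normals and
  \<open>\<beta> = pi / n\<close>, the height factors as \<open>2 * sin \<alpha> * (cos \<beta> *
  sin \<alpha> - x * cos \<alpha>)\<close>. Since \<open>\<alpha>\<close> lies in
  \<open>[\<beta>, pi - \<beta>]\<close> and half an edge is \<open>sin \<beta>\<close>, both
  factors are positive.\<close>

lemma edge_height_pos_off_edge:
  assumes n: "3 \<le> n" and x: "\<bar>x\<bar> < sin (pi / n)" and j: "j mod int n \<noteq> i mod int n"
  shows "0 < edge_height n j (edge_normal n i * Complex (apothem n) x)"
proof -
  define \<beta> where "\<beta> = pi / n"
  define m where "m = (j - i) mod int n"
  define \<alpha> where "\<alpha> = m * \<beta>"
  have "m \<noteq> 0" using j by (auto simp: m_def mod_eq_dvd_iff dvd_eq_mod_eq_0)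
  then have m: "1 \<le> m" "m \<le> int n - 1" using n pos_mod_sign[of "int n" "j - i"] pos_mod_bound[of "int n" "j - i"]
    unfolding m_def by linarith+
  have \<beta>: "0 < \<beta>" "real n * \<beta> = pi" using n by (auto simp: \<beta>_def)
  have "real_of_int 1 \<le> real_of_int m" "real_of_int m \<le> real_of_int (int n - 1)" using m of_int_le_iff by blast+
  then have "1 * \<beta> \<le> m * \<beta>" "m * \<beta> \<le> (real n - 1) * \<beta>"
    using \<beta>(1) by (intro mult_right_mono; simp)+
  then have \<alpha>: "\<beta> \<le> \<alpha>" "\<alpha> \<le> pi - \<beta>" using \<beta> by (auto simp: \<alpha>_def algebra_simps)
  have r: "apothem n = cos \<beta>" "0 < cos \<beta>" using apothem_pos[OF n] by (auto simp: apothem_def \<beta>_def)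
  have "3 * \<beta> \<le> real n * \<beta>" using n \<beta>(1) by (intro mult_right_mono) auto
  then have \<beta>2: "\<beta> \<le> pi / 2" using \<beta> by simp
  have cos: "\<bar>cos \<alpha>\<bar> \<le> cos \<beta>"
  proof -
    have "cos \<alpha> \<le> cos \<beta>" using \<alpha> \<beta> by (intro cos_monotone_0_pi_le) auto
    moreover have "cos (pi - \<beta>) \<le> cos \<alpha>" using \<alpha> \<beta> by (intro cos_monotone_0_pi_le) auto
    ultimately show ?thesis by (simp add: cos_diff abs_le_iff)
  qed
  have "(cos \<alpha>)\<^sup>2 \<le> (cos \<beta>)\<^sup>2" using cos r by (simp add: abs_le_square_iff[symmetric])
  then have "(sin \<beta>)\<^sup>2 \<le> (sin \<alpha>)\<^sup>2" by (simp add: sin_squared_eq)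
  moreover have s\<alpha>: "0 < sin \<alpha>" using \<alpha> \<beta> by (intro sin_gt_zero) auto
  ultimately have sin: "sin \<beta> \<le> sin \<alpha>" using power2_le_imp_le by (metis less_imp_le)
  have "edge_normal n j = edge_normal n ((i + m) mod int n)"
    using n by (simp add: m_def mod_add_right_eq edge_normal_mod)
  also have "\<dots> = edge_normal n i * cis (2 * \<alpha>)"
    using n by (simp add: edge_normal_mod edge_normal_add \<alpha>_def \<beta>_def mult_ac)
  finally have \<nu>: "edge_normal n j = edge_normal n i * cis (2 * \<alpha>)" .
  have double: "cos (2 * \<alpha>) = 1 - 2 * sin \<alpha> * sin \<alpha>" "sin (2 * \<alpha>) = 2 * sin \<alpha> * cos \<alpha>"
    by (simp_all add: cos_double_sin sin_double power2_eq_square)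
  have "edge_height n j (edge_normal n i * Complex (apothem n) x)
      = cos \<beta> - (cos (2 * \<alpha>) * cos \<beta> + sin (2 * \<alpha>) * x)"
    unfolding edge_height_def \<nu> inner_mult_unit[OF norm_edge_normal] r by (simp add: inner_complex_def)
  also have "\<dots> = 2 * sin \<alpha> * (cos \<beta> * sin \<alpha> - x * cos \<alpha>)"
    unfolding double by (simp add: algebra_simps)
  also have "\<dots> > 0"
  proof -
    have "x * cos \<alpha> \<le> \<bar>x\<bar> * cos \<beta>"
      using mult_mono[of "\<bar>x\<bar>" "\<bar>x\<bar>" "\<bar>cos \<alpha>\<bar>" "cos \<beta>"] cos abs_ge_self[of "x * cos \<alpha>"] by (simp add: abs_mult)
    also have "\<dots> < sin \<beta> * cos \<beta>" using x r by (simp add: \<beta>_def)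
    also have "\<dots> \<le> cos \<beta> * sin \<alpha>" using sin r by simp
    finally show ?thesis using s\<alpha> by simp
  qed
  finally show ?thesis .
qed

lemma edge_point_isolated:
  assumes n: "3 \<le> n" and x: "\<bar>x\<bar> < sin (pi / n)" and b: "b = edge_normal n i * Complex (apothem n) x"
  shows "edge_height n i b = 0" "b \<in> regular_polygon n"
    "\<exists>\<kappa>>0. \<forall>j. j mod int n \<noteq> i mod int n \<longrightarrow> \<kappa> \<le> edge_height n j b"
proof -
  have "edge_height n i b = apothem n - inner (edge_normal n i * 1) (edge_normal n i * Complex (apothem n) x)"
    by (simp add: b edge_height_def)
  then show h0: "edge_height n i b = 0" by (simp only: inner_mult_unit norm_edge_normal) (simp add: inner_complex_def)
  have pos: "0 < edge_height n j b" if "j mod int n \<noteq> i mod int n" for j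
    unfolding b by (rule edge_height_pos_off_edge[OF n x that])
  show "b \<in> regular_polygon n"
  proof (rule in_regular_polygonI[OF n])
    fix j
    show "0 \<le> edge_height n j b"
    proof (cases "j mod int n = i mod int n")
      case True
      then have "edge_height n j b = edge_height n i b"
        using n edge_height_mod[of n j b] edge_height_mod[of n i b] by simp
      then show ?thesis using h0 by simp
    qed (use pos[of j] in simp)
  qed
  define J where "J = {0..<int n} - {i mod int n}"
  define \<kappa> where "\<kappa> = Min (insert 1 ((\<lambda>j. edge_height n j b) ` J))"
  have fin: "finite (insert 1 ((\<lambda>j. edge_height n j b) ` J))" by (simp add: J_def)
  have "0 < \<kappa>" unfolding \<kappa>_def using fin pos by (subst Min_gr_iff) (auto simp: J_def)
  moreover have "\<kappa> \<le> edge_height n j b" if "j mod int n \<noteq> i mod int n" for j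
  proof -
    have "j mod int n \<in> J" using that n by (simp add: J_def)
    then have "\<kappa> \<le> edge_height n (j mod int n) b" unfolding \<kappa>_def using fin by (intro Min_le) auto
    then show ?thesis using n by (simp add: edge_height_mod)
  qed
  ultimately show "\<exists>\<kappa>>0. \<forall>j. j mod int n \<noteq> i mod int n \<longrightarrow> \<kappa> \<le> edge_height n j b" by blast
qed

text \<open>The path through \<open>b\<close> gives the upper bound. For the lower bound, unfold:
  the identity on sheet \<open>s\<close> and the reflection in the edge on the other sheet agree on
  the boundary near \<open>b\<close>, because other edges are at least \<open>\<kappa>\<close> away,
  and the images of the two points are the ends of a straight segment.\<close>

lemma doubled_dist_across_edge:
  assumes n: "3 \<le> n" and b: "b \<in> regular_polygon n" "edge_height n i b = 0"
    and \<kappa>: "\<And>j. j mod int n \<noteq> i mod int n \<Longrightarrow> \<kappa> \<le> edge_height n j b"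
    and v: "v = v' - (2 * inner (edge_normal n i) v') *\<^sub>R edge_normal n i" "norm v' = norm v"
    and \<alpha>: "0 \<le> \<alpha>" "0 \<le> \<beta>" "2 * (\<alpha> + \<beta>) * norm v < \<kappa>"
    and x: "b - \<alpha> *\<^sub>R v \<in> regular_polygon n" "b + \<beta> *\<^sub>R v' \<in> regular_polygon n" and s: "s \<noteq> s'"
  shows "doubled_dist n (doubled_point n s (b - \<alpha> *\<^sub>R v)) (doubled_point n s' (b + \<beta> *\<^sub>R v'))
    = (\<alpha> + \<beta>) * norm v"
proof -
  define \<nu> where "\<nu> = edge_normal n i"
  define R where "R z = z + (2 * edge_height n i z) *\<^sub>R \<nu>" for z
  let ?d = "doubled_dist n (doubled_point n s (b - \<alpha> *\<^sub>R v)) (doubled_point n s' (b + \<beta> *\<^sub>R v'))"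
  have "b \<in> frontier (regular_polygon n)" using frontier_regular_polygon[OF n b(1)] b(2) by blast
  from doubled_dist_via_frontier_le[OF x this, of s s']
  have le: "?d \<le> (\<alpha> + \<beta>) * norm v" using \<alpha> v(2) by (simp add: dist_norm distrib_right)
  have R_iso: "dist (R z) (R z') = dist z z'" for z z'
  proof -
    have "R z - R z' = (z - z') - (2 * inner \<nu> (z - z')) *\<^sub>R \<nu>"
      by (simp add: R_def edge_height_def \<nu>_def inner_diff_right algebra_simps)
    then have "(dist (R z) (R z'))\<^sup>2 = (norm ((z - z') + (- (2 * inner \<nu> (z - z'))) *\<^sub>R \<nu>))\<^sup>2"
      by (simp add: dist_norm)
    also have "\<dots> = (norm (z - z'))\<^sup>2"
      using dist_add_scaleR_sq[of 0 "z - z'" "- (2 * inner \<nu> (z - z'))" \<nu>] by (simp add: \<nu>_def power2_eq_square)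
    finally show ?thesis by (simp add: dist_norm power2_eq_iff_nonneg)
  qed
  have R_fix: "R u = u" if u: "u \<in> frontier (regular_polygon n)" "dist b u < \<kappa>" for u
  proof -
    obtain j where j: "edge_height n j u = 0"
      using frontier_regular_polygon[OF n frontier_polygon_subset[OF u(1)]] u(1) by blast
    have "edge_height n j b < \<kappa>" using edge_height_lipschitz[of n j b u] j u(2) by simp
    then have "j mod int n = i mod int n" using \<kappa>[of j] by force
    then have "edge_height n i u = 0"
      using n j edge_height_mod[of n j u] edge_height_mod[of n i u] by simp
    then show ?thesis by (simp add: R_def)
  qed
  define f where "f p = (if fst p = s then snd p else R (snd p))" for p :: "bool \<times> complex"
  have "dist (f (s, b - \<alpha> *\<^sub>R v)) (f (s', b + \<beta> *\<^sub>R v')) \<le> ?d"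
  proof (rule local_lipschitz_le_doubled_dist[OF x, where c = b and \<kappa> = \<kappa>])
    show "dist (f (t, z)) (f (t, z')) \<le> dist z z'" for t z z' by (simp add: f_def R_iso)
    show "f (t, u) = f (t', u)" if "u \<in> frontier (regular_polygon n)" "dist b u < \<kappa>" for t t' u
      using R_fix[OF that] by (simp add: f_def)
    have "dist b (b - \<alpha> *\<^sub>R v) \<le> (\<alpha> + \<beta>) * norm v" using \<alpha> by (simp add: dist_norm mult_right_mono)
    then show "dist b (b - \<alpha> *\<^sub>R v) + ?d < \<kappa>" using le \<alpha>(3) by linarith
  qed
  moreover have "R (b + \<beta> *\<^sub>R v') = b + \<beta> *\<^sub>R v"
    unfolding R_def v(1) by (simp add: edge_height_add b(2) \<nu>_def algebra_simps)
  then have "f (s, b - \<alpha> *\<^sub>R v) - f (s', b + \<beta> *\<^sub>R v') = - ((\<alpha> + \<beta>) *\<^sub>R v)"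
    using s by (simp add: f_def algebra_simps)
  ultimately have "(\<alpha> + \<beta>) * norm v \<le> ?d" using \<alpha> by (simp add: dist_norm)
  then show ?thesis using le by simp
qed

text \<open>The trajectory starts at the midpoint of the edge with normal \<open>-1\<close>, hits the edge with normal
  \<open>cis (\<pi> / n)\<close> perpendicularly, returns to the midpoint and then traverses the mirror image of this
  path in the real axis.  The integer \<open>m\<close> counts the bounces.\<close>

definition bounce_dir :: "nat \<Rightarrow> int \<Rightarrow> complex" where
  "bounce_dir n m = (if m mod 4 < 2 then edge_normal n 0 else edge_normal n (- 1))"

text \<open>The length \<open>apothem n + (apothem n)\<^sup>2\<close> is the distance from the
  midpoint \<open>- apothem n\<close> to the edge with normal \<open>bounce_dir n m\<close>,
  measured along that normal: its inner product with the midpoint is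
  \<open>- (apothem n)\<^sup>2\<close>.\<close>

definition bounce_point :: "nat \<Rightarrow> int \<Rightarrow> complex" where
  "bounce_point n m = (if even m then 0 else (apothem n + (apothem n)\<^sup>2) *\<^sub>R bounce_dir n m) - apothem n"

definition bounce_curve :: "nat \<Rightarrow> real \<Rightarrow> (bool \<times> complex) set" where
  "bounce_curve n x = doubled_point n (even \<lfloor>x\<rfloor>)
    (bounce_point n \<lfloor>x\<rfloor> + frac x *\<^sub>R (bounce_point n (\<lfloor>x\<rfloor> + 1) - bounce_point n \<lfloor>x\<rfloor>))"

text \<open>At even \<open>m\<close> the curve is at the midpoint of the edge with normal
  \<open>-1\<close>, which exists as \<open>n\<close> is odd, and the neighbouring points are mirror
  images in the real axis. At odd \<open>m\<close> it hits an edge perpendicularly, with offset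
  below half an edge because the apothem is below 1.\<close>

lemma bounce_point_on_edge:
  assumes n: "3 \<le> n" "odd n"
  obtains i x where "\<bar>x\<bar> < sin (pi / n)" "bounce_point n m = edge_normal n i * Complex (apothem n) x"
    "bounce_point n m - bounce_point n (m - 1) = (bounce_point n (m + 1) - bounce_point n m)
      - (2 * inner (edge_normal n i) (bounce_point n (m + 1) - bounce_point n m)) *\<^sub>R edge_normal n i"
proof -
  define r where "r = apothem n"
  define D where "D = r + r\<^sup>2"
  define \<beta> where "\<beta> = pi / n"
  have r: "0 < r" "r = cos \<beta>" using apothem_pos[OF n(1)] by (simp_all add: r_def apothem_def \<beta>_def)
  have sin\<beta>: "0 < sin \<beta>" unfolding \<beta>_def using n by (intro sin_gt_zero) (auto simp: field_simps)
  have "r < 1"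
    unfolding r \<beta>_def using cos_monotone_0_pi[of 0 "pi / n"] n by (simp add: field_simps)
  have n0: "edge_normal n 0 = cis \<beta>" and n1: "edge_normal n (- 1) = cis (- \<beta>)"
    by (simp_all add: edge_normal_def \<beta>_def)
  obtain h where h: "n = 2 * h + 1" using n(2) by (elim oddE)
  have nh: "edge_normal n (int h) = - 1"
  proof -
    have "(2 * real_of_int (int h) + 1) * pi / n = pi" using n h by (simp add: field_simps)
    then show ?thesis unfolding edge_normal_def by (simp add: complex_eq_iff)
  qed
  have dir: "bounce_dir n j = cis \<beta> \<or> bounce_dir n j = cis (- \<beta>)" for j
    by (simp add: bounce_dir_def n0 n1)
  show ?thesis
  proof (cases "even m")
    case True
    define d where "d = bounce_dir n (m + 1)"
    have "(m + 1) mod 4 < 2 \<longleftrightarrow> \<not> (m - 1) mod 4 < 2" using True by presburger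
    then have cnj: "bounce_dir n (m - 1) = cnj d"
      by (simp add: d_def bounce_dir_def n0 n1 cis_cnj)
    have pts: "bounce_point n m = - of_real r" "bounce_point n (m + 1) = D *\<^sub>R d - of_real r"
      "bounce_point n (m - 1) = D *\<^sub>R cnj d - of_real r"
      using True cnj by (simp_all add: bounce_point_def d_def D_def r_def)
    show ?thesis
    proof (rule that[of 0 "int h"])
      show "\<bar>0\<bar> < sin (pi / n)" using sin\<beta> by (simp add: \<beta>_def)
      show "bounce_point n m = edge_normal n (int h) * Complex (apothem n) 0"
        unfolding pts nh by (simp add: complex_eq_iff r_def)
      show "bounce_point n m - bounce_point n (m - 1) = (bounce_point n (m + 1) - bounce_point n m)
          - (2 * inner (edge_normal n (int h)) (bounce_point n (m + 1) - bounce_point n m)) *\<^sub>R edge_normal n (int h)"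
        unfolding pts nh by (simp add: complex_eq_iff inner_complex_def)
    qed
  next
    case False
    define d where "d = bounce_dir n m"
    obtain t i where t: "d = cis t" "d = edge_normal n i" "t = \<beta> \<or> t = - \<beta>"
      using dir[of m] n0 n1 unfolding d_def by metis
    have pts: "bounce_point n m = D *\<^sub>R d - of_real r" "bounce_point n (m + 1) = - of_real r"
      "bounce_point n (m - 1) = - of_real r"
      using False by (simp_all add: bounce_point_def d_def D_def r_def)
    show ?thesis
    proof (rule that[of "r * sin t" i])
      have "\<bar>r * sin t\<bar> = r * sin \<beta>" using t(3) r(1) sin\<beta> by (auto simp: abs_mult)
      also have "\<dots> < 1 * sin \<beta>" using \<open>r < 1\<close> sin\<beta> by (intro mult_strict_right_mono)
      finally show "\<bar>r * sin t\<bar> < sin (pi / n)" by (simp add: \<beta>_def)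
      have cos: "cos t = r" using t(3) r(2) by auto
      have unit: "r\<^sup>2 + (sin t)\<^sup>2 = 1" using sin_cos_squared_add2[of t] cos by simp
      have "D *\<^sub>R cis t - of_real r = cis t * Complex r (r * sin t)"
      proof (rule complex_eqI)
        have "Re (cis t * Complex r (r * sin t)) = r * r - r * (sin t)\<^sup>2" by (simp add: cos power2_eq_square)
        also have "(sin t)\<^sup>2 = 1 - r\<^sup>2" using unit by simp
        finally show "Re (D *\<^sub>R cis t - of_real r) = Re (cis t * Complex r (r * sin t))"
          by (simp add: cos D_def power2_eq_square algebra_simps)
        show "Im (D *\<^sub>R cis t - of_real r) = Im (cis t * Complex r (r * sin t))"
          by (simp add: cos D_def power2_eq_square algebra_simps)
      qed
      then show "bounce_point n m = edge_normal n i * Complex (apothem n) (r * sin t)"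
        unfolding pts using t by (simp add: r_def)
      show "bounce_point n m - bounce_point n (m - 1) = (bounce_point n (m + 1) - bounce_point n m)
          - (2 * inner (edge_normal n i) (bounce_point n (m + 1) - bounce_point n m)) *\<^sub>R edge_normal n i"
        unfolding pts t(2) by (simp add: complex_eq_iff)
    qed
  qed
qed

lemma norm_bounce_step:
  assumes "3 \<le> n"
  shows "norm (bounce_point n (m + 1) - bounce_point n m) = apothem n + (apothem n)\<^sup>2"
proof -
  have "norm (bounce_dir n j) = 1" for j by (simp add: bounce_dir_def)
  moreover have "0 < apothem n + (apothem n)\<^sup>2" using apothem_pos[OF assms] by (simp add: add_pos_nonneg)
  ultimately show ?thesis by (cases "even m") (simp_all add: bounce_point_def)
qed

lemma bounce_point_periodic: "bounce_point n (m + 4) = bounce_point n m"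
  by (simp add: bounce_point_def bounce_dir_def)

text \<open>Within one chord the metric is Euclidean; across a bounce,
  \<open>doubled_dist_across_edge\<close> applies. By periodicity four bounces decide the scale
  \<open>\<epsilon>\<close>.\<close>

lemma bounce_curve_local_isometry:
  assumes n: "3 \<le> n" "odd n"
  shows "\<exists>\<epsilon>>0. \<forall>x y. \<bar>x - y\<bar> \<le> \<epsilon> \<longrightarrow>
    doubled_dist n (bounce_curve n x) (bounce_curve n y) = (apothem n + (apothem n)\<^sup>2) * \<bar>x - y\<bar>"
    and "bounce_curve n x \<in> doubled_points n"
    and "bounce_curve n (x + 4) = bounce_curve n x"
proof -
  define D where "D = apothem n + (apothem n)\<^sup>2"
  have D: "0 < D" using apothem_pos[OF n(1)] by (simp add: D_def add_pos_nonneg)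
  let ?b = "bounce_point n"
  have b_in: "?b m \<in> regular_polygon n" for m
    by (rule bounce_point_on_edge[OF n, of m], rule edge_point_isolated(2)[OF n(1)])
  have seg: "?b m + t *\<^sub>R (?b (m + 1) - ?b m) \<in> regular_polygon n" if "0 \<le> t" "t \<le> 1" for m t
  proof -
    have "(1 - t) *\<^sub>R ?b m + t *\<^sub>R ?b (m + 1) \<in> regular_polygon n"
      using that by (intro convexD[OF convex_regular_polygon] b_in) auto
    then show ?thesis by (simp add: algebra_simps)
  qed
  have frac: "0 \<le> frac x" "frac x \<le> 1" for x :: real by (simp_all add: frac_lt_1 less_imp_le)
  show "bounce_curve n x \<in> doubled_points n"
    unfolding bounce_curve_def by (intro doubled_point_in seg frac)
  show "bounce_curve n (x + 4) = bounce_curve n x"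
  proof -
    have "\<lfloor>x + 4\<rfloor> = \<lfloor>x\<rfloor> + 4" "frac (x + 4) = frac x" by (simp_all add: frac_def)
    moreover have "?b (\<lfloor>x\<rfloor> + 4 + 1) = ?b (\<lfloor>x\<rfloor> + 1)"
      using bounce_point_periodic[of n "\<lfloor>x\<rfloor> + 1"] by (simp add: add_ac)
    ultimately show ?thesis by (simp add: bounce_curve_def bounce_point_periodic)
  qed
  have "\<exists>\<kappa>>0. \<forall>\<alpha> \<beta> s s'. 0 \<le> \<alpha> \<longrightarrow> 0 \<le> \<beta> \<longrightarrow> \<alpha> \<le> 1 \<longrightarrow> \<beta> \<le> 1 \<longrightarrow> s \<noteq> s' \<longrightarrow> 2 * (\<alpha> + \<beta>) * D < \<kappa> \<longrightarrow>
    doubled_dist n (doubled_point n s (?b m - \<alpha> *\<^sub>R (?b m - ?b (m - 1))))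
      (doubled_point n s' (?b m + \<beta> *\<^sub>R (?b (m + 1) - ?b m))) = (\<alpha> + \<beta>) * D" for m
  proof -
    obtain i x where ix: "\<bar>x\<bar> < sin (pi / n)" "?b m = edge_normal n i * Complex (apothem n) x"
      and v: "?b m - ?b (m - 1) = (?b (m + 1) - ?b m)
        - (2 * inner (edge_normal n i) (?b (m + 1) - ?b m)) *\<^sub>R edge_normal n i"
      by (rule bounce_point_on_edge[OF n, of m])
    obtain \<kappa> where \<kappa>: "0 < \<kappa>" "\<And>j. j mod int n \<noteq> i mod int n \<Longrightarrow> \<kappa> \<le> edge_height n j (?b m)"
      using edge_point_isolated(3)[OF n(1) ix] by blast
    have nD: "norm (?b m - ?b (m - 1)) = D" "norm (?b (m + 1) - ?b m) = D"
      using norm_bounce_step[OF n(1), of "m - 1"] norm_bounce_step[OF n(1), of m] by (simp_all add: D_def)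
    show ?thesis
    proof (intro exI[of _ \<kappa>] conjI allI impI \<kappa>(1))
      fix \<alpha> \<beta> :: real and s s' :: bool assume a: "0 \<le> \<alpha>" "0 \<le> \<beta>" "\<alpha> \<le> 1" "\<beta> \<le> 1" "s \<noteq> s'" "2 * (\<alpha> + \<beta>) * D < \<kappa>"
      have "?b m - \<alpha> *\<^sub>R (?b m - ?b (m - 1)) \<in> regular_polygon n"
        using seg[of "1 - \<alpha>" "m - 1"] a by (simp add: algebra_simps)
      moreover have "?b m + \<beta> *\<^sub>R (?b (m + 1) - ?b m) \<in> regular_polygon n" using seg a by simp
      ultimately show "doubled_dist n (doubled_point n s (?b m - \<alpha> *\<^sub>R (?b m - ?b (m - 1))))
          (doubled_point n s' (?b m + \<beta> *\<^sub>R (?b (m + 1) - ?b m))) = (\<alpha> + \<beta>) * D"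
        using doubled_dist_across_edge[OF n(1) b_in edge_point_isolated(1)[OF n(1) ix] \<kappa>(2) v _ a(1,2) _ _ _ a(5)] a(6)
        by (simp add: nD)
    qed
  qed
  then obtain K where K: "\<And>m. 0 < K m"
    "\<And>m \<alpha> \<beta> s s'. \<lbrakk>0 \<le> \<alpha>; 0 \<le> \<beta>; \<alpha> \<le> 1; \<beta> \<le> 1; s \<noteq> s'; 2 * (\<alpha> + \<beta>) * D < K m\<rbrakk> \<Longrightarrow>
      doubled_dist n (doubled_point n s (?b m - \<alpha> *\<^sub>R (?b m - ?b (m - 1))))
        (doubled_point n s' (?b m + \<beta> *\<^sub>R (?b (m + 1) - ?b m))) = (\<alpha> + \<beta>) * D"
    by metis
  define \<kappa> where "\<kappa> = Min (K ` {0, 1, 2, 3})"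
  have \<kappa>: "0 < \<kappa>" using K(1) by (simp add: \<kappa>_def)
  have cross: "doubled_dist n (doubled_point n s (?b m - \<alpha> *\<^sub>R (?b m - ?b (m - 1))))
        (doubled_point n s' (?b m + \<beta> *\<^sub>R (?b (m + 1) - ?b m))) = (\<alpha> + \<beta>) * D"
    if "0 \<le> \<alpha>" "0 \<le> \<beta>" "\<alpha> \<le> 1" "\<beta> \<le> 1" "s \<noteq> s'" "2 * (\<alpha> + \<beta>) * D < \<kappa>" for m \<alpha> \<beta> s s'
  proof -
    have mod: "?b (j mod 4 + i) = ?b (j + i)" for j i
    proof -
      have "(j mod 4 + i) mod 4 = (j + i) mod 4" by (simp add: mod_add_left_eq)
      moreover have "even (j mod 4 + i) \<longleftrightarrow> even (j + i)" by presburger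
      ultimately show ?thesis by (simp add: bounce_point_def bounce_dir_def)
    qed
    have "m mod 4 \<in> {0, 1, 2, 3}" by auto
    then have "\<kappa> \<le> K (m mod 4)" unfolding \<kappa>_def by (intro Min_le) auto
    then show ?thesis
      using K(2)[of \<alpha> \<beta> s s' "m mod 4"] that mod[of m 0] mod[of m 1] mod[of m "- 1"] by simp
  qed
  \<comment> \<open>The bound \<open>1 / 2\<close> allows at most one bounce between the two
    parameters, and the other bound is the room that \<open>cross\<close> requires.\<close>
  define \<epsilon> where "\<epsilon> = min (1 / 2) (\<kappa> / (4 * D))"
  have \<epsilon>: "0 < \<epsilon>" "\<epsilon> \<le> 1 / 2" using \<kappa> D by (auto simp: \<epsilon>_def)
  have \<epsilon>\<kappa>: "2 * a * D < \<kappa>" if "a \<le> \<epsilon>" for a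
  proof -
    have "a * (2 * D) \<le> \<kappa> / (4 * D) * (2 * D)" using that D by (intro mult_right_mono) (auto simp: \<epsilon>_def)
    also have "\<dots> = \<kappa> / 2" using D by simp
    finally show ?thesis using \<kappa> by (simp add: mult_ac)
  qed
  have main: "doubled_dist n (bounce_curve n x) (bounce_curve n y) = D * (y - x)"
    if xy: "x \<le> y" "y - x \<le> \<epsilon>" for x y
  proof (cases "\<lfloor>x\<rfloor> = \<lfloor>y\<rfloor>")
    case True
    have "doubled_dist n (bounce_curve n x) (bounce_curve n y)
        = norm ((frac x - frac y) *\<^sub>R (?b (\<lfloor>x\<rfloor> + 1) - ?b \<lfloor>x\<rfloor>))"
      unfolding bounce_curve_def True[symmetric] doubled_dist_same_sheet[OF seg[OF frac] seg[OF frac]]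
      by (simp add: dist_norm scaleR_left_diff_distrib)
    also have "\<dots> = \<bar>frac x - frac y\<bar> * D" using norm_bounce_step[OF n(1)] by (simp add: D_def)
    also have "frac x - frac y = x - y" using True by (simp add: frac_def)
    finally show ?thesis using xy by simp
  next
    case False
    define m where "m = \<lfloor>y\<rfloor>"
    have "\<lfloor>x\<rfloor> \<le> \<lfloor>y\<rfloor>" "y < x + 1" using xy \<epsilon> by (auto intro: floor_mono)
    then have mx: "\<lfloor>x\<rfloor> = m - 1" using False unfolding m_def by linarith
    define \<alpha> \<beta> where "\<alpha> = m - x" and "\<beta> = y - m"
    have ab: "0 \<le> \<alpha>" "0 \<le> \<beta>" "\<alpha> + \<beta> = y - x" using mx unfolding \<alpha>_def \<beta>_def m_def by linarith+
    then have ab1: "\<alpha> \<le> 1" "\<beta> \<le> 1" using xy \<epsilon> by linarith+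
    have fr: "\<alpha> = 1 - frac x" "\<beta> = frac y" using mx by (simp_all add: frac_def \<alpha>_def \<beta>_def m_def)
    have "bounce_curve n x = doubled_point n (even (m - 1)) (?b m - \<alpha> *\<^sub>R (?b m - ?b (m - 1)))"
      "bounce_curve n y = doubled_point n (even m) (?b m + \<beta> *\<^sub>R (?b (m + 1) - ?b m))"
      unfolding bounce_curve_def mx m_def[symmetric] fr by (simp_all add: algebra_simps)
    then show ?thesis
      using cross[of \<alpha> \<beta> "even (m - 1)" "even m" m] ab ab1 \<epsilon>\<kappa>[of "\<alpha> + \<beta>"] xy by simp
  qed
  have "doubled_dist n (bounce_curve n x) (bounce_curve n y) = D * \<bar>x - y\<bar>" if "\<bar>x - y\<bar> \<le> \<epsilon>" for x y
    using main[of x y] main[of y x] that Metric_space.commute[OF Metric_space_doubled, of n "bounce_curve n x" "bounce_curve n y"]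
    by (cases "x \<le> y") auto
  then show "\<exists>\<epsilon>>0. \<forall>x y. \<bar>x - y\<bar> \<le> \<epsilon> \<longrightarrow>
    doubled_dist n (bounce_curve n x) (bounce_curve n y) = (apothem n + (apothem n)\<^sup>2) * \<bar>x - y\<bar>"
    using \<epsilon> unfolding D_def by blast
qed

lemma ex_one_over_geodesic:
  assumes n: "3 \<le> n" "odd n"
  shows "\<exists>k\<ge>2. \<exists>\<gamma>. one_over_geodesic (doubled_polygon n) k \<gamma>"
proof -
  define D where "D = apothem n + (apothem n)\<^sup>2"
  have D: "0 < D" using apothem_pos[OF n(1)] by (simp add: D_def add_pos_nonneg)
  obtain \<epsilon> where \<epsilon>: "0 < \<epsilon>"
    "\<And>x y. \<bar>x - y\<bar> \<le> \<epsilon> \<Longrightarrow> doubled_dist n (bounce_curve n x) (bounce_curve n y) = D * \<bar>x - y\<bar>"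
    using bounce_curve_local_isometry(1)[OF n] unfolding D_def by blast
  \<comment> \<open>The factor \<open>2 / pi\<close> turns the period 4 of the bounce parameter into
    \<open>2 * pi\<close>.\<close>
  define \<gamma> where "\<gamma> t = bounce_curve n (2 / pi * t)" for t
  have "\<exists>k\<ge>2. one_over_geodesic (doubled_polygon n) k \<gamma>"
  proof (rule one_over_geodesic_of_local_isometry)
    show "0 < D * (2 / pi)" "0 < pi / 2 * \<epsilon>" using D \<epsilon>(1) by simp_all
    show "\<gamma> t \<in> mspace (doubled_polygon n)" for t
      using bounce_curve_local_isometry(2)[OF n] by (simp add: \<gamma>_def)
    show "\<gamma> (t + 2 * pi) = \<gamma> t" for t
      using bounce_curve_local_isometry(3)[OF n, of "2 / pi * t"] by (simp add: \<gamma>_def distrib_left)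
    show "mdist (doubled_polygon n) (\<gamma> s) (\<gamma> t) = D * (2 / pi) * \<bar>s - t\<bar>"
      if "\<bar>s - t\<bar> \<le> pi / 2 * \<epsilon>" for s t
    proof -
      have "2 / pi * s - 2 / pi * t = 2 / pi * (s - t)" by (simp only: right_diff_distrib)
      then have "\<bar>2 / pi * s - 2 / pi * t\<bar> = 2 / pi * \<bar>s - t\<bar>" by (simp only: abs_mult) simp
      moreover have "2 / pi * \<bar>s - t\<bar> \<le> 2 / pi * (pi / 2 * \<epsilon>)" using that by (intro mult_left_mono) auto
      ultimately show ?thesis using \<epsilon>(2)[of "2 / pi * s" "2 / pi * t"] by (simp add: \<gamma>_def)
    qed
  qed
  then show ?thesis by blast
qed

section \<open>The minimizing index\<close>

text \<open>Dividing the parameter by the speed \<open>c\<close> gives a unit-speed lift as in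
  \<open>polygon_geodesic\<close>, with \<open>l = c * (2 * pi / k)\<close>; once
  \<open>pi / p\<close> is small, \<open>not_prime_of_small_angle\<close> applies.\<close>

lemma eventually_no_one_over_geodesic:
  assumes k: "2 \<le> k"
  shows "\<forall>\<^sub>F p in at_top. prime p \<longrightarrow> (\<nexists>\<gamma>. one_over_geodesic (doubled_polygon p) k \<gamma>)"
  using eventually_small_angle[OF k refl refl] eventually_gt_at_top[of k]
proof eventually_elim
  case (elim p)
  show ?case
  proof (intro impI notI)
    assume p: "prime p" and "\<exists>\<gamma>. one_over_geodesic (doubled_polygon p) k \<gamma>"
    then obtain \<gamma> where "one_over_geodesic (doubled_polygon p) k \<gamma>" by blast
    then obtain c where c: "0 < c" "\<And>t. \<gamma> t \<in> doubled_points p" "\<And>t. \<gamma> (t + 2 * pi) = \<gamma> t"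
      "\<And>s t. \<bar>s - t\<bar> \<le> 2 * pi / k \<Longrightarrow> doubled_dist p (\<gamma> s) (\<gamma> t) = c * \<bar>s - t\<bar>"
      using one_over_geodesic_mdist[of "doubled_polygon p" k \<gamma>] k by auto
    have "\<exists>s z. z \<in> regular_polygon p \<and> \<gamma> (t / c) = doubled_point p s z" for t
      using c(2) by (metis doubled_points_cases)
    then obtain s z where sz: "\<And>t. z t \<in> regular_polygon p" "\<And>t. \<gamma> (t / c) = doubled_point p (s t) (z t)"
      by metis
    interpret polygon_geodesic p k "c * (2 * pi / k)" s z
    proof
      show "3 \<le> p" using k elim by simp
      show "0 < c * (2 * pi / k)" using c(1) k by simp
      show "doubled_dist p (doubled_point p (s t) (z t)) (doubled_point p (s u) (z u)) = \<bar>t - u\<bar>"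
        if "\<bar>t - u\<bar> \<le> c * (2 * pi / k)" for t u
      proof -
        have eq: "\<bar>t / c - u / c\<bar> = \<bar>t - u\<bar> / c" using c(1) by (simp flip: diff_divide_distrib)
        also have "\<dots> \<le> 2 * pi / k" using that c(1) by (simp add: field_simps)
        finally show ?thesis using c(4)[of "t / c" "u / c"] c(1) unfolding sz(2)[symmetric] eq by simp
      qed
      show "doubled_point p (s (t + k * (c * (2 * pi / k)))) (z (t + k * (c * (2 * pi / k))))
          = doubled_point p (s t) (z t)" for t
        using c(3)[of "t / c"] c(1) k unfolding sz(2)[symmetric] by (simp add: add_divide_distrib)
    qed (use sz k in auto)
    show False
      using not_prime_of_small_angle[OF p _ refl refl] elim by blast
  qed
qed

theorem theorem1p3:
  shows "filterlim (\<lambda>p::nat. minind (doubled_polygon p)) at_top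
           (inf at_top (principal {p. prime p}))"
  unfolding filterlim_at_top eventually_inf_principal
proof
  fix Z :: nat
  \<comment> \<open>The threshold on \<open>p\<close> depends on \<open>k\<close>; only finitely
    many \<open>k\<close> below \<open>Z\<close> must be excluded.\<close>
  have "\<forall>\<^sub>F p in at_top. \<forall>k\<in>{2..<Z}. prime p \<longrightarrow> (\<nexists>\<gamma>. one_over_geodesic (doubled_polygon p) k \<gamma>)"
    by (intro eventually_ball_finite ballI eventually_no_one_over_geodesic) auto
  then show "\<forall>\<^sub>F p in at_top. p \<in> {p. prime p} \<longrightarrow> Z \<le> minind (doubled_polygon p)"
    using eventually_ge_at_top[of 3]
  proof eventually_elim
    case (elim p)
    show ?case
    proof
      assume "p \<in> {p. prime p}"
      then have p: "prime p" by simp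
      have "odd p" using prime_odd_nat[OF p] elim(2) by simp
      \<comment> \<open>Without this, \<open>minind\<close> would be an unspecified number that does not depend on \<open>p\<close>.\<close>
      then have "\<exists>k. 2 \<le> k \<and> (\<exists>\<gamma>. one_over_geodesic (doubled_polygon p) k \<gamma>)"
        using ex_one_over_geodesic[OF elim(2)] by blast
      then have "2 \<le> minind (doubled_polygon p) \<and> (\<exists>\<gamma>. one_over_geodesic (doubled_polygon p) (minind (doubled_polygon p)) \<gamma>)"
        unfolding minind_def by (rule LeastI_ex)
      then show "Z \<le> minind (doubled_polygon p)" using elim(1) p by (metis atLeastLessThan_iff linorder_not_le)
    qed
  qed
qed

end
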